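(* Let $\epsilon,\delta\in(0,1)$, $\gamma\in(0,1)$, and let the policies satisfy $B<\infty$. Suppose that almost surely there are no ties among the non-conformity scores $\tau_i$. Then for any $\Delta_\epsilon\in(0,\epsilon)$ and any $n\ge1$, the interval $\hat C_{\tilde\tau}$ produced by the known-behavior-policy procedure described in the context satisfies $$\mathbb P\big[\epsilon-\Delta_\epsilon< L_{P^{\pi_e}}(\hat C_{\tilde\tau})\le \epsilon\big]\ >\ 1-\delta-\frac{C}{\sqrt n},$$ where $$C=\frac{7B}{\sqrt{\gamma(\epsilon-\Delta_\epsilon)(1-\epsilon+\Delta_\epsilon)}}+\frac{(\sqrt{-2\log\delta}+1)B}{2\Delta_\epsilon\sqrt\gamma}+(1-\delta)\Big(\sqrt{\lfloor m_1/\gamma\rfloor\, B}+\frac B2\Big),$$ $m_1=\max\big\{m_0,\ \frac{\log\delta}{-2\Delta_\epsilon^2}\big\}$ and $m_0=\log_{1-\epsilon}\delta$.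
   Context: Setting. $\mathcal S$ (contexts) and $\mathcal A$ (actions) are measurable spaces; rewards are real. A policy $\pi$ maps each $s\in\mathcal S$ to a probability distribution $\pi(\cdot\mid s)$ on $\mathcal A$; $\pi(a\mid s)$ denotes its density (or mass function) with respect to a fixed reference measure $\mathrm da$. $P_S$ is a distribution on $\mathcal S$ and $P_R(\cdot\mid s,a)$ is a conditional reward distribution on $\mathbb R$. The behavior policy $\pi_b$ and the target policy $\pi_e$ are given. The data $\mathcal D=\{(S_i,A_i,R_i)\}_{i=1}^n$ are i.i.d. with $S_i\sim P_S$, $A_i\mid S_i\sim \pi_b(\cdot\mid S_i)$, $R_i\mid (S_i,A_i)\sim P_R(\cdot\mid S_i,A_i)$. The target distribution $P^{\pi_e}$ on $\mathcal S\times\mathbb R$ is the law of $(S,R)$ when $S\sim P_S$, $A\mid S\sim\pi_e(\cdot\mid S)$, $R\mid(S,A)\sim P_R(\cdot\mid S,A)$. The test pair $(S_{n+1},R_{n+1})\sim P^{\pi_e}$ is independent of everything used to build the interval. Put $w(s,a)=\pi_e(a\mid s)/\pi_b(a\mid s)$, with $w(s,a)=0$ if $\pi_e(a\mid s)=\pi_b(a\mid s)=0$, and $B=\inf\{b:\pi_e(a\mid s)\le b\,\pi_b(a\mid s)\text{ for all }(s,a)\}$. Known-behavior-policy procedure. 1. Rejection sampling: let $V_1,\dots,V_n$ be i.i.d. uniform on $[0,1]$, independent of $\mathcal D$. Let $\mathcal D_{\mathrm{rs}}$ consist of the pairs $(S_i,R_i)$ with $V_i\le w(S_i,A_i)/B$,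 listed in increasing order of $i$; $N_{\mathrm{rs}}$ is their number. 2. Split: $\mathcal D_{\mathrm{rs}}$ is split into $\mathcal D^{\mathrm{rs}}_1$ (training) of size $N_{\mathrm{rs}}-M$ and $\mathcal D^{\mathrm{rs}}_2$ (calibration) of size $M=\lceil\gamma N_{\mathrm{rs}}\rceil$; the choice of positions does not depend on the values of the data points. 3. Training: fix quantile levels $\epsilon_{\mathrm{lo}},\epsilon_{\mathrm{up}}\in[0,1]$ with $\epsilon_{\mathrm{up}}-\epsilon_{\mathrm{lo}}=1-\epsilon$. An arbitrary fixed algorithm without extra randomness maps $\mathcal D^{\mathrm{rs}}_1$ to measurable functions $\hat q_{\epsilon_{\mathrm{lo}}},\hat q_{\epsilon_{\mathrm{up}}}:\mathcal S\to\mathbb R$ (estimates of the conditional quantiles of $R$ given $S$). For $\tau\in\mathbb R\cup\{\infty\}$ put $\hat C_\tau(s)=[\hat q_{\epsilon_{\mathrm{lo}}}(s)-\tau,\ \hat q_{\epsilon_{\mathrm{up}}}(s)+\tau]$ (empty if the lower endpoint exceeds the upper; equal to $\mathbb R$ if $\tau=\infty$). 4. Calibration: for $(S_i,R_i)\in\mathcal D^{\mathrm{rs}}_2$ put $\tau_i=\max\{\hat q_{\epsilon_{\mathrm{lo}}}(S_i)-R_i,\ R_i-\hat q_{\epsilon_{\mathrm{up}}}(S_i)\}$; let $\tau_{(1)}\le\dots\le\tau_{(M)}$ be the ordered values and $\tau_{(M+1)}=\infty$. With $F_{\mathrm{Bin}(M,\epsilon)}$ the binomial c.d.f., let $k(M,\epsilon,\delta)=\max\{k\in\{-1,0,\dots,M-1\}: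 F_{\mathrm{Bin}(M,\epsilon)}(k)\le\delta\}$ (where $F_{\mathrm{Bin}(M,\epsilon)}(-1)=0$). Set $\tilde\tau=\tau_{(M-k(M,\epsilon,\delta))}$. The output is $\hat C_{\tilde\tau}$. Miscoverage. $L_{P^{\pi_e}}(\hat C)$ is the conditional probability that $R_{n+1}\notin\hat C(S_{n+1})$ given everything used to construct $\hat C$ (i.e. $\mathcal D$, the $V_i$ and the split); it is a random variable. The outer probability $\mathbb P$ is over all this randomness. *)

theory Defs
  imports "HOL-Probability.Probability"
begin

text \<open>Measurable spaces of contexts and of actions are those underlying the context law \<open>PS\<close> and
  the reference measure \<open>da\<close>. A policy is a Markov kernel from contexts to actions given by a
  density with respect to \<open>da\<close>; no \<open>\<sigma>\<close>-finiteness of \<open>da\<close> is needed, because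
  measurability of the kernel is required directly.\<close>

definition is_policy :: "'s measure \<Rightarrow> 'a measure \<Rightarrow> ('s \<Rightarrow> 'a \<Rightarrow> real) \<Rightarrow> bool" where
  "is_policy PS da p \<longleftrightarrow>
     (\<lambda>(s, a). p s a) \<in> borel_measurable (PS \<Otimes>\<^sub>M da) \<and>
     (\<forall>s\<in>space PS. \<forall>a\<in>space da. 0 \<le> p s a) \<and>
     (\<lambda>s. density da (\<lambda>a. ennreal (p s a))) \<in> PS \<rightarrow>\<^sub>M prob_algebra da"

definition joint_law ::
  "'s measure \<Rightarrow> 'a measure \<Rightarrow> ('s \<Rightarrow> 'a \<Rightarrow> real measure) \<Rightarrow> ('s \<Rightarrow> 'a \<Rightarrow> real)
     \<Rightarrow> ('s \<times> 'a \<times> real) measure" where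
  "joint_law PS da PR p =
     PS \<bind> (\<lambda>s. density da (\<lambda>a. ennreal (p s a)) \<bind>
       (\<lambda>a. PR s a \<bind> (\<lambda>r. return (PS \<Otimes>\<^sub>M da \<Otimes>\<^sub>M borel) (s, a, r))))"

definition context_reward_law ::
  "'s measure \<Rightarrow> 'a measure \<Rightarrow> ('s \<Rightarrow> 'a \<Rightarrow> real measure) \<Rightarrow> ('s \<Rightarrow> 'a \<Rightarrow> real)
     \<Rightarrow> ('s \<times> real) measure" where
  "context_reward_law PS da PR p =
     distr (joint_law PS da PR p) (PS \<Otimes>\<^sub>M borel) (\<lambda>(s, a, r). (s, r))"

text \<open>Division by zero yields \<open>0\<close>, which gives the convention \<open>0 / 0 = 0\<close>. A zero denominator with
  a nonzero numerator is excluded as soon as \<open>ratio_bound\<close> below is finite.\<close>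

definition weight :: "('s \<Rightarrow> 'a \<Rightarrow> real) \<Rightarrow> ('s \<Rightarrow> 'a \<Rightarrow> real) \<Rightarrow> 's \<Rightarrow> 'a \<Rightarrow> real" where
  "weight pe pb s a = pe s a / pb s a"

text \<open>The infimum is \<open>\<infinity>\<close> if there is no admissible real bound.\<close>

definition ratio_bound ::
  "'s measure \<Rightarrow> 'a measure \<Rightarrow> ('s \<Rightarrow> 'a \<Rightarrow> real) \<Rightarrow> ('s \<Rightarrow> 'a \<Rightarrow> real) \<Rightarrow> ereal" where
  "ratio_bound PS da pe pb =
     Inf (ereal ` {b. \<forall>s\<in>space PS. \<forall>a\<in>space da. pe s a \<le> b * pb s a})"

text \<open>Sample indices are \<open>0, \<dots>, n - 1\<close>. Positions in the resulting list start at \<open>0\<close> too.\<close>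

definition rejection_sample ::
  "('s \<Rightarrow> 'a \<Rightarrow> real) \<Rightarrow> real \<Rightarrow> nat \<Rightarrow> (nat \<Rightarrow> 's) \<Rightarrow> (nat \<Rightarrow> 'a) \<Rightarrow> (nat \<Rightarrow> real) \<Rightarrow> (nat \<Rightarrow> real)
     \<Rightarrow> ('s \<times> real) list" where
  "rejection_sample w B n s a r v =
     map (\<lambda>i. (s i, r i)) (filter (\<lambda>i. v i \<le> w (s i) (a i) / B) [0..<n])"

definition binomial_cdf :: "nat \<Rightarrow> real \<Rightarrow> int \<Rightarrow> real" where
  "binomial_cdf m \<epsilon> k = measure_pmf.prob (binomial_pmf m \<epsilon>) {j. int j \<le> k}"

definition k_index :: "nat \<Rightarrow> real \<Rightarrow> real \<Rightarrow> int" where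
  "k_index m \<epsilon> \<delta> = Max {k \<in> {-1..int m - 1}. binomial_cdf m \<epsilon> k \<le> \<delta>}"

definition score :: "('s \<Rightarrow> real) \<Rightarrow> ('s \<Rightarrow> real) \<Rightarrow> 's \<times> real \<Rightarrow> real" where
  "score lo up = (\<lambda>(s, r). max (lo s - r) (r - up s))"

text \<open>Order statistics are numbered from \<open>1\<close>; the one numbered \<open>length xs + 1\<close> is \<open>\<infinity>\<close>.\<close>

definition order_statistic :: "real list \<Rightarrow> nat \<Rightarrow> ereal" where
  "order_statistic xs j = (if j \<le> length xs then ereal (sort xs ! (j - 1)) else \<infinity>)"

definition threshold :: "real \<Rightarrow> real \<Rightarrow> real list \<Rightarrow> ereal" where
  "threshold \<epsilon> \<delta> xs =
     order_statistic xs (nat (int (length xs) - k_index (length xs) \<epsilon> \<delta>))"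

definition band :: "('s \<Rightarrow> real) \<Rightarrow> ('s \<Rightarrow> real) \<Rightarrow> ereal \<Rightarrow> 's \<Rightarrow> real set" where
  "band lo up t s = {r. ereal (lo s) - t \<le> ereal r \<and> ereal r \<le> ereal (up s) + t}"

text \<open>A training algorithm \<open>qhat\<close> takes a quantile level and the training data. The set \<open>T\<close> holds
  the calibration positions in the list \<open>xs\<close>; the other positions are used for training.\<close>

definition calibration_scores ::
  "(real \<Rightarrow> ('s \<times> real) list \<Rightarrow> 's \<Rightarrow> real) \<Rightarrow> real \<Rightarrow> real \<Rightarrow> nat set \<Rightarrow> ('s \<times> real) list
     \<Rightarrow> real list" where
  "calibration_scores qhat \<epsilon>lo \<epsilon>up T xs =
     map (score (qhat \<epsilon>lo (nths xs (- T))) (qhat \<epsilon>up (nths xs (- T)))) (nths xs T)"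

definition conformal_interval ::
  "(real \<Rightarrow> ('s \<times> real) list \<Rightarrow> 's \<Rightarrow> real) \<Rightarrow> real \<Rightarrow> real \<Rightarrow> real \<Rightarrow> real \<Rightarrow> nat set
     \<Rightarrow> ('s \<times> real) list \<Rightarrow> 's \<Rightarrow> real set" where
  "conformal_interval qhat \<epsilon>lo \<epsilon>up \<epsilon> \<delta> T xs =
     band (qhat \<epsilon>lo (nths xs (- T))) (qhat \<epsilon>up (nths xs (- T)))
       (threshold \<epsilon> \<delta> (calibration_scores qhat \<epsilon>lo \<epsilon>up T xs))"

text \<open>Measurability of the training algorithm jointly in the training data and the context, for
  every size of the training set; this is what makes the miscoverage a random variable.\<close>

definition measurable_algorithm ::
  "'s measure \<Rightarrow> (('s \<times> real) list \<Rightarrow> 's \<Rightarrow> real) \<Rightarrow> bool" where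
  "measurable_algorithm PS q \<longleftrightarrow>
     (\<forall>m. (\<lambda>(x, s). q (map x [0..<m]) s)
        \<in> borel_measurable ((\<Pi>\<^sub>M j\<in>{..<m}. PS \<Otimes>\<^sub>M borel) \<Otimes>\<^sub>M PS))"

text \<open>The split \<open>T\<close> may be random, but given the length of the sample \<open>X\<close> it is conditionally
  independent of the values in \<open>X\<close>.\<close>

definition value_independent_split ::
  "'w measure \<Rightarrow> 'x measure \<Rightarrow> ('w \<Rightarrow> 'x list) \<Rightarrow> ('w \<Rightarrow> nat set) \<Rightarrow> bool" where
  "value_independent_split M K X T \<longleftrightarrow>
     (\<forall>N J. \<forall>E\<in>sets (\<Pi>\<^sub>M j\<in>{..<N}. K).
        \<P>(\<omega> in M. T \<omega> = J \<and> (\<lambda>j\<in>{..<N}. X \<omega> ! j) \<in> E \<bar> length (X \<omega>) = N) =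
        \<P>(\<omega> in M. T \<omega> = J \<bar> length (X \<omega>) = N) *
        \<P>(\<omega> in M. (\<lambda>j\<in>{..<N}. X \<omega> ! j) \<in> E \<bar> length (X \<omega>) = N))"

text \<open>The library constant \<open>indep_var\<close> requires both variables to have the same type.\<close>

definition independent_rvs ::
  "'w measure \<Rightarrow> 'x measure \<Rightarrow> ('w \<Rightarrow> 'x) \<Rightarrow> 'y measure \<Rightarrow> ('w \<Rightarrow> 'y) \<Rightarrow> bool" where
  "independent_rvs M K X K' Y \<longleftrightarrow>
     X \<in> M \<rightarrow>\<^sub>M K \<and> Y \<in> M \<rightarrow>\<^sub>M K' \<and>
     prob_space.indep_set M (sets (vimage_algebra (space M) X K)) (sets (vimage_algebra (space M) Y K'))"

text \<open>Conditional probability, given the variable \<open>Y\<close>, that \<open>r\<close> falls outside the random set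
  \<open>C\<close> at \<open>s\<close>.\<close>

definition cond_miscoverage ::
  "'w measure \<Rightarrow> 'y measure \<Rightarrow> ('w \<Rightarrow> 'y) \<Rightarrow> ('w \<Rightarrow> 's \<Rightarrow> real set) \<Rightarrow> ('w \<Rightarrow> 's) \<Rightarrow> ('w \<Rightarrow> real)
     \<Rightarrow> 'w \<Rightarrow> real" where
  "cond_miscoverage M K Y C s r =
     real_cond_exp M (vimage_algebra (space M) Y K)
       (indicator {\<omega> \<in> space M. r \<omega> \<notin> C \<omega> (s \<omega>)})"

end

theory Submission
  imports Defs
begin

text \<open>Given the number of accepted points and the split, the accepted points are i.i.d. from the
  target law. Given the training points as well, the miscoverage of the calibrated interval is at
  most \<open>a\<close> iff at least \<open>k + 1\<close> of the \<open>m\<close> calibration scores have survival probability at most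
  \<open>a\<close>; for an atomless score law this is a tail event of the binomial distribution with parameters
  \<open>m\<close> and \<open>a\<close>. The choice of \<open>k\<close> makes its probability at least \<open>1 - \<delta>\<close> for \<open>a = \<epsilon>\<close>, and Hoeffding's
  inequality makes it \<open>O (1 / sqrt m)\<close> for \<open>a = \<epsilon> - \<Delta>\<close>. Absence of ties forces the score law to be
  atomless only if \<open>m \<ge> 2\<close>; for \<open>m = 1\<close> the bound is trivial. Finally \<open>m \<ge> \<gamma> N\<close> where \<open>N\<close> is binomial
  with parameters \<open>n\<close> and \<open>1 / B\<close>, and the mean of \<open>1 / sqrt N\<close> on \<open>N \<ge> 1\<close> is at most \<open>B / sqrt n\<close>.\<close>

subsection \<open>Inverse moments of the binomial distribution\<close>

text \<open>The split is random and tied to the data only through conditional independence given the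
  sample size. The argument therefore runs over the joint masses \<open>q l J\<close> of the events
  that \<open>l\<close> points are accepted and the split is \<open>J\<close>. Identities are stated
  as products with this mass, so null events cause no trouble, and the tie hypothesis, which
  concerns the experiment, passes to the product of target laws precisely where
  \<open>q l J \<noteq> 0\<close>. Coverage from both sides needs the exact law of the event that
  the miscoverage is at most \<open>a\<close>, not an estimate, because the two-sided event is a
  difference of two such events. Exactness comes from uniform survival values, which is why atoms
  have to be excluded. About \<open>n / B\<close> points are accepted, so \<open>sqrt B\<close>
  would be the natural factor in the mean of \<open>1 / sqrt N\<close>. The constant has
  \<open>B\<close> instead, and this slack permits an elementary bound valid for every
  \<open>n \<ge> 1\<close>. In \<open>C\<close>, the term with \<open>7 * B\<close> pays for the
  case of a single calibration point and \<open>B / 2\<close> for an empty sample.\<close>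

lemma pmf_binomial_rec_divide:
  assumes "0 \<le> p" "p \<le> 1" "1 \<le> l"
  shows "pmf (binomial_pmf (Suc n) p) l / real l
    = pmf (binomial_pmf (Suc n) p) l / real (Suc n) + (1 - p) * (pmf (binomial_pmf n p) l / real l)"
proof (cases "l \<le> n")
  case True
  have e: "real (Suc n choose l) * real (Suc n - l) = real (Suc n) * real (n choose l)"
  proof -
    have "(Suc n choose l) * (Suc n - l) = Suc n * (n choose l)"
      using binomial_absorb_comp[of "Suc n" l] by (simp add: mult.commute)
    thus ?thesis by (metis of_nat_mult)
  qed
  \<comment> \<open>Since \<open>1 / l - 1 / (n + 1) = (n + 1 - l) / (l * (n + 1))\<close>, the
    factor \<open>n + 1 - l\<close> lowers the binomial coefficient from \<open>n + 1\<close> to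
    \<open>n\<close>. Summed over \<open>l\<close>, this links consecutive inverse moments.\<close>
  have "real (Suc n choose l) / real l - real (Suc n choose l) / real (Suc n)
      = real (Suc n choose l) * real (Suc n - l) / (real l * real (Suc n))"
    using True assms by (simp add: field_simps of_nat_diff)
  also have "\<dots> = real (n choose l) / real l"
    unfolding e using assms by simp
  finally have c: "real (Suc n choose l) / real l
      = real (Suc n choose l) / real (Suc n) + real (n choose l) / real l" by simp
  define X where "X = p ^ l * (1 - p) ^ (n - l)"
  have "Suc n - l = Suc (n - l)" using True by simp
  then have a: "pmf (binomial_pmf (Suc n) p) l = real (Suc n choose l) * (X * (1 - p))"
    and b: "pmf (binomial_pmf n p) l = real (n choose l) * X"
    using assms by (simp_all add: X_def)
  have "real (Suc n choose l) * (X * (1 - p)) / real l = (real (Suc n choose l) / real l) * (X * (1 - p))"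
    by simp
  also have "\<dots> = real (Suc n choose l) * (X * (1 - p)) / real (Suc n)
      + (1 - p) * (real (n choose l) * X / real l)"
    unfolding c by (simp add: distrib_right distrib_left mult_ac del: binomial_Suc_Suc of_nat_Suc)
  finally show ?thesis unfolding a b .
next
  case False
  then show ?thesis
    by (cases "l = Suc n") (use assms in \<open>auto simp: binomial_eq_0\<close>)
qed

lemma sum_pmf_binomial:
  assumes "0 \<le> p" "p \<le> 1"
  shows "(\<Sum>l\<le>n. pmf (binomial_pmf n p) l) = 1"
proof -
  have "set_pmf (binomial_pmf n p) \<subseteq> {..n}"
    using assms by (auto simp: set_pmf_binomial_eq split: if_splits)
  then show ?thesis by (intro sum_pmf_eq_1) auto
qed

lemma sum_pmf_binomial_pos_le:
  assumes "0 \<le> p" "p \<le> 1"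
  shows "(\<Sum>l=1..n. pmf (binomial_pmf n p) l) \<le> 1"
proof -
  have "(\<Sum>l=1..n. pmf (binomial_pmf n p) l) \<le> (\<Sum>l\<le>n. pmf (binomial_pmf n p) l)"
    by (intro sum_mono2) auto
  then show ?thesis using sum_pmf_binomial[OF assms] by simp
qed

text \<open>Absorption, \<open>(n choose l) / (l + 1) = (n + 1 choose l + 1) / (n + 1)\<close>,
  turns each term into a binomial probability for \<open>n + 1\<close> trials divided by
  \<open>(n + 1) * p\<close>, and these probabilities sum to at most one.\<close>

lemma sum_pmf_binomial_inverse_Suc_le:
  assumes "0 < p" "p \<le> 1"
  shows "(\<Sum>l\<le>n. pmf (binomial_pmf n p) l / real (Suc l)) \<le> 1 / (real (Suc n) * p)"
proof -
  have eq: "pmf (binomial_pmf n p) l / real (Suc l)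
      = pmf (binomial_pmf (Suc n) p) (Suc l) / (real (Suc n) * p)" for l
  proof -
    have "real (Suc l) * real (Suc n choose Suc l) = real (Suc n) * real (n choose l)"
      by (metis Suc_times_binomial of_nat_mult)
    then have "real (n choose l) / real (Suc l) = real (Suc n choose Suc l) / real (Suc n)"
      by (simp add: field_simps del: binomial_Suc_Suc)
    then have "real (n choose l) * (p ^ l * (1 - p) ^ (n - l)) / real (Suc l)
      = real (Suc n choose Suc l) * (p ^ l * (1 - p) ^ (n - l)) / real (Suc n)"
      by (metis times_divide_eq_left)
    moreover have "pmf (binomial_pmf (Suc n) p) (Suc l)
      = p * (real (Suc n choose Suc l) * (p ^ l * (1 - p) ^ (n - l)))"
      using assms by (simp del: binomial_Suc_Suc)
    ultimately show ?thesis using assms by (simp del: binomial_Suc_Suc of_nat_Suc add: mult.assoc)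
  qed
  have "(\<Sum>l\<le>n. pmf (binomial_pmf (Suc n) p) (Suc l)) \<le> (\<Sum>l\<le>Suc n. pmf (binomial_pmf (Suc n) p) l)"
    by (subst sum.atMost_Suc_shift) simp
  also have "\<dots> = 1" using assms by (intro sum_pmf_binomial) auto
  finally show ?thesis
    unfolding eq sum_divide_distrib[symmetric] using assms by (simp add: divide_right_mono)
qed

text \<open>The target \<open>1 / (n * p\<^sup>2)\<close> exceeds the natural order
  \<open>1 / (n * p)\<close> by the factor \<open>1 / p\<close>. For \<open>p \<le> 1 / 2\<close>
  this pays for the factor two in \<open>1 / l \<le> 2 / (l + 1)\<close>. For larger
  \<open>p\<close> there is no such room, with equality at \<open>p = 1\<close>, and induction on
  \<open>n\<close> along the recursion takes over.\<close>

lemma sum_pmf_binomial_inverse_le: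
  assumes "0 < p" "p \<le> 1" "1 \<le> n"
  shows "(\<Sum>l=1..n. pmf (binomial_pmf n p) l / real l) \<le> 1 / (real n * p\<^sup>2)"
proof (cases "p \<le> 1 / 2")
  case True
  have "(\<Sum>l=1..n. pmf (binomial_pmf n p) l / real l)
      \<le> (\<Sum>l=1..n. 2 * (pmf (binomial_pmf n p) l / real (Suc l)))"
  proof (intro sum_mono)
    fix l assume "l \<in> {1..n}"
    then have "1 / real l \<le> 2 / real (Suc l)" by (simp add: field_simps)
    from mult_left_mono[OF this, of "pmf (binomial_pmf n p) l"]
    show "pmf (binomial_pmf n p) l / real l \<le> 2 * (pmf (binomial_pmf n p) l / real (Suc l))"
      by (simp add: mult.commute)
  qed
  also have "\<dots> \<le> (\<Sum>l\<le>n. 2 * (pmf (binomial_pmf n p) l / real (Suc l)))"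
    by (intro sum_mono2) auto
  also have "\<dots> \<le> 2 * (1 / (real (Suc n) * p))"
    unfolding sum_distrib_left[symmetric]
    using sum_pmf_binomial_inverse_Suc_le[of p n] assms by simp
  also have "\<dots> \<le> 1 / (real n * p\<^sup>2)"
  proof -
    have "2 * p * real n \<le> 1 * real n" using True by (intro mult_right_mono) auto
    then have "2 * p * real n \<le> real (Suc n)" by simp
    then have "2 * (real n * p\<^sup>2) \<le> real (Suc n) * p"
      using assms mult_right_mono[of "2 * p * real n" "real (Suc n)" p]
      by (simp add: power2_eq_square mult_ac del: of_nat_Suc)
    then show ?thesis using assms by (simp add: divide_simps)
  qed
  finally show ?thesis .
next
  case False
  let ?f = "\<lambda>n. \<Sum>l=1..n. pmf (binomial_pmf n p) l / real l"
  have rec: "?f (Suc n) \<le> 1 / real (Suc n) + (1 - p) * ?f n" for n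
  proof -
    have "?f (Suc n) = (\<Sum>l=1..Suc n. pmf (binomial_pmf (Suc n) p) l / real (Suc n)
        + (1 - p) * (pmf (binomial_pmf n p) l / real l))"
      using assms by (intro sum.cong refl pmf_binomial_rec_divide) auto
    also have "\<dots> = (\<Sum>l=1..Suc n. pmf (binomial_pmf (Suc n) p) l) / real (Suc n)
        + (1 - p) * (\<Sum>l=1..Suc n. pmf (binomial_pmf n p) l / real l)"
      by (simp only: sum.distrib sum_distrib_left sum_divide_distrib)
    also have "(\<Sum>l=1..Suc n. pmf (binomial_pmf n p) l / real l) = ?f n"
      using assms by (simp add: binomial_eq_0)
    also have "(\<Sum>l=1..Suc n. pmf (binomial_pmf (Suc n) p) l) / real (Suc n) \<le> 1 / real (Suc n)"
      using assms by (intro divide_right_mono sum_pmf_binomial_pos_le) auto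
    finally show ?thesis by simp
  qed
  have p2: "p\<^sup>2 \<le> 1" using assms by (simp add: power_le_one)
  show ?thesis
    using \<open>1 \<le> n\<close>
  proof (induction n rule: nat_induct_at_least)
    case base
    have "p * p\<^sup>2 \<le> 1" using assms p2 by (simp add: mult_le_one)
    then show ?case using assms by (simp add: divide_simps)
  next
    case (Suc n)
    show ?case
    \<comment> \<open>The general step needs \<open>1 \<le> p * n\<close>, which
      \<open>p > 1 / 2\<close> yields only from \<open>n = 2\<close> on. Passing from one trial to
      two is computed directly; the double root at \<open>p = 1\<close> reflects that the bound is
      attained there.\<close>
    proof (cases "n = 1")
      case True
      have "?f (Suc n) = p * (4 - 3 * p) / 2"
        using assms by (simp add: True numeral_2_eq_2 sum.atLeast_Suc_atMost field_simps)
      moreover have "p * (4 - 3 * p) / 2 \<le> 1 / (2 * p\<^sup>2)"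
      proof -
        have "1 - p ^ 3 * (4 - 3 * p) = (1 - p)\<^sup>2 * (1 + 2 * p + 3 * p\<^sup>2)"
          by (simp add: power2_eq_square power3_eq_cube algebra_simps)
        also have "\<dots> \<ge> 0" using assms by simp
        finally have "p ^ 3 * (4 - 3 * p) \<le> 1" by simp
        then show ?thesis using assms
          by (simp add: divide_simps power2_eq_square power3_eq_cube algebra_simps)
      qed
      ultimately show ?thesis by (simp add: True)
    next
      case False
      with Suc have n2: "2 \<le> n" by simp
      have "(1 - p) * ?f n \<le> (1 - p) * (1 / (real n * p\<^sup>2))"
        using Suc assms by (intro mult_left_mono) auto
      with rec[of n] have "?f (Suc n) \<le> 1 / real (Suc n) + (1 - p) / (real n * p\<^sup>2)" by simp
      also have "\<dots> \<le> 1 / (real (Suc n) * p\<^sup>2)"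
      proof -
        have "1 \<le> p * real n"
          using mult_mono[of "1/2" p 2 "real n"] n2 \<open>\<not> p \<le> 1 / 2\<close> by simp
        then have "(1 - p) * 1 \<le> (1 - p) * (p * real n)" using assms by (intro mult_left_mono) auto
        then have "real n * p\<^sup>2 + (1 - p) * real (Suc n) \<le> real n"
          by (simp add: power2_eq_square algebra_simps)
        then have "(real n * p\<^sup>2 + (1 - p) * real (Suc n)) / (real n * (real (Suc n) * p\<^sup>2))
            \<le> real n / (real n * (real (Suc n) * p\<^sup>2))"
          using n2 by (intro divide_right_mono) auto
        moreover have "1 / real (Suc n) + (1 - p) / (real n * p\<^sup>2)
            = (real n * p\<^sup>2 + (1 - p) * real (Suc n)) / (real n * (real (Suc n) * p\<^sup>2))"
          using n2 assms by (simp add: divide_simps)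
        moreover have "1 / (real (Suc n) * p\<^sup>2) = real n / (real n * (real (Suc n) * p\<^sup>2))"
          using n2 by simp
        ultimately show ?thesis by linarith
      qed
      finally show ?thesis .
    qed
  qed
qed

text \<open>By AM-GM, \<open>1 / sqrt l \<le> (c / l + 1 / c) / 2\<close> for every \<open>c > 0\<close>; take \<open>c = p * sqrt n\<close>.\<close>

lemma sum_pmf_binomial_inverse_sqrt_le:
  assumes "0 < p" "p \<le> 1" "1 \<le> n"
  shows "(\<Sum>l=1..n. pmf (binomial_pmf n p) l / sqrt (real l)) \<le> 1 / (p * sqrt (real n))"
proof -
  define c where "c = p * sqrt (real n)"
  have c: "c > 0" and c2: "c\<^sup>2 = real n * p\<^sup>2"
    using assms by (auto simp: c_def power_mult_distrib)
  have amgm: "1 / sqrt x \<le> (c / x + 1 / c) / 2" if "x > 0" for x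
  proof -
    have "0 \<le> (c - sqrt x)\<^sup>2" by simp
    also have "\<dots> = c\<^sup>2 + x - 2 * c * sqrt x" using that by (simp add: power2_diff)
    finally have "2 * c * sqrt x \<le> c * c + x" by (simp add: power2_eq_square)
    then have "(2 * c * sqrt x) / (2 * c * x) \<le> (c * c + x) / (2 * c * x)"
      using c that by (intro divide_right_mono) auto
    moreover have "1 / sqrt x = (2 * c * sqrt x) / (2 * c * x)"
      using c that by (simp add: real_div_sqrt field_simps)
    moreover have "(c / x + 1 / c) / 2 = (c * c + x) / (2 * c * x)"
      using c that by (simp add: field_simps)
    ultimately show ?thesis by linarith
  qed
  have "(\<Sum>l=1..n. pmf (binomial_pmf n p) l / sqrt (real l))
      \<le> (\<Sum>l=1..n. pmf (binomial_pmf n p) l * ((c / real l + 1 / c) / 2))"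
  proof (intro sum_mono)
    fix l assume "l \<in> {1..n}"
    then show "pmf (binomial_pmf n p) l / sqrt (real l)
        \<le> pmf (binomial_pmf n p) l * ((c / real l + 1 / c) / 2)"
      using mult_left_mono[OF amgm[of "real l"], of "pmf (binomial_pmf n p) l"] by simp
  qed
  also have "\<dots> = c / 2 * (\<Sum>l=1..n. pmf (binomial_pmf n p) l / real l)
      + 1 / (2 * c) * (\<Sum>l=1..n. pmf (binomial_pmf n p) l)"
    unfolding sum_distrib_left sum.distrib[symmetric] by (intro sum.cong) (auto simp: field_simps)
  also have "\<dots> \<le> c / 2 * (1 / c\<^sup>2) + 1 / (2 * c) * 1"
    unfolding c2 using c assms
    by (intro add_mono mult_left_mono sum_pmf_binomial_inverse_le sum_pmf_binomial_pos_le) auto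
  also have "\<dots> = 1 / c" using c by (simp add: field_simps power2_eq_square)
  finally show ?thesis by (simp add: c_def)
qed

text \<open>The value at zero is the first term of the shifted inverse moment, and
  \<open>n + 1 \<ge> 2 * sqrt n\<close>. It bounds the chance that no point is accepted, the origin
  of \<open>B / 2\<close> in \<open>C\<close>.\<close>

lemma pmf_binomial_0_le:
  assumes "0 < p" "p \<le> 1" "1 \<le> n"
  shows "pmf (binomial_pmf n p) 0 \<le> 1 / (2 * p * sqrt (real n))"
proof -
  have "pmf (binomial_pmf n p) 0 = (\<Sum>l\<in>{0}. pmf (binomial_pmf n p) l / real (Suc l))" by simp
  also have "\<dots> \<le> (\<Sum>l\<le>n. pmf (binomial_pmf n p) l / real (Suc l))"
    by (intro sum_mono2) auto
  also have "\<dots> \<le> 1 / (real (Suc n) * p)" by (rule sum_pmf_binomial_inverse_Suc_le) fact+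
  also have "\<dots> \<le> 1 / (2 * p * sqrt (real n))"
  proof -
    have "0 \<le> (sqrt (real n) - 1)\<^sup>2" by simp
    then have "2 * sqrt (real n) \<le> real (Suc n)" by (simp add: power2_diff)
    then show ?thesis using assms by (intro divide_left_mono) (auto simp: mult_ac)
  qed
  finally show ?thesis .
qed

subsection \<open>Binomial tails at the calibration index\<close>

lemma k_index_bounds:
  assumes "0 < \<delta>"
  shows "-1 \<le> k_index m \<epsilon> \<delta>" "k_index m \<epsilon> \<delta> \<le> int m - 1"
    and "binomial_cdf m \<epsilon> (k_index m \<epsilon> \<delta>) \<le> \<delta>"
proof -
  let ?K = "{k \<in> {-1..int m - 1}. binomial_cdf m \<epsilon> k \<le> \<delta>}"
  have fin: "finite ?K" by (rule finite_subset[of _ "{-1..int m - 1}"]) auto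
  have "binomial_cdf m \<epsilon> (-1) = 0" by (simp add: binomial_cdf_def)
  then have "-1 \<in> ?K" using assms by simp
  then have "Max ?K \<in> ?K" by (intro Max_in fin) auto
  then show "-1 \<le> k_index m \<epsilon> \<delta>" "k_index m \<epsilon> \<delta> \<le> int m - 1"
    "binomial_cdf m \<epsilon> (k_index m \<epsilon> \<delta>) \<le> \<delta>"
    by (auto simp: k_index_def)
qed

text \<open>By maximality of \<open>k_index\<close>. The successor leaves the admissible range only
  if it equals \<open>m\<close>, where the distribution function is one and so exceeds
  \<open>\<delta>\<close>.\<close>

lemma binomial_cdf_succ_k_index:
  assumes "0 < \<delta>" "\<delta> < 1" "0 \<le> \<epsilon>" "\<epsilon> \<le> 1"
  shows "\<delta> < binomial_cdf m \<epsilon> (k_index m \<epsilon> \<delta> + 1)"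
proof (rule ccontr)
  let ?k = "k_index m \<epsilon> \<delta>"
  let ?K = "{k \<in> {-1..int m - 1}. binomial_cdf m \<epsilon> k \<le> \<delta>}"
  have fin: "finite ?K" by (rule finite_subset[of _ "{-1..int m - 1}"]) auto
  assume *: "\<not> \<delta> < binomial_cdf m \<epsilon> (?k + 1)"
  show False
  proof (cases "?k + 1 \<le> int m - 1")
    case True
    then have "?k + 1 \<in> ?K" using * k_index_bounds[OF assms(1), of m \<epsilon>] by simp
    then have "?k + 1 \<le> Max ?K" by (intro Max_ge fin)
    then show False by (simp add: k_index_def)
  next
    case False
    then have "?k + 1 = int m" using k_index_bounds[OF assms(1), of m \<epsilon>] by simp
    moreover have "binomial_cdf m \<epsilon> (int m) = 1"
      unfolding binomial_cdf_def
      using assms by (subst measure_pmf.prob_eq_1)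
        (auto simp: AE_measure_pmf_iff set_pmf_binomial_eq split: if_splits)
    ultimately show False using * assms by simp
  qed
qed

text \<open>Indexed by the natural number \<open>h\<close> that later equals \<open>k + 1\<close>:
  the value \<open>k = -1\<close> becomes \<open>h = 0\<close>, where the tail has probability one,
  in accordance with an infinite threshold and zero miscoverage.\<close>

definition upper_tail :: "nat \<Rightarrow> real \<Rightarrow> nat \<Rightarrow> real" where
  "upper_tail m p h = measure_pmf.prob (binomial_pmf m p) {h..}"

lemma upper_tail_eq_1_minus_cdf:
  "upper_tail m p h = 1 - binomial_cdf m p (int h - 1)"
proof -
  have "{j. int j \<le> int h - 1} = {..<h}" by auto
  moreover have "{h..} = UNIV - {..<h}" by auto
  ultimately show ?thesis
    using measure_pmf.prob_compl[of "{..<h}" "binomial_pmf m p"]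
    by (simp add: upper_tail_def binomial_cdf_def)
qed

lemma upper_tail_k_index_ge:
  assumes "0 < \<delta>"
  shows "1 - \<delta> \<le> upper_tail m \<epsilon> (nat (k_index m \<epsilon> \<delta> + 1))"
  using k_index_bounds[OF assms, of m \<epsilon>] by (simp add: upper_tail_eq_1_minus_cdf)

text \<open>Hoeffding's inequality at level \<open>\<epsilon>\<close> puts \<open>k_index\<close> within \<open>sqrt m * d\<close> of \<open>m * \<epsilon>\<close>; used
  again at level \<open>\<epsilon> - \<Delta>\<close> it bounds the tail by \<open>exp (- 2 * t\<^sup>2)\<close> with \<open>t = \<Delta> * sqrt m - d\<close>.\<close>

lemma upper_tail_k_index_le:
  assumes "0 < \<delta>" "\<delta> < 1" "0 < \<Delta>" "\<Delta> < \<epsilon>" "\<epsilon> < 1" "1 \<le> m"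
  shows "upper_tail m (\<epsilon> - \<Delta>) (nat (k_index m \<epsilon> \<delta> + 1))
    \<le> (sqrt (- 2 * ln \<delta>) + 1) / (2 * \<Delta> * sqrt (real m))"
proof -
  \<comment> \<open>\<open>d\<close> is chosen so that
    \<open>exp (- 2 * d\<^sup>2) = \<delta>\<close>. The claimed bound then reads
    \<open>(2 * d + 1) / (2 * (t + d))\<close>, which is at least one for
    \<open>t \<le> 1 / 2\<close>.\<close>
  define d where "d = sqrt (- ln \<delta> / 2)"
  define t where "t = \<Delta> * sqrt (real m) - d"
  define h where "h = nat (k_index m \<epsilon> \<delta> + 1)"
  have ln\<delta>: "ln \<delta> < 0" using assms by simp
  have d0: "d \<ge> 0" and d2: "2 * d\<^sup>2 = - ln \<delta>"
    using ln\<delta> by (auto simp: d_def)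
  have "sqrt (- 2 * ln \<delta>) = sqrt (4 * (- ln \<delta> / 2))" by (rule arg_cong[where f=sqrt]) simp
  also have "\<dots> = 2 * d" unfolding d_def by (simp only: real_sqrt_mult real_sqrt_four)
  finally have sd: "(sqrt (- 2 * ln \<delta>) + 1) / (2 * \<Delta> * sqrt (real m)) = (2 * d + 1) / (2 * (t + d))"
    by (simp add: t_def mult.assoc)
  have td: "t + d > 0" using assms by (simp add: t_def)
  have hm: "int h = k_index m \<epsilon> \<delta> + 1" using k_index_bounds[of \<delta> m \<epsilon>] assms by (simp add: h_def)
  show ?thesis
  proof (cases "t \<le> 1 / 2")
    case True
    then have "1 \<le> (2 * d + 1) / (2 * (t + d))" using td by (simp add: field_simps)
    then show ?thesis unfolding sd upper_tail_def by (rule order_trans[OF measure_pmf.prob_le_1])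
  next
    case False
    \<comment> \<open>If \<open>h\<close> were smaller, Hoeffding's inequality would put mass at
      most \<open>\<delta>\<close> on \<open>{..h}\<close>; but \<open>h = k + 1\<close> lies just
      beyond the largest index with that property.\<close>
    have h_gt: "real h > real m * \<epsilon> - d * sqrt (real m)"
    proof (rule ccontr)
      assume *: "\<not> ?thesis"
      interpret binomial_distribution m \<epsilon> by standard (use assms in auto)
      define s where "s = real m * \<epsilon> - real h"
      have s: "s \<ge> d * sqrt (real m)" using * by (simp add: s_def)
      have s0: "s \<ge> 0" by (rule order_trans[OF _ s]) (use d0 in auto)
      have "d\<^sup>2 * real m \<le> s\<^sup>2"
        using power_mono[OF s, of 2] d0 by (simp add: power_mult_distrib)
      then have e: "exp (- 2 * s\<^sup>2 / real m) \<le> exp (- 2 * d\<^sup>2)"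
        using assms by (simp add: field_simps)
      have "binomial_cdf m \<epsilon> (k_index m \<epsilon> \<delta> + 1) = measure_pmf.prob (binomial_pmf m \<epsilon>) {x. real x \<le> real m * \<epsilon> - s}"
        unfolding binomial_cdf_def hm[symmetric] by (simp add: s_def)
      also have "\<dots> \<le> exp (- 2 * s\<^sup>2 / real m)"
        using prob_le[of s] s0 assms by simp
      also have "\<dots> \<le> exp (- 2 * d\<^sup>2)" by (rule e)
      also have "\<dots> = \<delta>" using d2 assms by simp
      finally show False
        using binomial_cdf_succ_k_index[of \<delta> \<epsilon> m] assms by simp
    qed
    interpret binomial_distribution m "\<epsilon> - \<Delta>" by standard (use assms in auto)
    define s where "s = real h - real m * (\<epsilon> - \<Delta>)"
    have "sqrt (real m) * t = real m * \<Delta> - d * sqrt (real m)"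
      by (simp add: t_def algebra_simps)
    then have s: "s \<ge> sqrt (real m) * t" using h_gt by (simp add: s_def algebra_simps)
    have s0: "s \<ge> 0" by (rule order_trans[OF _ s]) (use False in auto)
    have "real m * t\<^sup>2 \<le> s\<^sup>2"
      using power_mono[OF s, of 2] False by (simp add: power_mult_distrib)
    then have e: "exp (- 2 * s\<^sup>2 / real m) \<le> exp (- 2 * t\<^sup>2)"
      using assms by (simp add: field_simps)
    have "upper_tail m (\<epsilon> - \<Delta>) h
      = measure_pmf.prob (binomial_pmf m (\<epsilon> - \<Delta>)) {x. real x \<ge> real m * (\<epsilon> - \<Delta>) + s}"
      by (simp add: upper_tail_def s_def atLeast_def)
    also have "\<dots> \<le> exp (- 2 * s\<^sup>2 / real m)"
      using prob_ge[of s] s0 assms by simp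
    also note e
    \<comment> \<open>The exponential is traded for a reciprocal via
      \<open>2 * t \<le> 1 + 2 * t\<^sup>2 \<le> exp (2 * t\<^sup>2)\<close>, which gives the order
      \<open>1 / sqrt m\<close>.\<close>
    also have "exp (- 2 * t\<^sup>2) \<le> 1 / (2 * t)"
    proof -
      have "0 \<le> t\<^sup>2 + (t - 1)\<^sup>2" by simp
      then have "2 * t \<le> 1 + 2 * t\<^sup>2" by (simp add: power2_diff)
      also have "\<dots> \<le> exp (2 * t\<^sup>2)" by (rule exp_ge_add_one_self)
      finally show ?thesis using False by (simp add: exp_minus field_simps)
    qed
    also have "1 / (2 * t) \<le> (2 * d + 1) / (2 * (t + d))"
    proof -
      have "d * 1 \<le> d * (2 * t)" using False d0 by (intro mult_left_mono) auto
      then show ?thesis using False td by (simp add: divide_simps algebra_simps)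
    qed
    finally show ?thesis unfolding sd h_def .
  qed
qed

subsection \<open>Miscoverage of a calibrated threshold\<close>

lemma sum_Pow_card:
  fixes f :: "nat \<Rightarrow> 'b::semiring_1"
  assumes "finite J"
  shows "(\<Sum>I | I \<subseteq> J \<and> P (card I). f (card I))
    = (\<Sum>l | l \<le> card J \<and> P l. of_nat (card J choose l) * f l)"
proof -
  let ?S = "{I. I \<subseteq> J \<and> P (card I)}" and ?T = "{l. l \<le> card J \<and> P l}"
  have "finite ?S" by (rule finite_subset[of _ "Pow J"]) (use assms in auto)
  then have "(\<Sum>I\<in>?S. f (card I)) = (\<Sum>l\<in>?T. \<Sum>I\<in>{I\<in>?S. card I = l}. f (card I))"
    using assms by (intro sum.group[symmetric]) (auto simp: card_mono)
  also have "\<dots> = (\<Sum>l\<in>?T. of_nat (card J choose l) * f l)"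
  proof (intro sum.cong refl)
    fix l assume "l \<in> ?T"
    then have "{I\<in>?S. card I = l} = {I. I \<subseteq> J \<and> card I = l}" by auto
    then show "(\<Sum>I\<in>{I\<in>?S. card I = l}. f (card I)) = of_nat (card J choose l) * f l"
      using n_subsets[OF assms, of l] by simp
  qed
  finally show ?thesis .
qed

lemma pred_card_ge [measurable (raw)]:
  assumes "finite J" "\<And>i. i \<in> J \<Longrightarrow> Measurable.pred M (P i)"
  shows "Measurable.pred M (\<lambda>x. h \<le> card {i \<in> J. P i x})"
proof -
  have "real (card {i \<in> J. P i x}) = (\<Sum>i\<in>J. if P i x then 1 else 0)" for x
    using sum.inter_filter[OF assms(1), of "\<lambda>_. 1 :: real" "\<lambda>i. P i x"] by simp
  moreover have "h \<le> card {i \<in> J. P i x} \<longleftrightarrow> real h \<le> real (card {i \<in> J. P i x})" for x by simp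
  ultimately have *: "(\<lambda>x. h \<le> card {i \<in> J. P i x}) = (\<lambda>x. real h \<le> (\<Sum>i\<in>J. if P i x then 1 else 0))"
    by presburger
  have "(\<lambda>x. \<Sum>i\<in>J. if P i x then 1 else 0 :: real) \<in> borel_measurable M"
    using assms(2) by (intro borel_measurable_sum measurable_If measurable_const) (auto simp: pred_def)
  then have "{x \<in> space M. real h \<le> (\<Sum>i\<in>J. if P i x then 1 else 0)} \<in> sets M"
    by (intro borel_measurable_le borel_measurable_const)
  then show ?thesis unfolding * pred_def .
qed

text \<open>The event splits disjointly by the exact set \<open>I\<close> of coordinates that hit
  \<open>A\<close>. Each piece is a rectangle whose mass depends on \<open>I\<close> only through
  \<open>card I\<close>, and counting the sets of each size yields the binomial weights.\<close>

lemma (in prob_space) prob_PiM_card_ge: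
  assumes J: "finite J" and A: "A \<in> events"
  shows "measure (\<Pi>\<^sub>M i\<in>J. M) {x \<in> space (\<Pi>\<^sub>M i\<in>J. M). h \<le> card {i \<in> J. x i \<in> A}}
    = upper_tail (card J) (prob A) h"
proof -
  interpret P: finite_product_prob_space "\<lambda>_. M" J by standard fact
  define F where "F = (\<lambda>I. Pi\<^sub>E J (\<lambda>i. if i \<in> I then A else space M - A))"
  let ?S = "{I. I \<subseteq> J \<and> h \<le> card I}"
  have fin: "finite ?S" by (rule finite_subset[of _ "Pow J"]) (use J in auto)
  have A': "A \<subseteq> space M" using A sets.sets_into_space by auto
  have mem: "x \<in> F I \<longleftrightarrow> x \<in> space (\<Pi>\<^sub>M i\<in>J. M) \<and> {i \<in> J. x i \<in> A} = I" if "I \<subseteq> J" for I x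
    using that A' by (fastforce simp: F_def space_PiM PiE_iff split: if_splits)
  have "{x \<in> space (\<Pi>\<^sub>M i\<in>J. M). h \<le> card {i \<in> J. x i \<in> A}} = (\<Union>I\<in>?S. F I)"
    (is "?L = _")
  proof (intro set_eqI iffI)
    fix x assume "x \<in> ?L"
    then show "x \<in> (\<Union>I\<in>?S. F I)"
      by (intro UN_I[of "{i \<in> J. x i \<in> A}"]) (auto simp: mem)
  qed (auto simp: mem)
  then have "P.prob {x \<in> space (\<Pi>\<^sub>M i\<in>J. M). h \<le> card {i \<in> J. x i \<in> A}} = P.prob (\<Union>I\<in>?S. F I)"
    by simp
  also have "\<dots> = (\<Sum>I\<in>?S. P.prob (F I))"
  proof (rule P.finite_measure_finite_Union[OF fin])
    show "F ` ?S \<subseteq> P.events" using A J by (auto simp: F_def intro!: sets_PiM_I_finite)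
    show "disjoint_family_on F ?S"
      unfolding disjoint_family_on_def
    proof (intro ballI impI)
      fix I I' assume "I \<in> ?S" "I' \<in> ?S" "I \<noteq> I'"
      then show "F I \<inter> F I' = {}" by (simp add: set_eq_iff mem) metis
    qed
  qed
  also have "\<dots> = (\<Sum>I\<in>?S. prob A ^ card I * (1 - prob A) ^ (card J - card I))"
  proof (intro sum.cong refl)
    fix I assume I: "I \<in> ?S"
    then have [simp]: "finite I" using J finite_subset by auto
    have "P.prob (F I) = (\<Prod>i\<in>J. prob (if i \<in> I then A else space M - A))"
      unfolding F_def by (rule P.finite_measure_PiM_emb) (use A in auto)
    also have "\<dots> = (\<Prod>i\<in>J. if i \<in> I then prob A else 1 - prob A)"
      using A by (intro prod.cong) (auto simp: prob_compl)
    also have "\<dots> = prob A ^ card (J \<inter> I) * (1 - prob A) ^ card (J - I)"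
      using J unfolding Diff_eq by (simp only: prod.If_cases Collect_mem_eq prod_constant)
    also have "J \<inter> I = I" using I by auto
    also have "card (J - I) = card J - card I" using I by (intro card_Diff_subset) auto
    finally show "P.prob (F I) = prob A ^ card I * (1 - prob A) ^ (card J - card I)" .
  qed
  also have "\<dots> = (\<Sum>l | l \<le> card J \<and> h \<le> l. real (card J choose l) * (prob A ^ l * (1 - prob A) ^ (card J - l)))"
    by (rule sum_Pow_card[OF J])
  also have "\<dots> = (\<Sum>l\<in>{h..card J}. pmf (binomial_pmf (card J) (prob A)) l)"
    by (intro sum.cong) auto
  also have "\<dots> = measure_pmf.prob (binomial_pmf (card J) (prob A)) {h..card J}"
    by (simp add: measure_measure_pmf_finite)
  also have "\<dots> = upper_tail (card J) (prob A) h"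
    unfolding upper_tail_def
    by (rule measure_pmf.finite_measure_eq_AE)
      (auto simp: AE_measure_pmf_iff set_pmf_binomial_eq split: if_splits)
  finally show ?thesis .
qed

text \<open>The left-hand probability is the mass above the order statistic of \<open>v\<close> with rank
  \<open>card J + 1 - h\<close>, and \<open>0\<close> if \<open>h = 0\<close>. This form needs no sorting.\<close>

lemma (in prob_space) prob_above_order_statistic_le_iff:
  fixes \<sigma> :: "'a \<Rightarrow> real" and v :: "'i \<Rightarrow> real"
  assumes [measurable]: "\<sigma> \<in> borel_measurable M" and J: "finite J" and h: "h \<le> card J" and a: "0 \<le> a"
  shows "prob {z \<in> space M. Suc (card J) - h \<le> card {i \<in> J. v i < \<sigma> z}} \<le> a
    \<longleftrightarrow> h \<le> card {i \<in> J. prob {z \<in> space M. v i < \<sigma> z} \<le> a}"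
proof (cases "h = 0")
  case True
  have "card {i \<in> J. v i < \<sigma> z} \<le> card J" for z using J by (intro card_mono) auto
  then have "{z \<in> space M. Suc (card J) - h \<le> card {i \<in> J. v i < \<sigma> z}} = {}"
    using True by (auto simp: not_le less_Suc_eq_le)
  then show ?thesis using True a by (simp only: measure_empty) simp
next
  case False
  let ?G = "\<lambda>t. prob {z \<in> space M. t < \<sigma> z}"
  let ?E = "{z \<in> space M. Suc (card J) - h \<le> card {i \<in> J. v i < \<sigma> z}}"
  let ?H = "{i \<in> J. ?G (v i) \<le> a}"
  have E: "?E \<in> events" using J by measurable
  have finH: "finite ?H" using J by simp
  have cJH: "card (J - ?H) = card J - card ?H" using J by (intro card_Diff_subset) auto
  show ?thesis
  proof
    assume le: "prob ?E \<le> a"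
    show "h \<le> card ?H"
    proof (rule ccontr)
      assume "\<not> h \<le> card ?H"
      then have c: "Suc (card J) - h \<le> card (J - ?H)" using cJH h by simp
      then have "0 < card (J - ?H)" using h by linarith
      then have ne: "J - ?H \<noteq> {}" by (metis card.empty less_irrefl)
      \<comment> \<open>Too small a set \<open>?H\<close> leaves at least
        \<open>Suc (card J) - h\<close> indices with survival probability above \<open>a\<close>.
        Exceeding the largest of their scores means exceeding all of them, so \<open>?E\<close>
        contains an event of mass above \<open>a\<close>.\<close>
      let ?t = "Max (v ` (J - ?H))"
      have "?t \<in> v ` (J - ?H)" using ne J by (intro Max_in) auto
      then obtain i where i: "i \<in> J - ?H" "?t = v i" by blast
      have sub: "{z \<in> space M. v i < \<sigma> z} \<subseteq> ?E"
      proof clarsimp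
        fix z assume z: "z \<in> space M" "v i < \<sigma> z"
        have "J - ?H \<subseteq> {i \<in> J. v i < \<sigma> z}"
        proof
          fix j assume "j \<in> J - ?H"
          then have "v j \<le> ?t" using J by (intro Max_ge) auto
          then show "j \<in> {i \<in> J. v i < \<sigma> z}" using i z \<open>j \<in> J - ?H\<close> by auto
        qed
        then have "card (J - ?H) \<le> card {i \<in> J. v i < \<sigma> z}" using J by (intro card_mono) auto
        then show "Suc (card J) - h \<le> card {i \<in> J. v i < \<sigma> z}" using c by simp
      qed
      have "?G (v i) \<le> prob ?E" by (rule finite_measure_mono[OF sub E])
      then show False using i le by auto
    qed
  next
    assume c: "h \<le> card ?H"
    then have ne: "?H \<noteq> {}" using False by force
    \<comment> \<open>A score that does not exceed the smallest one indexed by \<open>?H\<close> can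
      exceed only scores outside \<open>?H\<close>, of which there are at most
      \<open>card J - h\<close>. Hence \<open>?E\<close> forces this minimum to be exceeded.\<close>
    let ?t = "Min (v ` ?H)"
    have "?t \<in> v ` ?H" using ne finH by (intro Min_in) auto
    then obtain i where i: "i \<in> ?H" "?t = v i" by blast
    have "?E \<subseteq> {z \<in> space M. v i < \<sigma> z}"
    proof clarsimp
      fix z assume z: "z \<in> space M" "Suc (card J) - h \<le> card {i \<in> J. v i < \<sigma> z}"
      show "v i < \<sigma> z"
      proof (rule ccontr)
        assume n: "\<not> v i < \<sigma> z"
        have "{i \<in> J. v i < \<sigma> z} \<subseteq> J - ?H"
        proof
          fix j assume j: "j \<in> {i \<in> J. v i < \<sigma> z}"
          show "j \<in> J - ?H"
          proof (rule ccontr)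
            assume "j \<notin> J - ?H"
            then have "?t \<le> v j" using j finH by (intro Min_le) auto
            then show False using j n i by auto
          qed
        qed
        then have "card {i \<in> J. v i < \<sigma> z} \<le> card (J - ?H)" using J by (intro card_mono) auto
        then show False using z cJH c h by linarith
      qed
    qed
    then have "prob ?E \<le> ?G (v i)" by (intro finite_measure_mono) measurable
    then show "prob ?E \<le> a" using i by simp
  qed
qed

text \<open>The probability integral transform: without atoms the distribution function is
  continuous, so survival values are uniform on the unit interval.\<close>

lemma (in prob_space) prob_survival_le:
  fixes \<sigma> :: "'a \<Rightarrow> real"
  assumes [measurable]: "\<sigma> \<in> borel_measurable M"
    and atomless: "\<And>c. prob {z \<in> space M. \<sigma> z = c} = 0"
    and a: "0 < a" "a < 1"
  shows "prob {z \<in> space M. prob {z' \<in> space M. \<sigma> z < \<sigma> z'} \<le> a} = a"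
proof -
  define D where "D = distr M borel \<sigma>"
  interpret D: real_distribution D unfolding D_def by simp
  have md: "measure D X = prob {z \<in> space M. \<sigma> z \<in> X}" if "X \<in> sets borel" for X
    unfolding D_def using that by (simp add: measure_distr vimage_def Int_def conj_commute)
  have surv: "prob {z' \<in> space M. t < \<sigma> z'} = 1 - cdf D t" for t
  proof -
    have "UNIV - {..t} = {t<..}" by auto
    then show ?thesis using D.prob_compl[of "{..t}"] md[of "{t<..}"] by (simp add: cdf_def)
  qed
  have sing: "measure D {c} = 0" for c using md[of "{c}"] atomless by simp
  let ?S = "{t. 1 - a \<le> cdf D t}"
  \<comment> \<open>\<open>c\<close> is the smallest \<open>1 - a\<close> quantile. Flat stretches
    of the distribution function to its right are harmless, because the whole half-line from
    \<open>c\<close> is taken.\<close>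
  define c where "c = Inf ?S"
  have "eventually (\<lambda>t. 1 - a < cdf D t) at_top"
    using order_tendstoD(1)[OF D.cdf_lim_at_top_prob] a by simp
  then obtain t where "1 - a < cdf D t" by (auto dest: eventually_happens)
  then have "t \<in> ?S" by simp
  then have ne: "?S \<noteq> {}" by blast
  have "eventually (\<lambda>t. cdf D t < 1 - a) at_bot"
    using order_tendstoD(2)[OF D.cdf_lim_at_bot] a by simp
  then obtain b where b: "\<And>t. t \<le> b \<Longrightarrow> cdf D t < 1 - a" by (auto simp: eventually_at_bot_linorder)
  have bdd: "bdd_below ?S"
  proof (rule bdd_belowI[of _ b])
    fix t assume "t \<in> ?S"
    then show "b \<le> t" using b[of t] by (cases "t \<le> b") auto
  qed
  have cont: "isCont (cdf D) x" for x using D.isCont_cdf sing by simp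
  have "closed ?S"
    by (intro closed_Collect_le continuous_intros continuous_at_imp_continuous_on ballI cont)
  then have cS: "c \<in> ?S" unfolding c_def by (intro closed_contains_Inf ne bdd)
  have S: "?S = {c..}"
  proof (intro set_eqI iffI)
    fix t assume "t \<in> ?S" then show "t \<in> {c..}" unfolding c_def by (auto intro: cInf_lower bdd)
  next
    fix t assume "t \<in> {c..}"
    then have "cdf D c \<le> cdf D t" by (intro D.cdf_nondecreasing) simp
    then show "t \<in> ?S" using cS by simp
  qed
  \<comment> \<open>Below \<open>c\<close> the distribution function stays under
    \<open>1 - a\<close>; left continuity, that is, the absence of an atom at \<open>c\<close>,
    carries the bound to \<open>c\<close> itself.\<close>
  have "cdf D c \<le> 1 - a"
  proof (rule tendsto_upperbound)
    show "(cdf D \<longlongrightarrow> cdf D c) (at_left c)"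
      using cont[of c] unfolding isCont_def by (rule filterlim_mono) (auto simp: at_le)
    show "eventually (\<lambda>t. cdf D t \<le> 1 - a) (at_left c)"
    proof -
      have "eventually (\<lambda>t. t < c) (at_left c)" by (simp add: eventually_at_filter)
      then show ?thesis
      proof eventually_elim
        case (elim t)
        then have "t \<notin> ?S" unfolding S by simp
        then show ?case by simp
      qed
    qed
  qed simp
  then have cdfc: "cdf D c = 1 - a" using cS by simp
  have "prob {z \<in> space M. prob {z' \<in> space M. \<sigma> z < \<sigma> z'} \<le> a} = prob {z \<in> space M. \<sigma> z \<in> {c..}}"
    unfolding surv S[symmetric] by (rule arg_cong[where f=prob]) auto
  also have "\<dots> = measure D {c..}" by (simp add: md)
  also have "{c..} = UNIV - ({..c} - {c})" by auto
  also have "measure D \<dots> = 1 - measure D ({..c} - {c})" using D.prob_compl[of "{..c} - {c}"] by simp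
  also have "measure D ({..c} - {c}) = cdf D c"
    using D.finite_measure_Diff[of "{..c}" "{c}"] sing by (simp add: cdf_def)
  finally show ?thesis using cdfc by simp
qed

text \<open>If \<open>c\<close> had positive mass, all coordinates would score \<open>c\<close> at
  once with probability that mass to the power \<open>card J\<close>, and any two of them would tie.
  With a single index injectivity says nothing, hence the size condition.\<close>

lemma (in prob_space) atomless_if_AE_inj_on:
  fixes \<sigma> :: "'a \<Rightarrow> real"
  assumes [measurable]: "\<sigma> \<in> borel_measurable M" and J: "2 \<le> card J"
    and inj: "AE x in (\<Pi>\<^sub>M i\<in>J. M). inj_on (\<lambda>i. \<sigma> (x i)) J"
  shows "prob {z \<in> space M. \<sigma> z = c} = 0"
proof -
  have fin: "finite J" using J by (metis card.infinite not_numeral_le_zero)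
  interpret P: finite_product_prob_space "\<lambda>_. M" J by standard fact
  let ?A = "{z \<in> space M. \<sigma> z = c}"
  have A: "?A \<in> events" by measurable
  obtain i j where ij: "i \<in> J" "j \<in> J" "i \<noteq> j"
    using J card_le_Suc0_iff_eq[OF fin] by auto
  have "AE x in (\<Pi>\<^sub>M i\<in>J. M). x \<notin> Pi\<^sub>E J (\<lambda>_. ?A)"
    using inj
  proof eventually_elim
    case (elim x)
    show ?case
    proof
      assume "x \<in> Pi\<^sub>E J (\<lambda>_. ?A)"
      then have "\<sigma> (x i) = \<sigma> (x j)" using ij by (auto simp: PiE_iff)
      then show False using elim ij by (auto dest: inj_onD)
    qed
  qed
  then have "P.prob (Pi\<^sub>E J (\<lambda>_. ?A)) = 0"
    using A fin by (subst P.prob_eq_0) (auto intro!: sets_PiM_I_finite)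
  moreover have "P.prob (Pi\<^sub>E J (\<lambda>_. ?A)) = prob ?A ^ card J"
    using A by (subst P.finite_measure_PiM_emb) auto
  ultimately show ?thesis using J by simp
qed

lemma (in prob_space) measurable_prob_section:
  assumes "Measurable.pred (N \<Otimes>\<^sub>M M) (\<lambda>(x, z). P x z)"
  shows "(\<lambda>x. prob {z \<in> space M. P x z}) \<in> borel_measurable N"
proof -
  let ?X = "{w \<in> space (N \<Otimes>\<^sub>M M). case w of (x, z) \<Rightarrow> P x z}"
  have X: "?X \<in> sets (N \<Otimes>\<^sub>M M)" using assms by (simp add: pred_def)
  have "(\<lambda>x. enn2real (emeasure M (Pair x -` ?X))) \<in> borel_measurable N"
    using measurable_emeasure_Pair[OF X] by measurable
  moreover have "enn2real (emeasure M (Pair x -` ?X)) = prob {z \<in> space M. P x z}" if "x \<in> space N" for x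
    unfolding measure_def
    by (rule arg_cong[where f="\<lambda>X. enn2real (emeasure M X)"]) (use that in \<open>auto simp: space_pair_measure\<close>)
  ultimately show ?thesis by (simp cong: measurable_cong)
qed

lemma (in prob_space) measurable_prob_card_less:
  fixes \<sigma> :: "('i \<Rightarrow> 'a) \<Rightarrow> 'a \<Rightarrow> real"
  assumes D: "finite D" "J \<subseteq> D"
    and meas: "(\<lambda>(x, z). \<sigma> x z) \<in> borel_measurable ((\<Pi>\<^sub>M i\<in>D. M) \<Otimes>\<^sub>M M)"
  shows "(\<lambda>x. prob {z \<in> space M. h \<le> card {i \<in> J. \<sigma> x (x i) < \<sigma> x z}})
    \<in> borel_measurable (\<Pi>\<^sub>M i\<in>D. M)"
proof (rule measurable_prob_section)
  have J: "finite J" using D finite_subset by auto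
  have comp: "(\<lambda>w. \<sigma> (fst w) (fst w i)) \<in> borel_measurable ((\<Pi>\<^sub>M i\<in>D. M) \<Otimes>\<^sub>M M)" if "i \<in> J" for i
  proof -
    have "(\<lambda>w. (fst w, fst w i)) \<in> (\<Pi>\<^sub>M i\<in>D. M) \<Otimes>\<^sub>M M \<rightarrow>\<^sub>M (\<Pi>\<^sub>M i\<in>D. M) \<Otimes>\<^sub>M M"
      using that D by (intro measurable_Pair measurable_fst
          measurable_compose[OF measurable_fst measurable_component_singleton]) auto
    from measurable_compose[OF this meas] show ?thesis by simp
  qed
  have "(\<lambda>w. \<sigma> (fst w) (snd w)) \<in> borel_measurable ((\<Pi>\<^sub>M i\<in>D. M) \<Otimes>\<^sub>M M)"
    using meas by (simp add: case_prod_beta')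
  with comp show "Measurable.pred ((\<Pi>\<^sub>M i\<in>D. M) \<Otimes>\<^sub>M M)
      (\<lambda>(x, z). h \<le> card {i \<in> J. \<sigma> x (x i) < \<sigma> x z})"
    unfolding case_prod_beta' by (intro pred_card_ge[OF J] borel_measurable_pred_less) auto
qed

text \<open>Freeze the coordinates outside \<open>J\<close>: then \<open>\<sigma>\<close> is a fixed score function, the indices in
  \<open>J\<close> whose survival probability is at most \<open>a\<close> form independent trials, and each trial succeeds
  with probability \<open>a\<close> because the score has no atoms.\<close>

lemma (in prob_space) prob_miscoverage_le:
  fixes \<sigma> :: "('i \<Rightarrow> 'a) \<Rightarrow> 'a \<Rightarrow> real"
  defines "g \<equiv> \<lambda>h J x. prob {z \<in> space M. Suc (card J) - h \<le> card {i \<in> J. \<sigma> x (x i) < \<sigma> x z}}"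
  assumes D: "finite D" "J \<subseteq> D"
    and meas: "(\<lambda>(x, z). \<sigma> x z) \<in> borel_measurable ((\<Pi>\<^sub>M i\<in>D. M) \<Otimes>\<^sub>M M)"
    and dep: "\<And>x y. (\<And>i. i \<in> D - J \<Longrightarrow> x i = y i) \<Longrightarrow> \<sigma> x = \<sigma> y"
    and inj: "AE x in (\<Pi>\<^sub>M i\<in>D. M). inj_on (\<lambda>i. \<sigma> x (x i)) J"
    and J: "2 \<le> card J" and h: "h \<le> card J" and a: "0 < a" "a < 1"
  shows "measure (\<Pi>\<^sub>M i\<in>D. M) {x \<in> space (\<Pi>\<^sub>M i\<in>D. M). g h J x \<le> a} = upper_tail (card J) a h"
proof -
  let ?K = "D - J"
  have fin: "finite J" "finite ?K" and KJ: "?K \<union> J = D" and disj: "?K \<inter> J = {}"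
    using D finite_subset by auto
  interpret PD: finite_product_prob_space "\<lambda>_. M" D by standard fact
  interpret PJ: finite_product_prob_space "\<lambda>_. M" J by standard fact
  interpret PK: finite_product_prob_space "\<lambda>_. M" ?K by standard fact
  interpret KJ: pair_prob_space "\<Pi>\<^sub>M i\<in>?K. M" "\<Pi>\<^sub>M i\<in>J. M" by standard
  have mm: "merge ?K J \<in> (\<Pi>\<^sub>M i\<in>?K. M) \<Otimes>\<^sub>M (\<Pi>\<^sub>M i\<in>J. M) \<rightarrow>\<^sub>M (\<Pi>\<^sub>M i\<in>D. M)"
    using measurable_merge[of ?K J "\<lambda>_. M"] unfolding KJ .
  have mg: "g h J \<in> borel_measurable (\<Pi>\<^sub>M i\<in>D. M)"
    unfolding g_def by (rule measurable_prob_card_less[OF D meas])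
  have \<sigma>_merge: "\<sigma> (merge ?K J (y, x)) = \<sigma> y" for x y
    by (rule dep) (simp add: merge_def)
  have merge_J: "merge ?K J (y, x) i = x i" if "i \<in> J" for x y i
    using that by (simp add: merge_def)
  \<comment> \<open>\<open>y\<close> lacks the coordinates in \<open>J\<close>, so it is no point of
    the full product. Completing it by an arbitrary \<open>x\<close> gives a section of the jointly
    measurable score, and by \<open>dep\<close> the completion does not change the score.\<close>
  have m\<sigma>: "\<sigma> y \<in> borel_measurable M" if y: "y \<in> space (\<Pi>\<^sub>M i\<in>?K. M)" for y
  proof -
    obtain x where x: "x \<in> space (\<Pi>\<^sub>M i\<in>J. M)" using PJ.not_empty by blast
    have "merge ?K J (y, x) \<in> space (\<Pi>\<^sub>M i\<in>D. M)"
      by (rule measurable_space[OF mm]) (use x y in \<open>simp add: space_pair_measure\<close>)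
    from measurable_compose[OF measurable_Pair1'[OF this] meas] show ?thesis by (simp add: \<sigma>_merge)
  qed
  \<comment> \<open>The product over \<open>D\<close> is the image under \<open>merge\<close> of the
    product of its two parts, so almost sure absence of ties descends to almost every frozen
    \<open>y\<close>. A null set of training samples may still give scores with atoms.\<close>
  have "AE x in distr ((\<Pi>\<^sub>M i\<in>?K. M) \<Otimes>\<^sub>M (\<Pi>\<^sub>M i\<in>J. M)) (\<Pi>\<^sub>M i\<in>D. M) (merge ?K J).
      inj_on (\<lambda>i. \<sigma> x (x i)) J"
    using inj unfolding PD.distr_merge[OF disj fin(2,1), unfolded KJ] .
  from AE_distrD[OF mm this]
  have "AE y in (\<Pi>\<^sub>M i\<in>?K. M). AE x in (\<Pi>\<^sub>M i\<in>J. M).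
      inj_on (\<lambda>i. \<sigma> (merge ?K J (y, x)) (merge ?K J (y, x) i)) J"
    by (auto dest: KJ.AE_pair)
  then have inj': "AE y in (\<Pi>\<^sub>M i\<in>?K. M). AE x in (\<Pi>\<^sub>M i\<in>J. M). inj_on (\<lambda>i. \<sigma> y (x i)) J"
  proof eventually_elim
    case (elim y)
    then show ?case
    proof eventually_elim
      case (elim x)
      have "inj_on (\<lambda>i. \<sigma> (merge ?K J (y, x)) (merge ?K J (y, x) i)) J \<longleftrightarrow> inj_on (\<lambda>i. \<sigma> y (x i)) J"
        by (rule inj_on_cong) (simp only: \<sigma>_merge merge_J)
      with elim show ?case by simp
    qed
  qed
  let ?X = "{x \<in> space (\<Pi>\<^sub>M i\<in>D. M). g h J x \<le> a}"
  have X: "?X \<in> sets (\<Pi>\<^sub>M i\<in>D. M)" using mg by measurable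
  have "emeasure (\<Pi>\<^sub>M i\<in>D. M) ?X
      = (\<integral>\<^sup>+ y. \<integral>\<^sup>+ x. indicator ?X (merge ?K J (y, x)) \<partial>(\<Pi>\<^sub>M i\<in>J. M) \<partial>(\<Pi>\<^sub>M i\<in>?K. M))"
    using PD.product_nn_integral_fold[OF disj fin(2,1), of "indicator ?X"] X
    unfolding KJ by simp
  also have "\<dots> = (\<integral>\<^sup>+ y. ennreal (upper_tail (card J) a h) \<partial>(\<Pi>\<^sub>M i\<in>?K. M))"
  proof (rule nn_integral_cong_AE)
    show "AE y in (\<Pi>\<^sub>M i\<in>?K. M).
      (\<integral>\<^sup>+ x. indicator ?X (merge ?K J (y, x)) \<partial>(\<Pi>\<^sub>M i\<in>J. M)) = ennreal (upper_tail (card J) a h)"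
      using inj' AE_space
    proof eventually_elim
      case (elim y)
      note [measurable] = m\<sigma>[OF elim(2)]
      define A where "A = {z \<in> space M. prob {z' \<in> space M. \<sigma> y z < \<sigma> y z'} \<le> a}"
      have "(\<lambda>t. prob {z' \<in> space M. t < \<sigma> y z'}) \<in> borel_measurable borel"
        by (rule measurable_prob_section) measurable
      then have A: "A \<in> events" unfolding A_def by measurable
      have pA: "prob A = a" unfolding A_def
        by (intro prob_survival_le atomless_if_AE_inj_on[OF _ J elim(1)] a) measurable
      have mem: "merge ?K J (y, x) \<in> ?X \<longleftrightarrow> h \<le> card {i \<in> J. x i \<in> A}"
        if x: "x \<in> space (\<Pi>\<^sub>M i\<in>J. M)" for x
      proof -
        have sp: "merge ?K J (y, x) \<in> space (\<Pi>\<^sub>M i\<in>D. M)"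
          by (rule measurable_space[OF mm]) (use x elim in \<open>simp add: space_pair_measure\<close>)
        have "{i \<in> J. \<sigma> y (merge ?K J (y, x) i) < \<sigma> y z} = {i \<in> J. \<sigma> y (x i) < \<sigma> y z}" for z
          by (auto simp: merge_J)
        then have "g h J (merge ?K J (y, x))
          = prob {z \<in> space M. Suc (card J) - h \<le> card {i \<in> J. \<sigma> y (x i) < \<sigma> y z}}"
          unfolding g_def \<sigma>_merge by simp
        then have "merge ?K J (y, x) \<in> ?X \<longleftrightarrow> h \<le> card {i \<in> J. prob {z \<in> space M. \<sigma> y (x i) < \<sigma> y z} \<le> a}"
          using sp prob_above_order_statistic_le_iff[of "\<sigma> y" J h a "\<lambda>i. \<sigma> y (x i)"] fin h a by simp
        also have "{i \<in> J. prob {z \<in> space M. \<sigma> y (x i) < \<sigma> y z} \<le> a} = {i \<in> J. x i \<in> A}"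
          using x by (auto simp: A_def space_PiM PiE_iff)
        finally show ?thesis .
      qed
      have "(\<integral>\<^sup>+ x. indicator ?X (merge ?K J (y, x)) \<partial>(\<Pi>\<^sub>M i\<in>J. M))
        = (\<integral>\<^sup>+ x. indicator {x \<in> space (\<Pi>\<^sub>M i\<in>J. M). h \<le> card {i \<in> J. x i \<in> A}} x \<partial>(\<Pi>\<^sub>M i\<in>J. M))"
        by (intro nn_integral_cong) (simp only: indicator_def mem, simp)
      also have "\<dots> = emeasure (\<Pi>\<^sub>M i\<in>J. M) {x \<in> space (\<Pi>\<^sub>M i\<in>J. M). h \<le> card {i \<in> J. x i \<in> A}}"
        by (intro nn_integral_indicator predE pred_card_ge fin(1) pred_sets2[OF A]
            measurable_component_singleton)
      also have "\<dots> = ennreal (upper_tail (card J) a h)"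
        using prob_PiM_card_ge[OF fin(1) A, of h] by (simp add: PJ.emeasure_eq_measure pA)
      finally show ?case .
    qed
  qed
  also have "\<dots> = ennreal (upper_tail (card J) a h)" by (simp add: PK.emeasure_space_1)
  finally show "measure (\<Pi>\<^sub>M i\<in>D. M) ?X = upper_tail (card J) a h"
    by (simp add: PD.emeasure_eq_measure upper_tail_def)
qed

subsection \<open>Conformal intervals as counts of scores\<close>

text \<open>In the sorted list the entries below \<open>c\<close> form an initial segment, whose
  length decides. With \<open>1 \<le> j\<close> the position \<open>j - 1\<close> involves no
  truncated subtraction; the value \<open>\<infinity>\<close> for large \<open>j\<close> agrees with
  a count that cannot exceed the length.\<close>

lemma order_statistic_less_iff:
  assumes "1 \<le> j"
  shows "order_statistic xs j < ereal c \<longleftrightarrow> j \<le> length (filter (\<lambda>t. t < c) xs)"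
proof (cases "j \<le> length xs")
  case True
  define ys where "ys = sort xs"
  have len: "length ys = length xs" and sorted: "sorted ys" by (simp_all add: ys_def)
  have "mset (filter (\<lambda>t. t < c) ys) = mset (filter (\<lambda>t. t < c) xs)" by (simp add: ys_def)
  then have "length (filter (\<lambda>t. t < c) xs) = length (filter (\<lambda>t. t < c) ys)"
    by (metis size_mset)
  then have cnt: "length (filter (\<lambda>t. t < c) xs) = card {i. i < length ys \<and> ys ! i < c}"
    by (simp add: length_filter_conv_card)
  have "ys ! (j - 1) < c \<longleftrightarrow> j \<le> card {i. i < length ys \<and> ys ! i < c}"
  proof
    assume *: "ys ! (j - 1) < c"
    have "{..<j} \<subseteq> {i. i < length ys \<and> ys ! i < c}"
    proof
      fix i assume "i \<in> {..<j}"
      then have "ys ! i \<le> ys ! (j - 1)" using True len by (intro sorted_nth_mono[OF sorted]) auto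
      then show "i \<in> {i. i < length ys \<and> ys ! i < c}" using * \<open>i \<in> {..<j}\<close> True len by auto
    qed
    from card_mono[OF _ this] show "j \<le> card {i. i < length ys \<and> ys ! i < c}" by simp
  next
    assume le: "j \<le> card {i. i < length ys \<and> ys ! i < c}"
    show "ys ! (j - 1) < c"
    proof (rule ccontr)
      assume *: "\<not> ys ! (j - 1) < c"
      have "{i. i < length ys \<and> ys ! i < c} \<subseteq> {..<j - 1}"
      proof clarsimp
        fix i assume i: "i < length ys" "ys ! i < c"
        show "i < j - Suc 0"
        proof (rule ccontr)
          assume "\<not> i < j - Suc 0"
          then have "ys ! (j - 1) \<le> ys ! i" using i by (intro sorted_nth_mono[OF sorted]) auto
          then show False using * i by simp
        qed
      qed
      from card_mono[OF _ this] show False using le assms by simp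
    qed
  qed
  then show ?thesis using True by (simp add: order_statistic_def cnt flip: ys_def)
next
  case False
  then have "\<not> j \<le> length (filter (\<lambda>t. t < c) xs)"
    using length_filter_le[of "\<lambda>t. t < c" xs] by linarith
  then show ?thesis using False by (simp add: order_statistic_def)
qed

lemma order_statistic_ne_MInfty: "order_statistic xs j \<noteq> - \<infinity>"
  by (simp add: order_statistic_def)

text \<open>For real \<open>t\<close>, the two inequalities of the band say that both arguments of
  the maximum are at most \<open>t\<close>. This also covers a band that is empty because its
  endpoints are in the wrong order.\<close>

lemma notin_band_iff:
  assumes "t \<noteq> - \<infinity>"
  shows "r \<notin> band lo up t s \<longleftrightarrow> t < ereal (score lo up (s, r))"
  using assms by (cases t) (auto simp: band_def score_def less_max_iff_disj simp flip: ereal_max)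

text \<open>The argument \<open>x\<close> lists the sample; its entries outside \<open>J\<close> train the score.\<close>

definition trained_score ::
  "(('s \<times> real) list \<Rightarrow> 's \<Rightarrow> real) \<Rightarrow> (('s \<times> real) list \<Rightarrow> 's \<Rightarrow> real) \<Rightarrow> nat \<Rightarrow> nat set
    \<Rightarrow> (nat \<Rightarrow> 's \<times> real) \<Rightarrow> 's \<times> real \<Rightarrow> real" where
  "trained_score qlo qup l J x =
    score (qlo (map x (filter (\<lambda>j. j \<notin> J) [0..<l]))) (qup (map x (filter (\<lambda>j. j \<notin> J) [0..<l])))"

lemma nths_map_upt: "nths (map x [0..<l]) J = map x (filter (\<lambda>j. j \<in> J) [0..<l])"
proof (induction l)
  case (Suc l)
  then show ?case by (auto simp: nths_append)
qed simp

lemma calibration_scores_map_upt: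
  "calibration_scores qhat \<epsilon>lo \<epsilon>up J (map x [0..<l])
    = map (\<lambda>i. trained_score (qhat \<epsilon>lo) (qhat \<epsilon>up) l J x (x i)) (filter (\<lambda>j. j \<in> J) [0..<l])"
  by (simp add: calibration_scores_def nths_map_upt trained_score_def o_def)

lemma distinct_calibration_scores_iff:
  assumes "J \<subseteq> {..<l}"
  shows "distinct (calibration_scores qhat \<epsilon>lo \<epsilon>up J (map x [0..<l]))
    \<longleftrightarrow> inj_on (\<lambda>i. trained_score (qhat \<epsilon>lo) (qhat \<epsilon>up) l J x (x i)) J"
proof -
  have "{j. j < l \<and> j \<in> J} = J" using assms by auto
  then show ?thesis by (simp add: calibration_scores_map_upt distinct_map conj_commute)
qed

text \<open>The test score exceeds the order statistic of rank \<open>m - k\<close> iff at least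
  that many calibration scores lie strictly below it. Written as \<open>Suc m - h\<close> with
  \<open>h = nat (k + 1)\<close>, the rank is \<open>m + 1\<close> for \<open>k = -1\<close> and is
  never reached. What remains is a count, which is easier to measure and integrate than a sorted
  list.\<close>

lemma notin_conformal_interval_iff:
  fixes qhat :: "real \<Rightarrow> ('s \<times> real) list \<Rightarrow> 's \<Rightarrow> real" and \<epsilon>lo \<epsilon>up :: real
    and x :: "nat \<Rightarrow> 's \<times> real"
  assumes J: "J \<subseteq> {..<l}" and "0 < \<delta>"
  defines "\<sigma> \<equiv> trained_score (qhat \<epsilon>lo) (qhat \<epsilon>up) l J x"
  shows "r \<notin> conformal_interval qhat \<epsilon>lo \<epsilon>up \<epsilon> \<delta> J (map x [0..<l]) s
    \<longleftrightarrow> Suc (card J) - nat (k_index (card J) \<epsilon> \<delta> + 1) \<le> card {i \<in> J. \<sigma> (x i) < \<sigma> (s, r)}"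
proof -
  define cs where "cs = calibration_scores qhat \<epsilon>lo \<epsilon>up J (map x [0..<l])"
  have cs: "cs = map (\<lambda>i. \<sigma> (x i)) (filter (\<lambda>j. j \<in> J) [0..<l])"
    by (simp add: cs_def \<sigma>_def calibration_scores_map_upt)
  have setJ: "set (filter (\<lambda>j. j \<in> J) [0..<l]) = J" using J by auto
  have len: "length cs = card J"
    using distinct_card[of "filter (\<lambda>j. j \<in> J) [0..<l]"] by (simp add: cs setJ del: set_filter)
  have cnt: "length (filter (\<lambda>t. t < c) cs) = card {i \<in> J. \<sigma> (x i) < c}" for c
  proof -
    have "set (filter (\<lambda>i. \<sigma> (x i) < c) (filter (\<lambda>j. j \<in> J) [0..<l])) = {i \<in> J. \<sigma> (x i) < c}"
      using J by auto
    then show ?thesis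
      using distinct_card[of "filter (\<lambda>i. \<sigma> (x i) < c) (filter (\<lambda>j. j \<in> J) [0..<l])"]
      by (simp add: cs filter_map o_def del: filter_filter)
  qed
  let ?k = "k_index (card J) \<epsilon> \<delta>"
  have k: "-1 \<le> ?k" "?k \<le> int (card J) - 1" using k_index_bounds[OF \<open>0 < \<delta>\<close>, of "card J" \<epsilon>] by auto
  then have nat: "nat (int (card J) - ?k) = Suc (card J) - nat (?k + 1)" by linarith
  have "r \<notin> conformal_interval qhat \<epsilon>lo \<epsilon>up \<epsilon> \<delta> J (map x [0..<l]) s
    \<longleftrightarrow> threshold \<epsilon> \<delta> cs < ereal (\<sigma> (s, r))"
    unfolding conformal_interval_def cs_def[symmetric]
    by (subst notin_band_iff)
      (simp_all add: threshold_def order_statistic_ne_MInfty nths_map_upt \<sigma>_def trained_score_def)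
  also have "\<dots> \<longleftrightarrow> nat (int (card J) - ?k) \<le> card {i \<in> J. \<sigma> (x i) < \<sigma> (s, r)}"
    unfolding threshold_def len using k by (subst order_statistic_less_iff) (auto simp: cnt)
  finally show ?thesis unfolding nat .
qed

lemma trained_score_cong:
  assumes "\<And>i. i \<in> {..<l} - J \<Longrightarrow> x i = y i"
  shows "trained_score qlo qup l J x = trained_score qlo qup l J y"
proof -
  have "map x (filter (\<lambda>j. j \<notin> J) [0..<l]) = map y (filter (\<lambda>j. j \<notin> J) [0..<l])"
    using assms by auto
  then show ?thesis by (simp only: trained_score_def)
qed

text \<open>For fixed \<open>l\<close> and \<open>J\<close> the training list has fixed length and
  fixed positions, so its entries are coordinates of \<open>x\<close> and the measurability of the
  algorithm at that one size applies.\<close>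

lemma measurable_trained_score:
  assumes "measurable_algorithm PS qlo" "measurable_algorithm PS qup"
  shows "(\<lambda>(x, z). trained_score qlo qup l J x z)
    \<in> borel_measurable ((\<Pi>\<^sub>M i\<in>{..<l}. PS \<Otimes>\<^sub>M borel) \<Otimes>\<^sub>M (PS \<Otimes>\<^sub>M borel))"
proof -
  let ?P = "(\<Pi>\<^sub>M i\<in>{..<l}. PS \<Otimes>\<^sub>M borel) \<Otimes>\<^sub>M (PS \<Otimes>\<^sub>M (borel :: real measure))"
  let ?f = "filter (\<lambda>j. j \<notin> J) [0..<l]"
  have q: "(\<lambda>w. q (map (fst w) ?f) (fst (snd w))) \<in> borel_measurable ?P"
    if "measurable_algorithm PS q" for q
  proof -
    let ?m = "length ?f"
    let ?c = "\<lambda>w :: (nat \<Rightarrow> 'a \<times> real) \<times> 'a \<times> real. ((\<lambda>j\<in>{..<?m}. fst w (?f ! j)), fst (snd w))"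
    have nth: "?f ! j \<in> {..<l}" if "j < ?m" for j
      using nth_mem[OF that] by auto
    have c: "?c \<in> ?P \<rightarrow>\<^sub>M (\<Pi>\<^sub>M j\<in>{..<?m}. PS \<Otimes>\<^sub>M borel) \<Otimes>\<^sub>M PS"
    proof (intro measurable_Pair measurable_restrict)
      fix j assume "j \<in> {..<?m}"
      then show "(\<lambda>w. fst w (?f ! j)) \<in> ?P \<rightarrow>\<^sub>M PS \<Otimes>\<^sub>M borel"
        using nth by (intro measurable_compose[OF measurable_fst measurable_component_singleton]) auto
    qed measurable
    have "(\<lambda>w. q (map (fst (?c w)) [0..<?m]) (snd (?c w))) \<in> borel_measurable ?P"
      using measurable_compose[OF c that[unfolded measurable_algorithm_def case_prod_beta', rule_format]] .
    moreover have "map (fst (?c w)) [0..<?m] = map (fst w) ?f" for w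
      by (rule nth_equalityI) auto
    ultimately show ?thesis by simp
  qed
  note [measurable] = q[OF assms(1)] q[OF assms(2)]
  show ?thesis
    unfolding trained_score_def score_def case_prod_beta' by measurable
qed

text \<open>The event is the difference of two nested events whose probabilities are binomial tails
  at the levels \<open>\<epsilon>\<close> and \<open>\<epsilon> - \<Delta>\<close>. For
  \<open>card J = 1\<close> absence of ties gives no information about atoms; the extra
  \<open>1\<close> in the numerator makes the bound nonpositive there.\<close>

lemma (in prob_space) prob_miscoverage_between:
  fixes \<sigma> :: "('i \<Rightarrow> 'a) \<Rightarrow> 'a \<Rightarrow> real"
  assumes \<epsilon>\<delta>: "0 < \<delta>" "\<delta> < 1" "0 < \<Delta>" "\<Delta> < \<epsilon>" "\<epsilon> < 1"
  defines "g \<equiv> \<lambda>J x. prob {z \<in> space M.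
    Suc (card J) - nat (k_index (card J) \<epsilon> \<delta> + 1) \<le> card {i \<in> J. \<sigma> x (x i) < \<sigma> x z}}"
  assumes D: "finite D" "J \<subseteq> D"
    and meas: "(\<lambda>(x, z). \<sigma> x z) \<in> borel_measurable ((\<Pi>\<^sub>M i\<in>D. M) \<Otimes>\<^sub>M M)"
    and dep: "\<And>x y. (\<And>i. i \<in> D - J \<Longrightarrow> x i = y i) \<Longrightarrow> \<sigma> x = \<sigma> y"
    and inj: "AE x in (\<Pi>\<^sub>M i\<in>D. M). inj_on (\<lambda>i. \<sigma> x (x i)) J"
    and J: "1 \<le> card J"
  shows "measure (\<Pi>\<^sub>M i\<in>D. M) {x \<in> space (\<Pi>\<^sub>M i\<in>D. M). \<epsilon> - \<Delta> < g J x \<and> g J x \<le> \<epsilon>}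
    \<ge> 1 - \<delta> - ((sqrt (- 2 * ln \<delta>) + 1) / (2 * \<Delta>) + 1) / sqrt (real (card J))"
proof (cases "card J = 1")
  case True
  have "0 \<le> (sqrt (- 2 * ln \<delta>) + 1) / (2 * \<Delta>)"
    using \<epsilon>\<delta> by (intro divide_nonneg_nonneg) auto
  then have "1 - \<delta> - ((sqrt (- 2 * ln \<delta>) + 1) / (2 * \<Delta>) + 1) / sqrt (real (card J)) \<le> 0"
    using \<epsilon>\<delta> unfolding True of_nat_1 real_sqrt_one div_by_1 by linarith
  also have "0 \<le> measure (\<Pi>\<^sub>M i\<in>D. M) {x \<in> space (\<Pi>\<^sub>M i\<in>D. M). \<epsilon> - \<Delta> < g J x \<and> g J x \<le> \<epsilon>}"
    by simp
  finally show ?thesis .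
next
  case False
  then have J2: "2 \<le> card J" using J by simp
  interpret P: finite_product_prob_space "\<lambda>_. M" D by standard fact
  let ?m = "card J"
  let ?h = "nat (k_index ?m \<epsilon> \<delta> + 1)"
  have h: "?h \<le> ?m" using k_index_bounds[of \<delta> ?m \<epsilon>] \<epsilon>\<delta> by simp
  note le = prob_miscoverage_le[OF D meas dep inj J2 h]
  let ?E = "\<lambda>a. {x \<in> space (\<Pi>\<^sub>M i\<in>D. M). g J x \<le> a}"
  have mg: "g J \<in> borel_measurable (\<Pi>\<^sub>M i\<in>D. M)"
    unfolding g_def by (rule measurable_prob_card_less[OF D meas])
  have E: "?E a \<in> P.events" for a using mg by measurable
  have "{x \<in> space (\<Pi>\<^sub>M i\<in>D. M). \<epsilon> - \<Delta> < g J x \<and> g J x \<le> \<epsilon>} = ?E \<epsilon> - ?E (\<epsilon> - \<Delta>)" by auto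
  then have "P.prob {x \<in> space (\<Pi>\<^sub>M i\<in>D. M). \<epsilon> - \<Delta> < g J x \<and> g J x \<le> \<epsilon>}
      = P.prob (?E \<epsilon> - ?E (\<epsilon> - \<Delta>))" by simp
  moreover have "P.prob (?E \<epsilon> - ?E (\<epsilon> - \<Delta>)) = P.prob (?E \<epsilon>) - P.prob (?E (\<epsilon> - \<Delta>))"
    using \<epsilon>\<delta> by (intro P.finite_measure_Diff E) auto
  moreover have "P.prob (?E \<epsilon>) = upper_tail ?m \<epsilon> ?h"
    unfolding g_def by (rule le) (use \<epsilon>\<delta> in auto)
  moreover have "P.prob (?E (\<epsilon> - \<Delta>)) = upper_tail ?m (\<epsilon> - \<Delta>) ?h"
    unfolding g_def by (rule le) (use \<epsilon>\<delta> in auto)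
  moreover note upper_tail_k_index_ge[OF \<epsilon>\<delta>(1), of ?m \<epsilon>]
  moreover have "upper_tail ?m (\<epsilon> - \<Delta>) ?h \<le> (sqrt (- 2 * ln \<delta>) + 1) / (2 * \<Delta> * sqrt (real ?m))"
    using \<epsilon>\<delta> J by (intro upper_tail_k_index_le) auto
  moreover have "(sqrt (- 2 * ln \<delta>) + 1) / (2 * \<Delta> * sqrt (real ?m))
    \<le> ((sqrt (- 2 * ln \<delta>) + 1) / (2 * \<Delta>) + 1) / sqrt (real ?m)"
    by (simp add: add_divide_distrib)
  ultimately show ?thesis using \<epsilon>\<delta> by linarith
qed

subsection \<open>Independence and conditional miscoverage\<close>

lemma sets_vimage_algebra_eq:
  "X \<in> M \<rightarrow>\<^sub>M K \<Longrightarrow> sets (vimage_algebra (space M) X K) = {X -` A \<inter> space M | A. A \<in> sets K}"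
  by (intro sets_vimage_algebra2) (auto dest: measurable_space)

lemma (in prob_space) independent_rvs_distr:
  assumes "independent_rvs M K X K' Y"
  shows "distr M (K \<Otimes>\<^sub>M K') (\<lambda>\<omega>. (X \<omega>, Y \<omega>)) = distr M K X \<Otimes>\<^sub>M distr M K' Y"
proof -
  have [measurable]: "X \<in> M \<rightarrow>\<^sub>M K" "Y \<in> M \<rightarrow>\<^sub>M K'"
    and ind: "indep_set (sets (vimage_algebra (space M) X K)) (sets (vimage_algebra (space M) Y K'))"
    using assms by (auto simp: independent_rvs_def)
  interpret X: prob_space "distr M K X" by (rule prob_space_distr) measurable
  interpret Y: prob_space "distr M K' Y" by (rule prob_space_distr) measurable
  interpret XY: pair_sigma_finite "distr M K X" "distr M K' Y" by standard
  have "distr M K X \<Otimes>\<^sub>M distr M K' Y = distr M (K \<Otimes>\<^sub>M K') (\<lambda>\<omega>. (X \<omega>, Y \<omega>))"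
  proof (rule pair_measure_eqI)
    fix A B assume A: "A \<in> sets (distr M K X)" and B: "B \<in> sets (distr M K' Y)"
    have *: "(\<lambda>\<omega>. (X \<omega>, Y \<omega>)) -` (A \<times> B) \<inter> space M = (X -` A \<inter> space M) \<inter> (Y -` B \<inter> space M)"
      by auto
    have "prob ((X -` A \<inter> space M) \<inter> (Y -` B \<inter> space M))
        = prob (X -` A \<inter> space M) * prob (Y -` B \<inter> space M)"
    proof -
      have "X -` A \<inter> space M \<in> sets (vimage_algebra (space M) X K)"
        "Y -` B \<inter> space M \<in> sets (vimage_algebra (space M) Y K')"
        using A B by (auto simp: sets_vimage_algebra_eq)
      then show ?thesis using ind unfolding indep_sets2_eq by blast
    qed
    then show "emeasure (distr M K X) A * emeasure (distr M K' Y) B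
        = emeasure (distr M (K \<Otimes>\<^sub>M K') (\<lambda>\<omega>. (X \<omega>, Y \<omega>))) (A \<times> B)"
      using A B by (simp add: emeasure_distr * emeasure_eq_measure ennreal_mult'')
  qed (auto simp: X.sigma_finite_measure_axioms Y.sigma_finite_measure_axioms cong: sets_pair_measure_cong)
  then show ?thesis ..
qed

text \<open>Conditioning on \<open>Y\<close> freezes it, and the independent \<open>Z\<close> is
  integrated against its own law. The random set \<open>C\<close> enters only through the predicate
  \<open>P\<close>, so no measurability of set-valued maps has to be formulated.\<close>

lemma (in prob_space) AE_cond_miscoverage:
  assumes ind: "independent_rvs M K Y K' Z"
    and meas: "Measurable.pred (K \<Otimes>\<^sub>M K') (\<lambda>(y, z). P y z)"
    and C: "\<And>\<omega>. \<omega> \<in> space M \<Longrightarrow> r \<omega> \<notin> C \<omega> (s \<omega>) \<longleftrightarrow> P (Y \<omega>) (Z \<omega>)"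
  shows "AE \<omega> in M. cond_miscoverage M K Y C s r \<omega> = measure (distr M K' Z) {z \<in> space K'. P (Y \<omega>) z}"
    and "cond_miscoverage M K Y C s r \<in> borel_measurable M"
proof -
  let ?F = "vimage_algebra (space M) Y K"
  let ?Q = "distr M K' Z"
  have mY [measurable]: "Y \<in> M \<rightarrow>\<^sub>M K" and mZ [measurable]: "Z \<in> M \<rightarrow>\<^sub>M K'"
    using ind by (auto simp: independent_rvs_def)
  have sub: "subalgebra M ?F"
    using mY by (auto simp: subalgebra_def sets_vimage_algebra_eq dest: measurable_sets)
  interpret F: finite_measure_subalgebra M ?F by standard (rule sub)
  interpret Q: prob_space ?Q by (rule prob_space_distr) measurable
  interpret Y: prob_space "distr M K Y" by (rule prob_space_distr) measurable
  interpret YQ: pair_prob_space "distr M K Y" ?Q by standard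
  let ?X = "{w \<in> space (K \<Otimes>\<^sub>M K'). case w of (y, z) \<Rightarrow> P y z}"
  have X: "?X \<in> sets (K \<Otimes>\<^sub>M K')" using meas by (simp add: pred_def)
  define g where "g = (\<lambda>y. Q.prob {z \<in> space K'. P y z})"
  have mg: "g \<in> borel_measurable K"
  proof -
    have "(\<lambda>y. enn2real (emeasure ?Q (Pair y -` ?X))) \<in> borel_measurable K"
      using Q.measurable_emeasure_Pair[of ?X K] X by simp
    moreover have "enn2real (emeasure ?Q (Pair y -` ?X)) = g y" if "y \<in> space K" for y
      unfolding measure_def g_def
      by (rule arg_cong[where f="\<lambda>X. enn2real (emeasure ?Q X)"])
        (use that in \<open>auto simp: space_pair_measure\<close>)
    ultimately show ?thesis by (simp cong: measurable_cong)
  qed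
  let ?W = "{\<omega> \<in> space M. r \<omega> \<notin> C \<omega> (s \<omega>)}"
  have W: "?W = {\<omega> \<in> space M. (Y \<omega>, Z \<omega>) \<in> ?X}"
    using C measurable_space[OF mY] measurable_space[OF mZ] by (auto simp: space_pair_measure)
  have mW: "?W \<in> events" unfolding W using X by measurable
  have "AE \<omega> in M. real_cond_exp M ?F (indicator ?W) \<omega> = g (Y \<omega>)"
  proof (rule F.real_cond_exp_charact)
    show "integrable M (indicator ?W :: _ \<Rightarrow> real)" using mW by (simp add: integrable_indicator_iff emeasure_eq_measure)
    have gY: "(\<lambda>\<omega>. g (Y \<omega>)) \<in> borel_measurable M" using mg by measurable
    show "integrable M (\<lambda>\<omega>. g (Y \<omega>))"
      by (rule integrable_const_bound[where B=1]) (use gY in \<open>auto simp: g_def\<close>)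
    show "(\<lambda>\<omega>. g (Y \<omega>)) \<in> borel_measurable ?F"
      by (rule measurable_compose[OF measurable_vimage_algebra1 mg])
        (use measurable_space[OF mY] in auto)
    fix A assume "A \<in> sets ?F"
    then obtain D where D: "D \<in> sets K" "A = Y -` D \<inter> space M" using mY by (auto simp: sets_vimage_algebra_eq)
    have DX: "(D \<times> space K') \<inter> ?X \<in> sets (K \<Otimes>\<^sub>M K')" using D X by auto
    have A: "A \<in> events" using D by simp
    have "(\<integral>\<omega>\<in>A. indicator ?W \<omega> \<partial>M) = prob (A \<inter> ?W)"
      using A mW unfolding set_lebesgue_integral_def
      by (simp flip: indicator_inter_arith)
    also have "A \<inter> ?W = (\<lambda>\<omega>. (Y \<omega>, Z \<omega>)) -` ((D \<times> space K') \<inter> ?X) \<inter> space M"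
      unfolding W D(2) using measurable_space[OF mZ] by auto
    also have "prob \<dots> = measure (distr M (K \<Otimes>\<^sub>M K') (\<lambda>\<omega>. (Y \<omega>, Z \<omega>))) ((D \<times> space K') \<inter> ?X)"
      by (rule measure_distr[symmetric, OF _ DX]) measurable
    also have "\<dots> = measure (distr M K Y \<Otimes>\<^sub>M ?Q) ((D \<times> space K') \<inter> ?X)"
      unfolding independent_rvs_distr[OF ind] ..
    also have "\<dots> = (\<integral>\<omega>\<in>A. g (Y \<omega>) \<partial>M)"
    proof -
      have "emeasure (distr M K Y \<Otimes>\<^sub>M ?Q) ((D \<times> space K') \<inter> ?X)
        = (\<integral>\<^sup>+ y. emeasure ?Q (Pair y -` ((D \<times> space K') \<inter> ?X)) \<partial>distr M K Y)"
        using DX by (intro Q.emeasure_pair_measure_alt) simp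
      also have "\<dots> = (\<integral>\<^sup>+ y. ennreal (indicator D y * g y) \<partial>distr M K Y)"
      proof (rule nn_integral_cong)
        fix y assume "y \<in> space (distr M K Y)"
        then have "Pair y -` ((D \<times> space K') \<inter> ?X) = (if y \<in> D then {z \<in> space K'. P y z} else {})"
          by (auto simp: space_pair_measure)
        then show "emeasure ?Q (Pair y -` ((D \<times> space K') \<inter> ?X)) = ennreal (indicator D y * g y)"
          by (simp add: g_def Q.emeasure_eq_measure)
      qed
      also have "\<dots> = (\<integral>\<^sup>+ \<omega>. ennreal (indicator A \<omega> * g (Y \<omega>)) \<partial>M)"
        using D mg by (subst nn_integral_distr) (auto intro!: nn_integral_cong split: split_indicator)
      also have "\<dots> = ennreal (\<integral>\<omega>. indicator A \<omega> * g (Y \<omega>) \<partial>M)"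
        by (rule nn_integral_eq_integral, rule integrable_const_bound[where B=1])
          (use gY A in \<open>auto simp: g_def split: split_indicator\<close>)
      finally show ?thesis
        by (simp add: YQ.emeasure_eq_measure set_lebesgue_integral_def g_def)
    qed
    finally show "(\<integral>\<omega>\<in>A. indicator ?W \<omega> \<partial>M) = (\<integral>\<omega>\<in>A. g (Y \<omega>) \<partial>M)" .
  qed
  then show "AE \<omega> in M. cond_miscoverage M K Y C s r \<omega> = Q.prob {z \<in> space K'. P (Y \<omega>) z}"
    by (simp add: cond_miscoverage_def g_def)
  show "cond_miscoverage M K Y C s r \<in> borel_measurable M"
    unfolding cond_miscoverage_def by (rule borel_measurable_cond_exp2)
qed

text \<open>Tonelli's theorem, and then one factor at a time. Data and uniform variables arrive as
  two independent blocks, while acceptance compares the members of both with equal index; here the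
  blocks are regrouped into pairs.\<close>

lemma emeasure_pair_PiM_rectangle:
  assumes A: "\<And>i. i \<in> I \<Longrightarrow> prob_space (A i)" and B: "\<And>i. i \<in> I \<Longrightarrow> prob_space (B i)"
    and I: "finite I" and C: "\<And>i. i \<in> I \<Longrightarrow> C i \<in> sets (A i \<Otimes>\<^sub>M B i)"
  shows "emeasure (Pi\<^sub>M I A \<Otimes>\<^sub>M Pi\<^sub>M I B)
      {w \<in> space (Pi\<^sub>M I A \<Otimes>\<^sub>M Pi\<^sub>M I B). \<forall>i\<in>I. (fst w i, snd w i) \<in> C i}
    = (\<Prod>i\<in>I. emeasure (A i \<Otimes>\<^sub>M B i) (C i))"
proof -
  \<comment> \<open>\<open>product_prob_space\<close> asks for a probability measure at every index,
    so point masses fill the indices outside \<open>I\<close>; the products over \<open>I\<close> do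
    not see them.\<close>
  define A' where "A' i = (if i \<in> I then A i else return (count_space {undefined}) undefined)" for i
  define B' where "B' i = (if i \<in> I then B i else return (count_space {undefined}) undefined)" for i
  have "prob_space (A' i)" "prob_space (B' i)" for i
    using A B by (auto simp: A'_def B'_def intro!: prob_space_return)
  then interpret A: product_prob_space A' + B: product_prob_space B'
    by (auto intro: product_prob_spaceI)
  interpret A: finite_product_prob_space A' I by standard (rule I)
  interpret B: finite_product_prob_space B' I by standard (rule I)
  have AA: "Pi\<^sub>M I A = Pi\<^sub>M I A'" and BB: "Pi\<^sub>M I B = Pi\<^sub>M I B'"
    by (auto intro!: PiM_cong simp: A'_def B'_def)
  have C': "C i \<in> sets (A' i \<Otimes>\<^sub>M B' i)" if "i \<in> I" for i
    using C that by (simp add: A'_def B'_def)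
  let ?X = "{w \<in> space (Pi\<^sub>M I A' \<Otimes>\<^sub>M Pi\<^sub>M I B'). \<forall>i\<in>I. (fst w i, snd w i) \<in> C i}"
  have X: "?X \<in> sets (Pi\<^sub>M I A' \<Otimes>\<^sub>M Pi\<^sub>M I B')"
  proof (intro predE pred_intros_finite I pred_sets2[OF C'])
    fix i assume "i \<in> I"
    then show "(\<lambda>w. (fst w i, snd w i)) \<in> Pi\<^sub>M I A' \<Otimes>\<^sub>M Pi\<^sub>M I B' \<rightarrow>\<^sub>M A' i \<Otimes>\<^sub>M B' i"
      by (intro measurable_Pair measurable_compose[OF measurable_fst measurable_component_singleton]
          measurable_compose[OF measurable_snd measurable_component_singleton])
  qed
  have "emeasure (Pi\<^sub>M I A' \<Otimes>\<^sub>M Pi\<^sub>M I B') ?X = (\<integral>\<^sup>+ x. emeasure (Pi\<^sub>M I B') (Pair x -` ?X) \<partial>Pi\<^sub>M I A')"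
    by (rule B.emeasure_pair_measure_alt[OF X])
  also have "\<dots> = (\<integral>\<^sup>+ x. (\<Prod>i\<in>I. emeasure (B' i) (Pair (x i) -` C i)) \<partial>Pi\<^sub>M I A')"
  proof (rule nn_integral_cong)
    fix x assume x: "x \<in> space (Pi\<^sub>M I A')"
    have CB: "Pair (x i) -` C i \<in> sets (B' i)" if "i \<in> I" for i
      using C'[OF that] by (rule sets_Pair1)
    have "Pair x -` ?X = Pi\<^sub>E I (\<lambda>i. Pair (x i) -` C i)"
      (is "?l = ?r")
    proof (intro set_eqI iffI)
      fix y assume "y \<in> ?l"
      then show "y \<in> ?r" by (auto simp: space_pair_measure space_PiM)
    next
      fix y assume y: "y \<in> ?r"
      then have "y \<in> space (Pi\<^sub>M I B')"
        using sets.sets_into_space[OF CB] by (auto simp: space_PiM PiE_iff)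
      then show "y \<in> ?l" using x y by (auto simp: space_pair_measure)
    qed
    then show "emeasure (Pi\<^sub>M I B') (Pair x -` ?X) = (\<Prod>i\<in>I. emeasure (B' i) (Pair (x i) -` C i))"
      using CB I by (simp add: B.emeasure_PiM)
  qed
  also have "\<dots> = (\<Prod>i\<in>I. \<integral>\<^sup>+ y. emeasure (B' i) (Pair y -` C i) \<partial>A' i)"
    by (rule A.product_nn_integral_prod[OF I]) (rule B.M.measurable_emeasure_Pair[OF C'])
  also have "\<dots> = (\<Prod>i\<in>I. emeasure (A' i \<Otimes>\<^sub>M B' i) (C i))"
    by (intro prod.cong refl B.M.emeasure_pair_measure_alt[symmetric] C')
  also have "\<dots> = (\<Prod>i\<in>I. emeasure (A i \<Otimes>\<^sub>M B i) (C i))"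
    by (intro prod.cong) (auto simp: A'_def B'_def)
  finally show ?thesis unfolding AA BB .
qed

subsection \<open>Rejection sampling\<close>

text \<open>For a fixed acceptance pattern \<open>I\<close> the accepted values sit at known
  positions and independence factorises: an accepted index contributes \<open>p\<close> times
  \<open>Q\<close>, a rejected one \<open>1 - p\<close>. The mass depends on \<open>I\<close> only
  through its size, hence the binomial coefficient.\<close>

lemma (in prob_space) rejection_law:
  fixes Y :: "nat \<Rightarrow> 'a \<Rightarrow> 'y" and f :: "'y \<Rightarrow> 'z"
  assumes "prob_space N" "prob_space Q"
    and mY: "\<And>i. i < n \<Longrightarrow> Y i \<in> M \<rightarrow>\<^sub>M N"
    and ind: "\<And>C. (\<And>i. i < n \<Longrightarrow> C i \<in> sets N) \<Longrightarrow>
      prob {\<omega> \<in> space M. \<forall>i<n. Y i \<omega> \<in> C i} = (\<Prod>i<n. measure N (C i))"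
    and Acc: "Acc \<in> sets N" and mf: "f \<in> N \<rightarrow>\<^sub>M Q"
    and acc: "\<And>E. E \<in> sets Q \<Longrightarrow> measure N {y \<in> Acc. f y \<in> E} = p * measure Q E"
    and E: "E \<in> sets (\<Pi>\<^sub>M j\<in>{..<l}. Q)"
  defines "acpt \<equiv> \<lambda>\<omega>. {i. i < n \<and> Y i \<omega> \<in> Acc}"
  defines "W \<equiv> {\<omega> \<in> space M. card (acpt \<omega>) = l \<and>
      (\<lambda>j\<in>{..<l}. f (Y (sorted_list_of_set (acpt \<omega>) ! j) \<omega>)) \<in> E}"
  shows "W \<in> events" and "prob W = pmf (binomial_pmf n p) l * measure (\<Pi>\<^sub>M j\<in>{..<l}. Q) E"
proof -
  interpret N: prob_space N by fact
  interpret Q: prob_space Q by fact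
  interpret PQ: finite_product_prob_space "\<lambda>_. Q" "{..<l}" by standard simp
  have AccE: "{y \<in> Acc. f y \<in> E} \<in> sets N" if "E \<in> sets Q" for E
  proof -
    have "{y \<in> Acc. f y \<in> E} = Acc \<inter> (f -` E \<inter> space N)"
      using sets.sets_into_space[OF Acc] by auto
    then show ?thesis using Acc measurable_sets[OF mf that] by simp
  qed
  have pAcc: "measure N Acc = p"
  proof -
    have "{y \<in> Acc. f y \<in> space Q} = Acc"
      using sets.sets_into_space[OF Acc] measurable_space[OF mf] by auto
    then show ?thesis using acc[of "space Q"] by (simp add: Q.prob_space)
  qed
  have p: "0 \<le> p" "p \<le> 1" using pAcc N.prob_le_1[of Acc] measure_nonneg[of N Acc] by auto
  define c where "c = p ^ l * (1 - p) ^ (n - l)"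
  have c: "0 \<le> c" using p by (simp add: c_def)
  have fibre: "{\<omega> \<in> space M. acpt \<omega> = I \<and> (\<lambda>j\<in>{..<l}. f (Y (sorted_list_of_set I ! j) \<omega>)) \<in> E} \<in> events
      \<and> prob {\<omega> \<in> space M. acpt \<omega> = I \<and> (\<lambda>j\<in>{..<l}. f (Y (sorted_list_of_set I ! j) \<omega>)) \<in> E}
        = c * PQ.prob E"
    if I: "I \<subseteq> {..<n}" "card I = l" for I
  proof -
    have finI: "finite I" using I finite_subset by auto
    let ?e = "\<lambda>j. sorted_list_of_set I ! j"
    define X where "X = (\<lambda>\<omega>. \<lambda>j\<in>{..<l}. f (Y (?e j) \<omega>))"
    have bij: "bij_betw ?e {..<l} I"
      by (rule bij_betw_nth) (use I finI in auto)
    have e_mem: "?e j \<in> I" if "j < l" for j using bij that by (auto dest: bij_betwE)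
    have mX: "X \<in> M \<rightarrow>\<^sub>M (\<Pi>\<^sub>M j\<in>{..<l}. Q)"
      unfolding X_def
      by (intro measurable_restrict measurable_compose[OF mY mf]) (use e_mem I in auto)
    define A where "A = {\<omega> \<in> space M. acpt \<omega> = I}"
    have A: "A \<in> events"
    proof -
      have "A = {\<omega> \<in> space M. \<forall>i\<in>{..<n}. Y i \<omega> \<in> (if i \<in> I then Acc else space N - Acc)}"
        using I measurable_space[OF mY] unfolding A_def acpt_def by (auto split: if_splits)
      also have "\<dots> \<in> events"
        by (intro predE pred_intros_finite finite_lessThan pred_sets2[OF _ mY]) (use Acc in auto)
      finally show ?thesis .
    qed
    \<comment> \<open>The law of the accepted values restricted to the event of pattern
      \<open>I\<close>. Left unnormalised, it can be compared with a multiple of the product measure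
      even if that event is null.\<close>
    define P where "P = distr (density M (indicator A)) (\<Pi>\<^sub>M j\<in>{..<l}. Q) X"
    have P: "emeasure P F = emeasure M {\<omega> \<in> A. X \<omega> \<in> F}" if F: "F \<in> sets (\<Pi>\<^sub>M j\<in>{..<l}. Q)" for F
    proof -
      have AF: "{\<omega> \<in> A. X \<omega> \<in> F} = A \<inter> (X -` F \<inter> space M)" by (auto simp: A_def)
      have "emeasure P F = emeasure (density M (indicator A)) (X -` F \<inter> space M)"
        unfolding P_def using mX F by (subst emeasure_distr) auto
      also have "\<dots> = (\<integral>\<^sup>+ \<omega>. indicator A \<omega> * indicator (X -` F \<inter> space M) \<omega> \<partial>M)"
        using A measurable_sets[OF mX F] by (intro emeasure_density) auto
      also have "\<dots> = (\<integral>\<^sup>+ \<omega>. indicator {\<omega> \<in> A. X \<omega> \<in> F} \<omega> \<partial>M)"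
        unfolding AF by (intro nn_integral_cong) (simp add: indicator_inter_arith)
      also have "\<dots> = emeasure M {\<omega> \<in> A. X \<omega> \<in> F}"
        unfolding AF using A measurable_sets[OF mX F] by (intro nn_integral_indicator) auto
      finally show ?thesis .
    qed
    have "P = scale_measure (ennreal c) (\<Pi>\<^sub>M j\<in>{..<l}. Q)"
    proof (rule measure_eqI_PiM_finite[where A="\<lambda>_. space (\<Pi>\<^sub>M j\<in>{..<l}. Q)"])
      fix F assume F: "\<And>j. j \<in> {..<l} \<Longrightarrow> F j \<in> sets Q"
      define pos where "pos = inv_into {..<l} ?e"
      have pos: "pos i < l" if "i \<in> I" for i
        using that bij unfolding pos_def bij_betw_def by (metis inv_into_into lessThan_iff)
      have pos_e: "pos (?e j) = j" if "j < l" for j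
        using that bij unfolding pos_def bij_betw_def by (simp add: inv_into_f_f)
      \<comment> \<open>\<open>pos\<close> inverts the increasing enumeration of \<open>I\<close>,
        so a rectangle for the accepted list becomes a separate requirement \<open>C i\<close> on
        each draw.\<close>
      define C where "C i = (if i \<in> I then {y \<in> Acc. f y \<in> F (pos i)} else space N - Acc)" for i
      have C: "C i \<in> sets N" for i
        using Acc AccE F pos unfolding C_def by auto
      have "{\<omega> \<in> A. X \<omega> \<in> Pi\<^sub>E {..<l} F} = {\<omega> \<in> space M. \<forall>i<n. Y i \<omega> \<in> C i}"
      proof (intro set_eqI iffI)
        fix \<omega> assume \<omega>: "\<omega> \<in> {\<omega> \<in> A. X \<omega> \<in> Pi\<^sub>E {..<l} F}"
        have "Y i \<omega> \<in> C i" if i: "i < n" for i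
        proof (cases "i \<in> I")
          case True
          then have "f (Y (?e (pos i)) \<omega>) \<in> F (pos i)"
            using \<omega> pos[OF True] by (auto simp: X_def PiE_iff)
          moreover have "?e (pos i) = i"
            unfolding pos_def using True bij by (intro f_inv_into_f) (auto simp: bij_betw_def)
          ultimately show ?thesis using \<omega> True by (auto simp: C_def A_def acpt_def)
        next
          case False
          then show ?thesis
            using \<omega> i measurable_space[OF mY[OF i], of \<omega>] by (auto simp: C_def A_def acpt_def)
        qed
        then show "\<omega> \<in> {\<omega> \<in> space M. \<forall>i<n. Y i \<omega> \<in> C i}" using \<omega> by (auto simp: A_def)
      next
        fix \<omega> assume \<omega>: "\<omega> \<in> {\<omega> \<in> space M. \<forall>i<n. Y i \<omega> \<in> C i}"
        then have "acpt \<omega> = I"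
          using I unfolding acpt_def C_def by (fastforce split: if_splits)
        moreover have "f (Y (?e j) \<omega>) \<in> F j" if "j < l" for j
        proof -
          have "?e j < n" using e_mem[OF that] I by auto
          then have "Y (?e j) \<omega> \<in> C (?e j)" using \<omega> by auto
          then show ?thesis using e_mem[OF that] pos_e[OF that] by (auto simp: C_def)
        qed
        ultimately show "\<omega> \<in> {\<omega> \<in> A. X \<omega> \<in> Pi\<^sub>E {..<l} F}"
          using \<omega> by (auto simp: A_def X_def)
      qed
      then have "emeasure P (Pi\<^sub>E {..<l} F) = ennreal (prob {\<omega> \<in> space M. \<forall>i<n. Y i \<omega> \<in> C i})"
        using F by (subst P) (auto simp: emeasure_eq_measure intro!: sets_PiM_I_finite)
      also have "prob {\<omega> \<in> space M. \<forall>i<n. Y i \<omega> \<in> C i} = (\<Prod>i<n. N.prob (C i))"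
        by (rule ind) (rule C)
      also have "\<dots> = (\<Prod>i<n. if i \<in> I then p * Q.prob (F (pos i)) else 1 - p)"
        using Acc F pos by (intro prod.cong) (auto simp: C_def acc pAcc N.prob_compl)
      also have "\<dots> = (\<Prod>i\<in>{..<n} \<inter> I. p * Q.prob (F (pos i))) * (1 - p) ^ card ({..<n} \<inter> - I)"
        by (simp only: prod.If_cases finite_lessThan Collect_mem_eq prod_constant)
      also have "{..<n} \<inter> I = I" using I by auto
      also have "{..<n} \<inter> - I = {..<n} - I" by auto
      also have "card ({..<n} - I) = n - l" using I finI by (simp add: card_Diff_subset)
      also have "(\<Prod>i\<in>I. p * Q.prob (F (pos i))) = p ^ l * (\<Prod>i\<in>I. Q.prob (F (pos i)))"
        using I by (simp add: prod.distrib)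
      also have "(\<Prod>i\<in>I. Q.prob (F (pos i))) = (\<Prod>j\<in>{..<l}. Q.prob (F (pos (?e j))))"
        by (rule prod.reindex_bij_betw[OF bij, symmetric])
      also have "\<dots> = (\<Prod>j\<in>{..<l}. Q.prob (F j))" by (intro prod.cong) (auto simp: pos_e)
      also have "\<dots> = PQ.prob (Pi\<^sub>E {..<l} F)" using F by (intro PQ.finite_measure_PiM_emb[symmetric])
      also have "p ^ l * PQ.prob (Pi\<^sub>E {..<l} F) * (1 - p) ^ (n - l) = c * PQ.prob (Pi\<^sub>E {..<l} F)"
        by (simp add: c_def mult_ac)
      also have "ennreal \<dots> = emeasure (scale_measure (ennreal c) (\<Pi>\<^sub>M j\<in>{..<l}. Q)) (Pi\<^sub>E {..<l} F)"
        using c by (simp add: PQ.emeasure_eq_measure ennreal_mult)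
      finally show "emeasure P (Pi\<^sub>E {..<l} F)
        = emeasure (scale_measure (ennreal c) (\<Pi>\<^sub>M j\<in>{..<l}. Q)) (Pi\<^sub>E {..<l} F)" .
    next
      show "range (\<lambda>_. space (\<Pi>\<^sub>M j\<in>{..<l}. Q)) \<subseteq> prod_algebra {..<l} (\<lambda>_. Q)"
        by (auto simp: space_PiM intro!: prod_algebraI_finite)
      show "emeasure P (space (\<Pi>\<^sub>M j\<in>{..<l}. Q)) \<noteq> \<infinity>" for i :: nat
        by (subst P) (auto simp: emeasure_eq_measure)
    qed (auto simp: P_def)
    then have "emeasure M {\<omega> \<in> A. X \<omega> \<in> E} = ennreal (c * PQ.prob E)"
      using P[OF E] c by (simp add: PQ.emeasure_eq_measure ennreal_mult)
    moreover have "{\<omega> \<in> A. X \<omega> \<in> E} = A \<inter> (X -` E \<inter> space M)" by (auto simp: A_def)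
    moreover have "{\<omega> \<in> A. X \<omega> \<in> E}
        = {\<omega> \<in> space M. acpt \<omega> = I \<and> (\<lambda>j\<in>{..<l}. f (Y (?e j) \<omega>)) \<in> E}"
      by (auto simp: A_def X_def)
    ultimately show ?thesis
      using c A measurable_sets[OF mX E] by (simp add: emeasure_eq_measure)
  qed
  let ?S = "{I. I \<subseteq> {..<n} \<and> card I = l}"
  let ?W = "\<lambda>I. {\<omega> \<in> space M. acpt \<omega> = I \<and> (\<lambda>j\<in>{..<l}. f (Y (sorted_list_of_set I ! j) \<omega>)) \<in> E}"
  have finS: "finite ?S" by (rule finite_subset[of _ "Pow {..<n}"]) auto
  have W: "W = (\<Union>I\<in>?S. ?W I)"
    unfolding W_def by (auto simp: acpt_def)
  show "W \<in> events" unfolding W by (intro sets.finite_UN finS) (use fibre in blast)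
  have "prob W = (\<Sum>I\<in>?S. prob (?W I))"
    unfolding W
    by (rule finite_measure_finite_Union[OF finS]) (use fibre in \<open>auto simp: disjoint_family_on_def\<close>)
  also have "\<dots> = (\<Sum>I\<in>?S. c * PQ.prob E)" by (intro sum.cong refl) (use fibre in blast)
  also have "\<dots> = real (n choose l) * (c * PQ.prob E)" using n_subsets[of "{..<n}" l] by simp
  also have "\<dots> = pmf (binomial_pmf n p) l * PQ.prob E" using p by (simp add: c_def)
  finally show "prob W = pmf (binomial_pmf n p) l * PQ.prob E" .
qed

section \<open>Integration against the joint law of context, action and reward\<close>

lemma measurable_joint_law_kernel:
  assumes PR: "(\<lambda>(s, a). PR s a) \<in> PS \<Otimes>\<^sub>M da \<rightarrow>\<^sub>M prob_algebra borel"
  defines "N \<equiv> PS \<Otimes>\<^sub>M da \<Otimes>\<^sub>M (borel :: real measure)"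
  defines "K \<equiv> \<lambda>s a. PR s a \<bind> (\<lambda>r. return N (s, a, r))"
  shows "(\<lambda>w. K (fst w) (snd w)) \<in> PS \<Otimes>\<^sub>M da \<rightarrow>\<^sub>M subprob_algebra N"
    and "is_policy PS da p \<Longrightarrow> (\<lambda>s. density da (\<lambda>a. ennreal (p s a)) \<bind> K s) \<in> PS \<rightarrow>\<^sub>M subprob_algebra N"
proof -
  have PR': "(\<lambda>w. PR (fst w) (snd w)) \<in> PS \<Otimes>\<^sub>M da \<rightarrow>\<^sub>M subprob_algebra borel"
    using measurable_prob_algebraD[OF PR] by (simp add: case_prod_beta')
  show K: "(\<lambda>w. K (fst w) (snd w)) \<in> PS \<Otimes>\<^sub>M da \<rightarrow>\<^sub>M subprob_algebra N"
    unfolding K_def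
  proof (rule measurable_bind[OF PR'])
    show "(\<lambda>w. return N (fst (fst w), snd (fst w), snd w))
        \<in> (PS \<Otimes>\<^sub>M da) \<Otimes>\<^sub>M borel \<rightarrow>\<^sub>M subprob_algebra N"
      unfolding N_def by (rule measurable_compose[OF _ return_measurable]) measurable
  qed
  assume "is_policy PS da p"
  then have D: "(\<lambda>s. density da (\<lambda>a. ennreal (p s a))) \<in> PS \<rightarrow>\<^sub>M subprob_algebra da"
    by (intro measurable_prob_algebraD) (simp add: is_policy_def)
  show "(\<lambda>s. density da (\<lambda>a. ennreal (p s a)) \<bind> K s) \<in> PS \<rightarrow>\<^sub>M subprob_algebra N"
    by (rule measurable_bind[OF D K])
qed

lemma sets_joint_law:
  assumes "(\<lambda>(s, a). PR s a) \<in> PS \<Otimes>\<^sub>M da \<rightarrow>\<^sub>M prob_algebra borel"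
    and "is_policy PS da p" and "prob_space PS"
  shows "sets (joint_law PS da PR p) = sets (PS \<Otimes>\<^sub>M da \<Otimes>\<^sub>M borel)"
  using sets_bind[OF sets_kernel[OF measurable_joint_law_kernel(2)] prob_space.not_empty] assms
  by (simp add: joint_law_def)

text \<open>Unfolds the nested binds. The order of integration is kept throughout, since
  \<open>da\<close> is not assumed to be sigma-finite and its integral cannot be exchanged
  freely.\<close>

lemma nn_integral_joint_law:
  assumes PR: "(\<lambda>(s, a). PR s a) \<in> PS \<Otimes>\<^sub>M da \<rightarrow>\<^sub>M prob_algebra borel"
    and pol: "is_policy PS da p"
    and f: "f \<in> borel_measurable (PS \<Otimes>\<^sub>M da \<Otimes>\<^sub>M borel)"
  shows "(\<integral>\<^sup>+ w. f w \<partial>joint_law PS da PR p)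
    = (\<integral>\<^sup>+ s. \<integral>\<^sup>+ a. ennreal (p s a) * (\<integral>\<^sup>+ r. f (s, a, r) \<partial>PR s a) \<partial>da \<partial>PS)"
proof -
  let ?N = "PS \<Otimes>\<^sub>M da \<Otimes>\<^sub>M (borel :: real measure)"
  let ?D = "\<lambda>s. density da (\<lambda>a. ennreal (p s a))"
  let ?K = "\<lambda>s a. PR s a \<bind> (\<lambda>r. return ?N (s, a, r))"
  have p: "(\<lambda>w. p (fst w) (snd w)) \<in> borel_measurable (PS \<Otimes>\<^sub>M da)"
    using pol by (simp add: is_policy_def case_prod_beta')
  note K = measurable_joint_law_kernel(1)[OF PR]
  note DK = measurable_joint_law_kernel(2)[OF PR pol]
  have "(\<integral>\<^sup>+ w. f w \<partial>joint_law PS da PR p) = (\<integral>\<^sup>+ s. \<integral>\<^sup>+ w. f w \<partial>(?D s \<bind> ?K s) \<partial>PS)"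
    unfolding joint_law_def by (rule nn_integral_bind[OF f DK])
  also have "\<dots> = (\<integral>\<^sup>+ s. \<integral>\<^sup>+ a. ennreal (p s a) * (\<integral>\<^sup>+ r. f (s, a, r) \<partial>PR s a) \<partial>da \<partial>PS)"
  proof (rule nn_integral_cong)
    fix s assume s: "s \<in> space PS"
    have Ks: "?K s \<in> da \<rightarrow>\<^sub>M subprob_algebra ?N"
      using measurable_compose[OF measurable_Pair1'[OF s] K] by simp
    have ps: "(\<lambda>a. ennreal (p s a)) \<in> borel_measurable da"
      using measurable_compose[OF measurable_Pair1'[OF s] p] by simp
    have "(\<integral>\<^sup>+ w. f w \<partial>(?D s \<bind> ?K s)) = (\<integral>\<^sup>+ a. \<integral>\<^sup>+ w. f w \<partial>?K s a \<partial>?D s)"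
      by (rule nn_integral_bind[OF f]) (use Ks in simp)
    also have "\<dots> = (\<integral>\<^sup>+ a. ennreal (p s a) * (\<integral>\<^sup>+ w. f w \<partial>?K s a) \<partial>da)"
      by (rule nn_integral_density[OF ps])
        (rule measurable_compose[OF Ks nn_integral_measurable_subprob_algebra[OF f]])
    also have "\<dots> = (\<integral>\<^sup>+ a. ennreal (p s a) * (\<integral>\<^sup>+ r. f (s, a, r) \<partial>PR s a) \<partial>da)"
    proof (intro nn_integral_cong arg_cong2[where f="(*)"] refl)
      fix a assume a: "a \<in> space da"
      have "PR s a \<in> space (subprob_algebra borel)"
        using measurable_space[OF measurable_prob_algebraD[OF PR], of "(s, a)"] s a
        by (simp add: space_pair_measure)
      then have sPR: "sets (PR s a) = sets borel" by (simp add: space_subprob_algebra)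
      have "(\<lambda>r. (s, a, r)) \<in> borel \<rightarrow>\<^sub>M ?N" using s a by measurable
      then have m: "(\<lambda>r. (s, a, r)) \<in> PR s a \<rightarrow>\<^sub>M ?N" by (simp add: measurable_cong_sets[OF sPR refl])
      have "(\<integral>\<^sup>+ w. f w \<partial>?K s a) = (\<integral>\<^sup>+ r. \<integral>\<^sup>+ w. f w \<partial>return ?N (s, a, r) \<partial>PR s a)"
        by (rule nn_integral_bind[OF f measurable_compose[OF m return_measurable]])
      also have "\<dots> = (\<integral>\<^sup>+ r. f (s, a, r) \<partial>PR s a)"
        by (intro nn_integral_cong nn_integral_return f) (use s a in \<open>simp add: space_pair_measure\<close>)
      finally show "(\<integral>\<^sup>+ w. f w \<partial>?K s a) = (\<integral>\<^sup>+ r. f (s, a, r) \<partial>PR s a)" .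
    qed
    finally show "(\<integral>\<^sup>+ w. f w \<partial>(?D s \<bind> ?K s))
      = (\<integral>\<^sup>+ a. ennreal (p s a) * (\<integral>\<^sup>+ r. f (s, a, r) \<partial>PR s a) \<partial>da)" .
  qed
  finally show ?thesis .
qed

section \<open>The density ratio bound and the acceptance probability\<close>

context
  fixes PS :: "'s measure" and da :: "'a measure" and \<pi>b \<pi>e :: "'s \<Rightarrow> 'a \<Rightarrow> real" and B :: real
  assumes PS: "prob_space PS" and pol: "is_policy PS da \<pi>b" "is_policy PS da \<pi>e"
    and fin: "ratio_bound PS da \<pi>e \<pi>b < \<infinity>"
    and B: "B = real_of_ereal (ratio_bound PS da \<pi>e \<pi>b)"
begin

text \<open>Both densities have total mass one, so it suffices to integrate the pointwise inequality
  over the actions at any one context.\<close>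

lemma admissible_ratio_ge_1:
  assumes b: "\<forall>s\<in>space PS. \<forall>a\<in>space da. \<pi>e s a \<le> b * \<pi>b s a"
  shows "1 \<le> b"
proof -
  interpret PS: prob_space PS by fact
  obtain s where s: "s \<in> space PS" using PS.not_empty by blast
  have int: "(\<integral>\<^sup>+ a. ennreal (p s a) \<partial>da) = 1" and m: "(\<lambda>a. ennreal (p s a)) \<in> borel_measurable da"
    and nn: "\<forall>a\<in>space da. 0 \<le> p s a"
    if "is_policy PS da p" for p
  proof -
    have p: "(\<lambda>w. p (fst w) (snd w)) \<in> borel_measurable (PS \<Otimes>\<^sub>M da)"
      using that by (simp add: is_policy_def case_prod_beta')
    then show m: "(\<lambda>a. ennreal (p s a)) \<in> borel_measurable da"
      using measurable_compose[OF measurable_Pair1'[OF s] p] by simp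
    have "density da (\<lambda>a. ennreal (p s a)) \<in> space (prob_algebra da)"
      using that s by (auto simp: is_policy_def dest: measurable_space)
    then have "prob_space (density da (\<lambda>a. ennreal (p s a)))" by (simp add: space_prob_algebra)
    from prob_space.emeasure_space_1[OF this] show "(\<integral>\<^sup>+ a. ennreal (p s a) \<partial>da) = 1"
      using m by (simp add: emeasure_density cong: nn_integral_cong)
    show "\<forall>a\<in>space da. 0 \<le> p s a" using that s by (simp add: is_policy_def)
  qed
  have "1 = (\<integral>\<^sup>+ a. ennreal (\<pi>e s a) \<partial>da)" using int[OF pol(2)] by simp
  also have "\<dots> \<le> (\<integral>\<^sup>+ a. ennreal b * ennreal (\<pi>b s a) \<partial>da)"
  proof (rule nn_integral_mono)
    fix a assume a: "a \<in> space da"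
    \<comment> \<open>The sign of \<open>b\<close> is not known yet, and \<open>ennreal\<close>
      sends negative numbers to zero, so \<open>b\<close> is first replaced by its nonnegative
      part.\<close>
    have "\<pi>e s a \<le> max b 0 * \<pi>b s a"
      using b s a nn[OF pol(1)] mult_right_mono[of b "max b 0" "\<pi>b s a"] by fastforce
    then have "ennreal (\<pi>e s a) \<le> ennreal (max b 0 * \<pi>b s a)" by (rule ennreal_leI)
    also have "\<dots> = ennreal b * ennreal (\<pi>b s a)"
      using nn[OF pol(1)] a by (simp add: ennreal_mult max_def ennreal_neg)
    finally show "ennreal (\<pi>e s a) \<le> ennreal b * ennreal (\<pi>b s a)" .
  qed
  also have "\<dots> = ennreal b" using m[OF pol(1)] int[OF pol(1)] by (simp add: nn_integral_cmult)
  finally show "1 \<le> b" by (metis ennreal_ge_1)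
qed

text \<open>Finiteness provides an admissible bound and \<open>1\<close> is a lower bound, so the
  infimum is real. It is itself admissible: where \<open>\<pi>b\<close> vanishes, any admissible
  bound forces \<open>\<pi>e\<close> to vanish too; elsewhere the quotient is below every admissible
  bound, hence below the infimum.\<close>

lemma ratio_bound_attained:
  shows "1 \<le> B" and "\<And>s a. s \<in> space PS \<Longrightarrow> a \<in> space da \<Longrightarrow> \<pi>e s a \<le> B * \<pi>b s a"
proof -
  let ?X = "{b. \<forall>s\<in>space PS. \<forall>a\<in>space da. \<pi>e s a \<le> b * \<pi>b s a}"
  have ne: "?X \<noteq> {}"
  proof
    assume "?X = {}"
    then have "ratio_bound PS da \<pi>e \<pi>b = Inf (ereal ` {})" by (simp only: ratio_bound_def)
    then show False using fin by (simp add: top_ereal_def)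
  qed
  have bdd: "bdd_below ?X" by (rule bdd_belowI[of _ 1]) (use admissible_ratio_ge_1 in auto)
  have "ereal 1 \<le> ratio_bound PS da \<pi>e \<pi>b"
    unfolding ratio_bound_def by (intro Inf_greatest) (use admissible_ratio_ge_1 in auto)
  then obtain b0 where b0: "ratio_bound PS da \<pi>e \<pi>b = ereal b0"
    using fin by (cases "ratio_bound PS da \<pi>e \<pi>b") auto
  then have B0: "ratio_bound PS da \<pi>e \<pi>b = ereal B" using B by simp
  then show "1 \<le> B" using \<open>ereal 1 \<le> _\<close> by simp
  fix s a assume s: "s \<in> space PS" and a: "a \<in> space da"
  have nb: "0 \<le> \<pi>b s a" using pol(1) s a by (simp add: is_policy_def)
  show "\<pi>e s a \<le> B * \<pi>b s a"
  proof (cases "\<pi>b s a = 0")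
    case True
    then show ?thesis using ne s a by fastforce
  next
    case False
    then have pos: "0 < \<pi>b s a" using nb by simp
    have "ereal (\<pi>e s a / \<pi>b s a) \<le> ratio_bound PS da \<pi>e \<pi>b"
      unfolding ratio_bound_def
      by (intro Inf_greatest) (use s a pos in \<open>auto simp: divide_le_eq\<close>)
    then show ?thesis using B0 pos by (simp add: divide_le_eq)
  qed
qed

text \<open>Given its context, action and reward, a draw is accepted with probability
  \<open>weight / B\<close>, and multiplication by \<open>\<pi>b\<close> leaves
  \<open>\<pi>e / B\<close>. Accepted draws thus carry the target law scaled by
  \<open>1 / B\<close>.\<close>

lemma emeasure_accept:
  fixes PR :: "'s \<Rightarrow> 'a \<Rightarrow> real measure"
  assumes PR: "(\<lambda>(s, a). PR s a) \<in> PS \<Otimes>\<^sub>M da \<rightarrow>\<^sub>M prob_algebra borel"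
    and E: "E \<in> sets (PS \<Otimes>\<^sub>M borel)"
  defines "N \<equiv> joint_law PS da PR \<pi>b \<Otimes>\<^sub>M uniform_measure lborel {0..1::real}"
  defines "acc \<equiv> \<lambda>((s, a, r), v). v \<le> weight \<pi>e \<pi>b s a / B"
  shows "{y \<in> space N. acc y} \<in> sets N"
    and "(\<lambda>((s, a, r), v). (s, r)) \<in> N \<rightarrow>\<^sub>M PS \<Otimes>\<^sub>M borel"
    and "emeasure N {y \<in> {y \<in> space N. acc y}. (\<lambda>((s, a, r), v). (s, r)) y \<in> E}
      = ennreal (1 / B) * emeasure (context_reward_law PS da PR \<pi>e) E"
proof -
  let ?L = "PS \<Otimes>\<^sub>M da \<Otimes>\<^sub>M (borel :: real measure)"
  let ?U = "uniform_measure lborel {0..1::real}"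
  let ?J = "\<lambda>p. joint_law PS da PR p"
  note B1 = ratio_bound_attained(1)
  interpret U: prob_space ?U by (rule prob_space_uniform_measure) auto
  have sJ: "sets (?J \<pi>b) = sets ?L" "sets (?J \<pi>e) = sets ?L"
    using sets_joint_law[OF PR _ PS] pol by auto
  have sN: "sets N = sets (?L \<Otimes>\<^sub>M (borel :: real measure))"
    unfolding N_def using sJ by (intro sets_pair_measure_cong) auto
  note mN = measurable_cong_sets[OF sN refl]
  have p [measurable]: "(\<lambda>w. \<pi>b (fst w) (snd w)) \<in> borel_measurable (PS \<Otimes>\<^sub>M da)"
    "(\<lambda>w. \<pi>e (fst w) (snd w)) \<in> borel_measurable (PS \<Otimes>\<^sub>M da)"
    using pol by (simp_all add: is_policy_def case_prod_beta')
  have p1 [measurable]: "(\<lambda>w. \<pi>b (fst w) (fst (snd w))) \<in> borel_measurable ?L"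
    "(\<lambda>w. \<pi>e (fst w) (fst (snd w))) \<in> borel_measurable ?L"
  proof -
    have m: "(\<lambda>w. (fst w, fst (snd w))) \<in> ?L \<rightarrow>\<^sub>M PS \<Otimes>\<^sub>M da" by measurable
    show "(\<lambda>w. \<pi>b (fst w) (fst (snd w))) \<in> borel_measurable ?L"
      "(\<lambda>w. \<pi>e (fst w) (fst (snd w))) \<in> borel_measurable ?L"
      using measurable_compose[OF m p(1)] measurable_compose[OF m p(2)] by simp_all
  qed
  define ww where "ww = (\<lambda>w :: 's \<times> 'a \<times> real. weight \<pi>e \<pi>b (fst w) (fst (snd w)) / B)"
  have ww [measurable]: "ww \<in> borel_measurable ?L" unfolding ww_def weight_def by measurable
  have acc: "acc y \<longleftrightarrow> snd y \<le> ww (fst y)" for y by (auto simp: acc_def ww_def split: prod.split)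
  have "Measurable.pred (?L \<Otimes>\<^sub>M borel) (\<lambda>y. snd y \<le> ww (fst y))" by measurable
  then show Acc: "{y \<in> space N. acc y} \<in> sets N"
    unfolding acc by (simp add: sN sets_eq_imp_space_eq[OF sN] pred_def)
  show mf: "(\<lambda>((s, a, r), v). (s, r)) \<in> N \<rightarrow>\<^sub>M PS \<Otimes>\<^sub>M borel"
    unfolding mN case_prod_beta' by measurable
  let ?A = "{y \<in> {y \<in> space N. acc y}. (\<lambda>((s, a, r), v). (s, r)) y \<in> E}"
  have A: "?A \<in> sets N"
  proof -
    have "?A = {y \<in> space N. acc y} \<inter> ((\<lambda>((s, a, r), v). (s, r)) -` E \<inter> space N)" by auto
    then show ?thesis using Acc measurable_sets[OF mf E] by simp
  qed
  have Em [measurable]: "Measurable.pred ?L (\<lambda>w. (fst w, snd (snd w)) \<in> E)"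
    by (rule pred_sets2[OF E]) measurable
  define h :: "'s \<times> 'a \<times> real \<Rightarrow> ennreal" where "h w = indicator E (fst w, snd (snd w))" for w
  have h [measurable]: "h \<in> borel_measurable ?L" unfolding h_def
    by (rule borel_measurable_indicator'[OF predE[OF Em]])
  \<comment> \<open>As \<open>B\<close> is attained, the ratio lies in the unit interval. Where
    \<open>\<pi>b\<close> is zero, so is \<open>\<pi>e\<close>, and the convention
    \<open>0 / 0 = 0\<close> preserves the product identity.\<close>
  have ww01: "0 \<le> ww w \<and> ww w \<le> 1 \<and> ennreal (\<pi>b (fst w) (fst (snd w))) * ennreal (ww w)
      = ennreal (1 / B) * ennreal (\<pi>e (fst w) (fst (snd w)))" if w: "w \<in> space ?L" for w
  proof -
    obtain s a r where sar: "w = (s, a, r)" by (metis prod.collapse)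
    have sa: "s \<in> space PS" "a \<in> space da" using w by (auto simp: sar space_pair_measure)
    have nn: "0 \<le> \<pi>b s a" "0 \<le> \<pi>e s a" using pol sa by (auto simp: is_policy_def)
    have le: "\<pi>e s a \<le> B * \<pi>b s a" by (rule ratio_bound_attained(2)[OF sa])
    have "\<pi>b s a * ww w = 1 / B * \<pi>e s a"
      using nn le B1 by (cases "\<pi>b s a = 0") (auto simp: ww_def weight_def sar)
    moreover have "0 \<le> ww w" using nn B1 by (simp add: ww_def weight_def sar)
    moreover have "ww w \<le> 1" using nn le B1 by (cases "\<pi>b s a = 0") (auto simp: ww_def weight_def sar field_simps)
    ultimately show ?thesis using nn B1 by (simp add: sar flip: ennreal_mult)
  qed
  have Ucdf: "emeasure ?U {..t} = ennreal t" if "0 \<le> t" "t \<le> 1" for t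
  proof -
    have "{0..1} \<inter> {..t} = {0..t}" using that by auto
    then show ?thesis using that divide_ennreal[of t 1] by (simp add: emeasure_uniform_measure)
  qed
  have "emeasure N ?A = (\<integral>\<^sup>+ w. emeasure ?U (Pair w -` ?A) \<partial>?J \<pi>b)"
    using U.emeasure_pair_measure_alt[OF A[unfolded N_def]] unfolding N_def .
  also have "\<dots> = (\<integral>\<^sup>+ w. h w * ennreal (ww w) \<partial>?J \<pi>b)"
  proof (rule nn_integral_cong)
    fix w assume "w \<in> space (?J \<pi>b)"
    then have w: "w \<in> space ?L" using sets_eq_imp_space_eq[OF sJ(1)] by simp
    have "Pair w -` ?A = (if (fst w, snd (snd w)) \<in> E then {..ww w} else {})"
      using w by (auto simp: acc sets_eq_imp_space_eq[OF sN] space_pair_measure split: prod.splits)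
    then show "emeasure ?U (Pair w -` ?A) = h w * ennreal (ww w)"
      using ww01[OF w] divide_ennreal[of "ww w" 1] by (simp add: h_def Ucdf)
  qed
  also have "\<dots> = (\<integral>\<^sup>+ s. \<integral>\<^sup>+ a. ennreal (\<pi>b s a) * (\<integral>\<^sup>+ r. h (s, a, r) * ennreal (ww (s, a, r)) \<partial>PR s a) \<partial>da \<partial>PS)"
    by (rule nn_integral_joint_law[OF PR pol(1)]) measurable
  also have "\<dots> = (\<integral>\<^sup>+ s. \<integral>\<^sup>+ a. ennreal (\<pi>e s a) * (\<integral>\<^sup>+ r. ennreal (1 / B) * h (s, a, r) \<partial>PR s a) \<partial>da \<partial>PS)"
  proof (intro nn_integral_cong)
    fix s a assume sa: "s \<in> space PS" "a \<in> space da"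
    have "PR s a \<in> space (prob_algebra borel)"
      using measurable_space[OF PR, of "(s, a)"] sa by (simp add: space_pair_measure)
    then have sPR: "sets (PR s a) = sets borel" by (simp add: space_prob_algebra)
    have "(\<lambda>r. (s, a, r)) \<in> borel \<rightarrow>\<^sub>M ?L" using sa by measurable
    from measurable_compose[OF this h] have hs [measurable]: "(\<lambda>r. h (s, a, r)) \<in> borel_measurable (PR s a)"
      by (simp add: measurable_cong_sets[OF sPR refl])
    define c where "c = weight \<pi>e \<pi>b s a / B"
    have w0: "ww (s, a, r) = c" for r by (simp add: ww_def c_def)
    have "(s, a, 0) \<in> space ?L" using sa by (simp add: space_pair_measure)
    from ww01[OF this] have *: "ennreal (\<pi>b s a) * ennreal c = ennreal (1 / B) * ennreal (\<pi>e s a)"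
      by (simp add: w0)
    have "ennreal (\<pi>b s a) * (\<integral>\<^sup>+ r. h (s, a, r) * ennreal (ww (s, a, r)) \<partial>PR s a)
      = (ennreal (\<pi>b s a) * ennreal c) * (\<integral>\<^sup>+ r. h (s, a, r) \<partial>PR s a)"
      unfolding w0 nn_integral_multc[OF hs] by (simp only: mult_ac)
    also have "\<dots> = ennreal (\<pi>e s a) * (\<integral>\<^sup>+ r. ennreal (1 / B) * h (s, a, r) \<partial>PR s a)"
      unfolding * nn_integral_cmult[OF hs] by (simp only: mult_ac)
    finally show "ennreal (\<pi>b s a) * (\<integral>\<^sup>+ r. h (s, a, r) * ennreal (ww (s, a, r)) \<partial>PR s a)
      = ennreal (\<pi>e s a) * (\<integral>\<^sup>+ r. ennreal (1 / B) * h (s, a, r) \<partial>PR s a)" .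
  qed
  also have "\<dots> = (\<integral>\<^sup>+ w. ennreal (1 / B) * h w \<partial>?J \<pi>e)"
    by (rule nn_integral_joint_law[OF PR pol(2), symmetric]) measurable
  also have "\<dots> = ennreal (1 / B) * (\<integral>\<^sup>+ w. h w \<partial>?J \<pi>e)"
    by (rule nn_integral_cmult) (simp add: measurable_cong_sets[OF sJ(2) refl])
  also have "(\<integral>\<^sup>+ w. h w \<partial>?J \<pi>e) = emeasure (context_reward_law PS da PR \<pi>e) E"
  proof -
    have m: "(\<lambda>(s, a, r). (s, r)) \<in> ?J \<pi>e \<rightarrow>\<^sub>M PS \<Otimes>\<^sub>M borel"
      unfolding measurable_cong_sets[OF sJ(2) refl] case_prod_beta' by measurable
    have "emeasure (context_reward_law PS da PR \<pi>e) E
      = (\<integral>\<^sup>+ z. indicator E z \<partial>context_reward_law PS da PR \<pi>e)"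
      using E by (simp add: context_reward_law_def)
    also have "\<dots> = (\<integral>\<^sup>+ w. h w \<partial>?J \<pi>e)"
      unfolding context_reward_law_def using E
      by (subst nn_integral_distr[OF m]) (auto simp: h_def intro!: nn_integral_cong)
    finally show ?thesis ..
  qed
  finally show "emeasure N ?A = ennreal (1 / B) * emeasure (context_reward_law PS da PR \<pi>e) E" .
qed

end

section \<open>Law of the accepted sample\<close>

lemma rejection_sample_eq_map_sorted_list_of_set:
  "rejection_sample w B n s a r v
    = map (\<lambda>i. (s i, r i)) (sorted_list_of_set {i. i < n \<and> v i \<le> w (s i) (a i) / B})"
proof -
  let ?xs = "filter (\<lambda>i. v i \<le> w (s i) (a i) / B) [0..<n]"
  have "sorted_list_of_set (set ?xs) = ?xs"
    by (rule sorted_list_of_set.idem_if_sorted_distinct) (auto intro: sorted_wrt_filter)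
  moreover have "set ?xs = {i. i < n \<and> v i \<le> w (s i) (a i) / B}" by auto
  ultimately show ?thesis by (simp add: rejection_sample_def)
qed

text \<open>The draws are the pairs of a data point and its uniform variable; their independence is
  assembled from independence within and between the two blocks. The product form, instead of a
  conditional law given the size, also makes sense for sizes of probability zero.\<close>

lemma (in prob_space) rejection_sample_law:
  fixes S :: "nat \<Rightarrow> 'a \<Rightarrow> 's" and A :: "nat \<Rightarrow> 'a \<Rightarrow> 'c" and R V :: "nat \<Rightarrow> 'a \<Rightarrow> real"
    and PR :: "'s \<Rightarrow> 'c \<Rightarrow> real measure" and B :: real
  assumes PS: "prob_space PS"
    and PR: "(\<lambda>(s, a). PR s a) \<in> PS \<Otimes>\<^sub>M da \<rightarrow>\<^sub>M prob_algebra borel"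
    and pol: "is_policy PS da \<pi>b" "is_policy PS da \<pi>e"
    and fin: "ratio_bound PS da \<pi>e \<pi>b < \<infinity>" and B: "B = real_of_ereal (ratio_bound PS da \<pi>e \<pi>b)"
    and n: "1 \<le> n"
    and iD: "indep_vars (\<lambda>_. PS \<Otimes>\<^sub>M da \<Otimes>\<^sub>M borel) (\<lambda>i \<omega>. (S i \<omega>, A i \<omega>, R i \<omega>)) {..<n}"
    and dD: "\<And>i. i < n \<Longrightarrow>
      distr M (PS \<Otimes>\<^sub>M da \<Otimes>\<^sub>M borel) (\<lambda>\<omega>. (S i \<omega>, A i \<omega>, R i \<omega>)) = joint_law PS da PR \<pi>b"
    and iV: "indep_vars (\<lambda>_. borel) V {..<n}"
    and dV: "\<And>i. i < n \<Longrightarrow> distr M borel (V i) = uniform_measure lborel {0..1}"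
    and ind: "independent_rvs M
      (\<Pi>\<^sub>M i\<in>{..<n}. PS \<Otimes>\<^sub>M da \<Otimes>\<^sub>M borel) (\<lambda>\<omega>. \<lambda>i\<in>{..<n}. (S i \<omega>, A i \<omega>, R i \<omega>))
      (\<Pi>\<^sub>M i\<in>{..<n}. borel) (\<lambda>\<omega>. \<lambda>i\<in>{..<n}. V i \<omega>)"
    and Q: "prob_space (context_reward_law PS da PR \<pi>e)"
    and E: "E \<in> sets (\<Pi>\<^sub>M j\<in>{..<l}. PS \<Otimes>\<^sub>M borel)"
  defines "X \<equiv> \<lambda>\<omega>. rejection_sample (weight \<pi>e \<pi>b) B n
      (\<lambda>i. S i \<omega>) (\<lambda>i. A i \<omega>) (\<lambda>i. R i \<omega>) (\<lambda>i. V i \<omega>)"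
  shows "{\<omega> \<in> space M. length (X \<omega>) = l \<and> (\<lambda>j\<in>{..<l}. X \<omega> ! j) \<in> E} \<in> events" (is "?W \<in> _")
    and "prob {\<omega> \<in> space M. length (X \<omega>) = l \<and> (\<lambda>j\<in>{..<l}. X \<omega> ! j) \<in> E}
      = pmf (binomial_pmf n (1 / B)) l * measure (\<Pi>\<^sub>M j\<in>{..<l}. context_reward_law PS da PR \<pi>e) E"
proof -
  let ?L = "PS \<Otimes>\<^sub>M da \<Otimes>\<^sub>M (borel :: real measure)"
  let ?J = "joint_law PS da PR \<pi>b"
  let ?U = "uniform_measure lborel {0..1::real}"
  let ?Q = "context_reward_law PS da PR \<pi>e"
  define N where "N = ?J \<Otimes>\<^sub>M ?U"
  define acc :: "('s \<times> 'c \<times> real) \<times> real \<Rightarrow> bool"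
    where "acc = (\<lambda>((s, a, r), v). v \<le> weight \<pi>e \<pi>b s a / B)"
  define f :: "('s \<times> 'c \<times> real) \<times> real \<Rightarrow> 's \<times> real" where "f = (\<lambda>((s, a, r), v). (s, r))"
  define D where "D = (\<lambda>i \<omega>. (S i \<omega>, A i \<omega>, R i \<omega>))"
  define Y where "Y = (\<lambda>i \<omega>. (D i \<omega>, V i \<omega>))"
  let ?Acc = "{y \<in> space N. acc y}"
  have sJ: "sets ?J = sets ?L" by (rule sets_joint_law[OF PR pol(1) PS])
  have sQ: "sets ?Q = sets (PS \<Otimes>\<^sub>M borel)" by (simp add: context_reward_law_def)
  have mD: "D i \<in> M \<rightarrow>\<^sub>M ?L" if "i < n" for i using iD that by (auto simp: indep_vars_def D_def)
  have mV: "V i \<in> borel_measurable M" if "i < n" for i using iV that by (auto simp: indep_vars_def)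
  have "prob_space (distr M ?L (D 0))" using n by (intro prob_space_distr mD) simp
  then interpret J: prob_space ?J using dD[of 0] n by (simp add: D_def)
  interpret U: prob_space ?U by (rule prob_space_uniform_measure) auto
  interpret N: pair_prob_space ?J ?U by standard
  have PN: "prob_space N" unfolding N_def by (rule N.prob_space_axioms)
  have ne: "{..<n} \<noteq> {}" using n by (auto simp: lessThan_empty_iff)
  have DV: "distr M ((\<Pi>\<^sub>M i\<in>{..<n}. ?L) \<Otimes>\<^sub>M (\<Pi>\<^sub>M i\<in>{..<n}. borel))
      (\<lambda>\<omega>. (\<lambda>i\<in>{..<n}. D i \<omega>, \<lambda>i\<in>{..<n}. V i \<omega>)) = (\<Pi>\<^sub>M i\<in>{..<n}. ?J) \<Otimes>\<^sub>M (\<Pi>\<^sub>M i\<in>{..<n}. ?U)"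
  proof -
    have "distr M (\<Pi>\<^sub>M i\<in>{..<n}. ?L) (\<lambda>\<omega>. \<lambda>i\<in>{..<n}. D i \<omega>) = (\<Pi>\<^sub>M i\<in>{..<n}. distr M ?L (D i))"
      using iD mD ne by (subst indep_vars_iff_distr_eq_PiM'[symmetric]) (auto simp: D_def)
    also have "\<dots> = (\<Pi>\<^sub>M i\<in>{..<n}. ?J)" using dD by (intro PiM_cong) (auto simp: D_def)
    finally have 1: "distr M (\<Pi>\<^sub>M i\<in>{..<n}. ?L) (\<lambda>\<omega>. \<lambda>i\<in>{..<n}. D i \<omega>) = (\<Pi>\<^sub>M i\<in>{..<n}. ?J)" .
    have "distr M (\<Pi>\<^sub>M i\<in>{..<n}. borel) (\<lambda>\<omega>. \<lambda>i\<in>{..<n}. V i \<omega>) = (\<Pi>\<^sub>M i\<in>{..<n}. distr M borel (V i))"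
      using iV mV ne by (subst indep_vars_iff_distr_eq_PiM'[symmetric]) auto
    also have "\<dots> = (\<Pi>\<^sub>M i\<in>{..<n}. ?U)" using dV by (intro PiM_cong) auto
    finally have 2: "distr M (\<Pi>\<^sub>M i\<in>{..<n}. borel) (\<lambda>\<omega>. \<lambda>i\<in>{..<n}. V i \<omega>) = (\<Pi>\<^sub>M i\<in>{..<n}. ?U)" .
    show ?thesis using independent_rvs_distr[OF ind] 1 2 by (simp add: D_def)
  qed
  have sN: "sets N = sets (?L \<Otimes>\<^sub>M (borel :: real measure))"
    unfolding N_def using sJ by (intro sets_pair_measure_cong) auto
  have mY: "Y i \<in> M \<rightarrow>\<^sub>M N" if "i < n" for i
    unfolding measurable_cong_sets[OF refl sN] Y_def using mD[OF that] mV[OF that] by measurable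
  have indY: "prob {\<omega> \<in> space M. \<forall>i<n. Y i \<omega> \<in> C i} = (\<Prod>i<n. measure N (C i))"
    if C: "\<And>i. i < n \<Longrightarrow> C i \<in> sets N" for C
  proof -
    let ?P = "(\<Pi>\<^sub>M i\<in>{..<n}. ?J) \<Otimes>\<^sub>M (\<Pi>\<^sub>M i\<in>{..<n}. ?U)"
    let ?P' = "(\<Pi>\<^sub>M i\<in>{..<n}. ?L) \<Otimes>\<^sub>M (\<Pi>\<^sub>M i\<in>{..<n}. (borel :: real measure))"
    let ?C = "{w \<in> space ?P. \<forall>i\<in>{..<n}. (fst w i, snd w i) \<in> C i}"
    let ?DV = "\<lambda>\<omega>. (\<lambda>i\<in>{..<n}. D i \<omega>, \<lambda>i\<in>{..<n}. V i \<omega>)"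
    have mDV: "?DV \<in> M \<rightarrow>\<^sub>M ?P'" using mD mV by measurable
    have sP: "sets ?P = sets ?P'"
      using sJ by (intro sets_pair_measure_cong sets_PiM_cong) auto
    have "?C \<in> sets ?P"
    proof (intro predE pred_intros_finite finite_lessThan pred_sets2[OF C])
      fix i assume "i \<in> {..<n}"
      then show "(\<lambda>w. (fst w i, snd w i)) \<in> ?P \<rightarrow>\<^sub>M N"
        unfolding N_def
        by (intro measurable_Pair measurable_compose[OF measurable_fst measurable_component_singleton]
            measurable_compose[OF measurable_snd measurable_component_singleton])
    qed auto
    then have C': "?C \<in> sets ?P'" using sP by simp
    have "{\<omega> \<in> space M. \<forall>i<n. Y i \<omega> \<in> C i} = ?DV -` ?C \<inter> space M"
      using measurable_space[OF mDV] sets_eq_imp_space_eq[OF sP] by (auto simp: Y_def)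
    then have "emeasure M {\<omega> \<in> space M. \<forall>i<n. Y i \<omega> \<in> C i} = emeasure (distr M ?P' ?DV) ?C"
      using emeasure_distr[OF mDV C'] by simp
    also have "\<dots> = (\<Prod>i\<in>{..<n}. emeasure N (C i))"
      unfolding DV N_def
      by (rule emeasure_pair_PiM_rectangle)
        (use C in \<open>auto simp: N_def J.prob_space_axioms U.prob_space_axioms\<close>)
    also have "\<dots> = ennreal (\<Prod>i<n. measure N (C i))"
      unfolding N_def by (simp add: N.emeasure_eq_measure prod_ennreal)
    finally show ?thesis by (simp add: emeasure_eq_measure prod_nonneg)
  qed
  have Acc: "?Acc \<in> sets N" and mf: "f \<in> N \<rightarrow>\<^sub>M PS \<Otimes>\<^sub>M borel"
    unfolding N_def acc_def f_def using emeasure_accept(1,2)[OF PS pol fin B PR] E by auto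
  have accQ: "measure N {y \<in> ?Acc. f y \<in> F} = 1 / B * measure ?Q F" if F: "F \<in> sets ?Q" for F
  proof -
    have "emeasure N {y \<in> ?Acc. f y \<in> F} = ennreal (1 / B) * emeasure ?Q F"
      unfolding N_def acc_def f_def
      by (rule emeasure_accept(3)[OF PS pol fin B PR]) (use F sQ in simp)
    moreover have "0 < B" using ratio_bound_attained(1)[OF PS pol fin B] by simp
    ultimately show ?thesis unfolding measure_def by (simp add: enn2real_mult)
  qed
  have mf': "f \<in> N \<rightarrow>\<^sub>M ?Q" using mf by (simp add: measurable_cong_sets[OF refl sQ])
  have E': "E \<in> sets (\<Pi>\<^sub>M j\<in>{..<l}. ?Q)"
    using E sets_PiM_cong[of "{..<l}" "{..<l}" "\<lambda>_. ?Q" "\<lambda>_. PS \<Otimes>\<^sub>M borel"] sQ by simp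
  define I where "I = (\<lambda>\<omega>. {i. i < n \<and> Y i \<omega> \<in> ?Acc})"
  note law = rejection_law[OF PN Q mY indY Acc mf' accQ E']
  have X: "X \<omega> = map (\<lambda>i. f (Y i \<omega>)) (sorted_list_of_set (I \<omega>))" if "\<omega> \<in> space M" for \<omega>
  proof -
    have "I \<omega> = {i. i < n \<and> V i \<omega> \<le> weight \<pi>e \<pi>b (S i \<omega>) (A i \<omega>) / B}"
      unfolding I_def using measurable_space[OF mY that] by (auto simp: acc_def Y_def D_def)
    then show ?thesis
      by (simp add: X_def rejection_sample_eq_map_sorted_list_of_set f_def Y_def D_def)
  qed
  have W: "?W = {\<omega> \<in> space M. card (I \<omega>) = l \<and> (\<lambda>j\<in>{..<l}. f (Y (sorted_list_of_set (I \<omega>) ! j) \<omega>)) \<in> E}"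
  proof (intro Collect_cong conj_cong refl)
    fix \<omega> assume \<omega>: "\<omega> \<in> space M"
    show "length (X \<omega>) = l \<longleftrightarrow> card (I \<omega>) = l" by (simp add: X[OF \<omega>])
    assume "card (I \<omega>) = l"
    then have "(\<lambda>j\<in>{..<l}. X \<omega> ! j) = (\<lambda>j\<in>{..<l}. f (Y (sorted_list_of_set (I \<omega>) ! j) \<omega>))"
      by (intro restrict_ext) (simp add: X[OF \<omega>])
    then show "(\<lambda>j\<in>{..<l}. X \<omega> ! j) \<in> E \<longleftrightarrow> (\<lambda>j\<in>{..<l}. f (Y (sorted_list_of_set (I \<omega>) ! j) \<omega>)) \<in> E"
      by simp
  qed
  show "?W \<in> events" unfolding W I_def by (rule law(1)) auto
  show "prob ?W = pmf (binomial_pmf n (1 / B)) l * measure (\<Pi>\<^sub>M j\<in>{..<l}. ?Q) E"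
    unfolding W I_def by (rule law(2)) auto
qed

text \<open>The sample has random length, so the predicate is cut along the finitely many acceptance
  patterns \<open>I\<close> and splits \<open>J\<close>; on each piece all lists have fixed length.
  The inclusion for \<open>J\<close> is part of the predicate because the data space admits every
  subset of \<open>{..<n}\<close>, while the counting form of the interval speaks of actual
  positions only.\<close>

lemma pred_notin_conformal_interval:
  fixes \<pi>b \<pi>e :: "'s \<Rightarrow> 'a \<Rightarrow> real" and qhat :: "real \<Rightarrow> ('s \<times> real) list \<Rightarrow> 's \<Rightarrow> real" and n :: nat
    and B :: real
  assumes pol: "is_policy PS da \<pi>b" "is_policy PS da \<pi>e"
    and alg: "measurable_algorithm PS (qhat \<epsilon>lo)" "measurable_algorithm PS (qhat \<epsilon>up)" and "0 < \<delta>"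
  defines "RS \<equiv> \<lambda>d v. rejection_sample (weight \<pi>e \<pi>b) B n
      (\<lambda>i. fst (d i)) (\<lambda>i. fst (snd (d i))) (\<lambda>i. snd (snd (d i))) v"
  shows "Measurable.pred
    (((\<Pi>\<^sub>M i\<in>{..<n}. PS \<Otimes>\<^sub>M da \<Otimes>\<^sub>M borel) \<Otimes>\<^sub>M (\<Pi>\<^sub>M i\<in>{..<n}. borel)
      \<Otimes>\<^sub>M count_space (Pow {..<n})) \<Otimes>\<^sub>M (PS \<Otimes>\<^sub>M borel))
    (\<lambda>((d, v, J), s, r). J \<subseteq> {..<length (RS d v)} \<and>
      r \<notin> conformal_interval qhat \<epsilon>lo \<epsilon>up \<epsilon> \<delta> J (RS d v) s)"
    (is "Measurable.pred ?P ?p")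
proof -
  let ?L = "PS \<Otimes>\<^sub>M da \<Otimes>\<^sub>M (borel :: real measure)"
  let ?I = "\<lambda>d v. {i. i < n \<and> v i \<le> weight \<pi>e \<pi>b (fst (d i)) (fst (snd (d i))) / B}"
  define x where "x I d = (\<lambda>j\<in>{..<card I}. (fst (d (sorted_list_of_set I ! j)), snd (snd (d (sorted_list_of_set I ! j)))))"
    for I and d :: "nat \<Rightarrow> 's \<times> 'a \<times> real"
  define miss where "miss I J d z \<longleftrightarrow> Suc (card J) - nat (k_index (card J) \<epsilon> \<delta> + 1)
      \<le> card {i \<in> J. trained_score (qhat \<epsilon>lo) (qhat \<epsilon>up) (card I) J (x I d) (x I d i)
          < trained_score (qhat \<epsilon>lo) (qhat \<epsilon>up) (card I) J (x I d) z}" for I J d z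
  have RS: "RS d v = map (x (?I d v) d) [0..<card (?I d v)]" for d v
    unfolding RS_def rejection_sample_eq_map_sorted_list_of_set
    by (rule nth_equalityI) (auto simp: x_def)
  let ?p' = "\<lambda>w. \<exists>I\<in>Pow {..<n}. \<exists>J\<in>Pow {..<card I}.
      (\<forall>i\<in>{..<n}. fst (snd (fst w)) i \<le> weight \<pi>e \<pi>b (fst (fst (fst w) i)) (fst (snd (fst (fst w) i))) / B
        \<longleftrightarrow> i \<in> I)
      \<and> snd (snd (fst w)) = J \<and> miss I J (fst (fst w)) (snd w)"
  have "?p = ?p'"
  proof (rule ext)
    fix w :: "((nat \<Rightarrow> 's \<times> 'a \<times> real) \<times> (nat \<Rightarrow> real) \<times> nat set) \<times> 's \<times> real"
    obtain d v J s r where w: "w = ((d, v, J), s, r)" by (metis prod.collapse)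
    have "?p w \<longleftrightarrow> J \<subseteq> {..<card (?I d v)} \<and> miss (?I d v) J d (s, r)"
      unfolding w using notin_conformal_interval_iff[of J "card (?I d v)" \<delta> r qhat \<epsilon>lo \<epsilon>up \<epsilon> "x (?I d v) d" s] \<open>0 < \<delta>\<close>
      by (auto simp: RS miss_def)
    also have "\<dots> \<longleftrightarrow> ?p' w"
    proof
      assume "J \<subseteq> {..<card (?I d v)} \<and> miss (?I d v) J d (s, r)"
      then show "?p' w" unfolding w by (intro bexI[of _ "?I d v"] bexI[of _ J]) auto
    next
      assume "?p' w"
      then obtain I where I: "I \<in> Pow {..<n}" "J \<in> Pow {..<card I}" "miss I J d (s, r)"
        "\<forall>i\<in>{..<n}. v i \<le> weight \<pi>e \<pi>b (fst (d i)) (fst (snd (d i))) / B \<longleftrightarrow> i \<in> I"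
        unfolding w by auto
      then have "?I d v = I" by auto
      then show "J \<subseteq> {..<card (?I d v)} \<and> miss (?I d v) J d (s, r)" using I by simp
    qed
    finally show "?p w = ?p' w" .
  qed
  moreover have "Measurable.pred ?P ?p'"
  proof (intro pred_intros_finite finite_Pow_iff[THEN iffD2] finite_lessThan pred_intros_logic)
    fix I J assume I: "I \<in> Pow {..<n}" and J: "J \<in> Pow {..<card I}"
    have fI: "finite I" using I finite_subset by auto
    have fJ: "finite J" using J finite_subset by auto
    have md: "(\<lambda>w. fst (fst w) i) \<in> ?P \<rightarrow>\<^sub>M ?L" if "i < n" for i
    proof -
      have "(\<lambda>w. fst (fst w)) \<in> ?P \<rightarrow>\<^sub>M (\<Pi>\<^sub>M i\<in>{..<n}. ?L)" by measurable
      from measurable_compose[OF this measurable_component_singleton, of i] that show ?thesis by simp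
    qed
    have mv: "(\<lambda>w. fst (snd (fst w))) \<in> ?P \<rightarrow>\<^sub>M (\<Pi>\<^sub>M i\<in>{..<n}. borel)" by measurable
    { fix i assume "i \<in> {..<n}"
      then have i: "i < n" by simp
      note [measurable] = md[OF i]
      have [measurable]: "(\<lambda>w. fst (snd (fst w)) i) \<in> borel_measurable ?P"
        using measurable_compose[OF mv measurable_component_singleton, of i] i by simp
      have p: "(\<lambda>w. p (fst (fst (fst w) i)) (fst (snd (fst (fst w) i)))) \<in> borel_measurable ?P"
        if "is_policy PS da p" for p
      proof -
        have "(\<lambda>w. p (fst w) (snd w)) \<in> borel_measurable (PS \<Otimes>\<^sub>M da)"
          using that by (simp add: is_policy_def case_prod_beta')
        from measurable_compose[OF _ this, of "\<lambda>w. (fst (fst (fst w) i), fst (snd (fst (fst w) i)))" ?P]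
        show ?thesis by simp
      qed
      note [measurable] = p[OF pol(1)] p[OF pol(2)]
      show "Measurable.pred ?P (\<lambda>w. fst (snd (fst w)) i \<le> weight \<pi>e \<pi>b (fst (fst (fst w) i)) (fst (snd (fst (fst w) i))) / B)"
        unfolding weight_def by measurable }
    have "card I \<le> n" using I card_mono[of "{..<n}" I] by auto
    then have "J \<in> Pow {..<n}" using J by auto
    then have "{J} \<in> sets (count_space (Pow {..<n}))" by auto
    moreover have "(\<lambda>w. snd (snd (fst w))) \<in> ?P \<rightarrow>\<^sub>M count_space (Pow {..<n})" by measurable
    ultimately have "Measurable.pred ?P (\<lambda>w. snd (snd (fst w)) \<in> {J})" by (rule pred_sets2)
    then show "Measurable.pred ?P (\<lambda>w. snd (snd (fst w)) = J)" by simp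
    have sl: "sorted_list_of_set I ! j < n" if "j < card I" for j
    proof -
      have "sorted_list_of_set I ! j \<in> set (sorted_list_of_set I)" using that by (intro nth_mem) simp
      then show ?thesis using I fI by auto
    qed
    have mx: "(\<lambda>w. x I (fst (fst w))) \<in> ?P \<rightarrow>\<^sub>M (\<Pi>\<^sub>M j\<in>{..<card I}. PS \<Otimes>\<^sub>M borel)"
      unfolding x_def
    proof (rule measurable_restrict)
      fix j assume "j \<in> {..<card I}"
      then have [measurable]: "(\<lambda>w. fst (fst w) (sorted_list_of_set I ! j)) \<in> ?P \<rightarrow>\<^sub>M ?L"
        using sl md by auto
      show "(\<lambda>w. (fst (fst (fst w) (sorted_list_of_set I ! j)), snd (snd (fst (fst w) (sorted_list_of_set I ! j)))))
        \<in> ?P \<rightarrow>\<^sub>M PS \<Otimes>\<^sub>M borel" by measurable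
    qed
    have ts: "(\<lambda>w. trained_score (qhat \<epsilon>lo) (qhat \<epsilon>up) (card I) J (x I (fst (fst w))) (z w)) \<in> borel_measurable ?P"
      if "z \<in> ?P \<rightarrow>\<^sub>M PS \<Otimes>\<^sub>M borel" for z
      using measurable_compose[OF measurable_Pair[OF mx that] measurable_trained_score[OF alg]] by simp
    show "Measurable.pred ?P (\<lambda>w. miss I J (fst (fst w)) (snd w))"
      unfolding miss_def
    proof (intro pred_card_ge fJ borel_measurable_pred_less ts measurable_snd)
      fix i assume "i \<in> J"
      then show "(\<lambda>w. x I (fst (fst w)) i) \<in> ?P \<rightarrow>\<^sub>M PS \<Otimes>\<^sub>M borel"
        by (intro measurable_compose[OF mx measurable_component_singleton]) (use J in auto)
    qed
  qed auto
  ultimately show ?thesis by simp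
qed

subsection \<open>Coverage\<close>

text \<open>The term with \<open>7 * B\<close> strictly dominates \<open>B / sqrt \<gamma>\<close>,
  the price of the extra \<open>1\<close>, because
  \<open>(\<epsilon> - \<Delta>) * (1 - \<epsilon> + \<Delta>)\<close> is at most one; this is the
  source of the strict inequality. The second summand of \<open>C\<close> matches the Hoeffding term
  exactly, and \<open>B / 2\<close> covers \<open>b0\<close>.\<close>

lemma coverage_bound_arith:
  fixes \<epsilon> \<delta> \<gamma> \<Delta> B b0 m0 m1 C :: real and n :: nat
  assumes "0 < \<epsilon>" "\<epsilon> < 1" "0 < \<delta>" "\<delta> < 1" "0 < \<gamma>" "\<gamma> < 1" "0 < \<Delta>" "\<Delta> < \<epsilon>" "1 \<le> n" "1 \<le> B"
    and b0: "b0 \<le> B / (2 * sqrt (real n))"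
    and m1: "m1 = max m0 (ln \<delta> / (- 2 * \<Delta>\<^sup>2))"
    and C: "C = 7 * B / sqrt (\<gamma> * (\<epsilon> - \<Delta>) * (1 - \<epsilon> + \<Delta>))
      + (sqrt (- 2 * ln \<delta>) + 1) * B / (2 * \<Delta> * sqrt \<gamma>)
      + (1 - \<delta>) * (sqrt (real_of_int \<lfloor>m1 / \<gamma>\<rfloor> * B) + B / 2)"
  shows "1 - \<delta> - C / sqrt (real n)
    < (1 - \<delta>) * (1 - b0) - ((sqrt (- 2 * ln \<delta>) + 1) / (2 * \<Delta>) + 1) / sqrt \<gamma> * (B / sqrt (real n))"
proof -
  define a where "a = \<epsilon> - \<Delta>"
  have a: "0 < a" "a < 1" using assms by (auto simp: a_def)
  have sg: "0 < sqrt \<gamma>" and sn: "0 < sqrt (real n)" using assms by auto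
  have "\<gamma> * a * (1 - a) \<le> \<gamma> * 1 * 1" using a assms by (intro mult_mono) auto
  then have le: "sqrt (\<gamma> * a * (1 - a)) \<le> sqrt \<gamma>" by simp
  have "0 < \<gamma> * a * (1 - a)" using a assms by simp
  then have pos: "0 < sqrt (\<gamma> * a * (1 - a))" by simp
  have "B / sqrt \<gamma> < 7 * B / sqrt \<gamma>" using sg assms by (intro divide_strict_right_mono) auto
  also have "\<dots> \<le> 7 * B / sqrt (\<gamma> * a * (1 - a))"
    using le pos assms by (intro divide_left_mono) auto
  finally have 1: "B / sqrt \<gamma> < 7 * B / sqrt (\<gamma> * (\<epsilon> - \<Delta>) * (1 - \<epsilon> + \<Delta>))"
    by (simp add: a_def algebra_simps)
  \<comment> \<open>In HOL the root of a negative number is negative, so the sign of the floor term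
    has to be checked; \<open>m1\<close> is nonnegative as \<open>\<delta> < 1\<close>.\<close>
  have "0 \<le> ln \<delta> / (- 2 * \<Delta>\<^sup>2)" using assms by (intro divide_nonpos_nonpos) auto
  then have "0 \<le> m1 / \<gamma>" using assms(5) unfolding m1 by (intro divide_nonneg_pos) auto
  then have "0 \<le> real_of_int \<lfloor>m1 / \<gamma>\<rfloor> * B" using assms by (intro mult_nonneg_nonneg) auto
  then have 2: "(1 - \<delta>) * (B / 2) \<le> (1 - \<delta>) * (sqrt (real_of_int \<lfloor>m1 / \<gamma>\<rfloor> * B) + B / 2)"
    using assms by (intro mult_left_mono) auto
  have "((sqrt (- 2 * ln \<delta>) + 1) / (2 * \<Delta>) + 1) / sqrt \<gamma> * B
      = (sqrt (- 2 * ln \<delta>) + 1) * B / (2 * \<Delta> * sqrt \<gamma>) + B / sqrt \<gamma>"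
    using sg assms by (simp add: field_simps)
  with 1 2 have "((sqrt (- 2 * ln \<delta>) + 1) / (2 * \<Delta>) + 1) / sqrt \<gamma> * B + (1 - \<delta>) * (B / 2) < C"
    unfolding C by linarith
  from divide_strict_right_mono[OF this sn]
  have "((sqrt (- 2 * ln \<delta>) + 1) / (2 * \<Delta>) + 1) / sqrt \<gamma> * (B / sqrt (real n))
      + (1 - \<delta>) * (B / (2 * sqrt (real n))) < C / sqrt (real n)"
    by (simp add: add_divide_distrib)
  moreover have "(1 - \<delta>) * b0 \<le> (1 - \<delta>) * (B / (2 * sqrt (real n)))"
    using b0 assms by (intro mult_left_mono) auto
  ultimately show ?thesis by (simp add: algebra_simps)
qed

theorem theorem3:
  fixes PS :: "'s measure" and da :: "'a measure"
    and PR :: "'s \<Rightarrow> 'a \<Rightarrow> real measure"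
    and \<pi>b \<pi>e :: "'s \<Rightarrow> 'a \<Rightarrow> real"
    and M :: "'w measure"
    and S :: "nat \<Rightarrow> 'w \<Rightarrow> 's" and A :: "nat \<Rightarrow> 'w \<Rightarrow> 'a" and R V :: "nat \<Rightarrow> 'w \<Rightarrow> real"
    and Snew :: "'w \<Rightarrow> 's" and Rnew :: "'w \<Rightarrow> real"
    and T :: "'w \<Rightarrow> nat set"
    and qhat :: "real \<Rightarrow> ('s \<times> real) list \<Rightarrow> 's \<Rightarrow> real"
    and \<epsilon> \<delta> \<gamma> \<Delta> \<epsilon>lo \<epsilon>up B m0 m1 C :: real and n :: nat
    and Dataspace :: "((nat \<Rightarrow> 's \<times> 'a \<times> real) \<times> (nat \<Rightarrow> real) \<times> nat set) measure"
    and everything :: "'w \<Rightarrow> (nat \<Rightarrow> 's \<times> 'a \<times> real) \<times> (nat \<Rightarrow> real) \<times> nat set"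
    and Drs :: "'w \<Rightarrow> ('s \<times> real) list" and Chat :: "'w \<Rightarrow> 's \<Rightarrow> real set" and L :: "'w \<Rightarrow> real"
  assumes "0 < \<epsilon>" "\<epsilon> < 1" and "0 < \<delta>" "\<delta> < 1" and "0 < \<gamma>" "\<gamma> < 1"
    and "0 < \<Delta>" "\<Delta> < \<epsilon>" and "n \<ge> 1"
    and "\<epsilon>lo \<in> {0..1}" "\<epsilon>up \<in> {0..1}" "\<epsilon>up - \<epsilon>lo = 1 - \<epsilon>"
    \<comment> \<open>environment and policies\<close>
    and "prob_space PS"
    and "(\<lambda>(s, a). PR s a) \<in> PS \<Otimes>\<^sub>M da \<rightarrow>\<^sub>M prob_algebra borel"
    and "is_policy PS da \<pi>b" and "is_policy PS da \<pi>e"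
    and "ratio_bound PS da \<pi>e \<pi>b < \<infinity>"
    and "B = real_of_ereal (ratio_bound PS da \<pi>e \<pi>b)"
    \<comment> \<open>data and auxiliary uniform variables\<close>
    and "prob_space M"
    and "prob_space.indep_vars M (\<lambda>_. PS \<Otimes>\<^sub>M da \<Otimes>\<^sub>M borel) (\<lambda>i \<omega>. (S i \<omega>, A i \<omega>, R i \<omega>)) {..<n}"
    and "\<And>i. i < n \<Longrightarrow>
      distr M (PS \<Otimes>\<^sub>M da \<Otimes>\<^sub>M borel) (\<lambda>\<omega>. (S i \<omega>, A i \<omega>, R i \<omega>)) = joint_law PS da PR \<pi>b"
    and "prob_space.indep_vars M (\<lambda>_. borel) V {..<n}"
    and "\<And>i. i < n \<Longrightarrow> distr M borel (V i) = uniform_measure lborel {0..1}"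
    and "independent_rvs M
      (\<Pi>\<^sub>M i\<in>{..<n}. PS \<Otimes>\<^sub>M da \<Otimes>\<^sub>M borel) (\<lambda>\<omega>. \<lambda>i\<in>{..<n}. (S i \<omega>, A i \<omega>, R i \<omega>))
      (\<Pi>\<^sub>M i\<in>{..<n}. borel) (\<lambda>\<omega>. \<lambda>i\<in>{..<n}. V i \<omega>)"
    \<comment> \<open>rejection sampling and split\<close>
    and "Drs = (\<lambda>\<omega>. rejection_sample (weight \<pi>e \<pi>b) B n
      (\<lambda>i. S i \<omega>) (\<lambda>i. A i \<omega>) (\<lambda>i. R i \<omega>) (\<lambda>i. V i \<omega>))"
    and "T \<in> M \<rightarrow>\<^sub>M count_space (Pow {..<n})"
    and "\<And>\<omega>. \<omega> \<in> space M \<Longrightarrow> T \<omega> \<subseteq> {..<length (Drs \<omega>)}"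
    and "\<And>\<omega>. \<omega> \<in> space M \<Longrightarrow> int (card (T \<omega>)) = \<lceil>\<gamma> * real (length (Drs \<omega>))\<rceil>"
    and "value_independent_split M (PS \<Otimes>\<^sub>M borel) Drs T"
    \<comment> \<open>training and calibration\<close>
    and "measurable_algorithm PS (qhat \<epsilon>lo)" and "measurable_algorithm PS (qhat \<epsilon>up)"
    and "AE \<omega> in M. distinct (calibration_scores qhat \<epsilon>lo \<epsilon>up (T \<omega>) (Drs \<omega>))"
    and "Chat = (\<lambda>\<omega>. conformal_interval qhat \<epsilon>lo \<epsilon>up \<epsilon> \<delta> (T \<omega>) (Drs \<omega>))"
    \<comment> \<open>test pair and miscoverage\<close>
    and "Dataspace = (\<Pi>\<^sub>M i\<in>{..<n}. PS \<Otimes>\<^sub>M da \<Otimes>\<^sub>M borel) \<Otimes>\<^sub>M (\<Pi>\<^sub>M i\<in>{..<n}. borel)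
      \<Otimes>\<^sub>M count_space (Pow {..<n})"
    and "everything = (\<lambda>\<omega>. (\<lambda>i\<in>{..<n}. (S i \<omega>, A i \<omega>, R i \<omega>), \<lambda>i\<in>{..<n}. V i \<omega>, T \<omega>))"
    and "distr M (PS \<Otimes>\<^sub>M borel) (\<lambda>\<omega>. (Snew \<omega>, Rnew \<omega>)) = context_reward_law PS da PR \<pi>e"
    and "independent_rvs M Dataspace everything (PS \<Otimes>\<^sub>M borel) (\<lambda>\<omega>. (Snew \<omega>, Rnew \<omega>))"
    and "L = cond_miscoverage M Dataspace everything Chat Snew Rnew"
    \<comment> \<open>constants\<close>
    and "m0 = log (1 - \<epsilon>) \<delta>"
    and "m1 = max m0 (ln \<delta> / (- 2 * \<Delta>\<^sup>2))"
    and "C = 7 * B / sqrt (\<gamma> * (\<epsilon> - \<Delta>) * (1 - \<epsilon> + \<Delta>))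
      + (sqrt (- 2 * ln \<delta>) + 1) * B / (2 * \<Delta> * sqrt \<gamma>)
      + (1 - \<delta>) * (sqrt (real_of_int \<lfloor>m1 / \<gamma>\<rfloor> * B) + B / 2)"
  shows "\<P>(\<omega> in M. \<epsilon> - \<Delta> < L \<omega> \<and> L \<omega> \<le> \<epsilon>) > 1 - \<delta> - C / sqrt (real n)"
proof -
  interpret prob_space M by fact
  note \<epsilon>\<delta> = assms(1-9)
  note PS = assms(13) and PR = assms(14) and pol = assms(15,16) and ratio = assms(17,18)
  note Drs = assms(25) and mT = assms(26) and T_sub = assms(27) and T_card = assms(28) and vis = assms(29)
  note alg = assms(30,31) and no_ties = assms(32) and Chat = assms(33)
  define Q where "Q = context_reward_law PS da PR \<pi>e"
  define K where "K = PS \<Otimes>\<^sub>M (borel :: real measure)"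
  \<comment> \<open>The target law is a probability measure because it is the law of the test
    pair.\<close>
  have "(\<lambda>\<omega>. (Snew \<omega>, Rnew \<omega>)) \<in> M \<rightarrow>\<^sub>M K"
    using assms(37) by (simp add: independent_rvs_def K_def)
  then have Q_prob: "prob_space Q"
    unfolding Q_def assms(36)[symmetric] K_def by (rule prob_space_distr)
  interpret Q: prob_space Q by (rule Q_prob)
  have sQ: "sets Q = sets K" by (simp add: Q_def K_def context_reward_law_def)
  have spQ: "space Q = space K" by (rule sets_eq_imp_space_eq[OF sQ])
  have sPi: "sets (\<Pi>\<^sub>M j\<in>{..<l}. Q) = sets (\<Pi>\<^sub>M j\<in>{..<l}. K)" for l :: nat
    using sQ by (intro sets_PiM_cong) auto
  have spPi: "space (\<Pi>\<^sub>M j\<in>{..<l}. Q) = space (\<Pi>\<^sub>M j\<in>{..<l}. K)" for l :: nat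
    by (rule sets_eq_imp_space_eq[OF sPi])
  have Pi_prob: "prob_space (\<Pi>\<^sub>M j\<in>{..<l}. Q)" for l :: nat
    by (rule prob_space_PiM) (rule Q_prob)
  define p where "p = 1 / B"
  have B1: "1 \<le> B" by (rule ratio_bound_attained(1)[OF PS pol ratio])
  have p: "0 < p" "p \<le> 1" using B1 by (auto simp: p_def)
  define b where "b = pmf (binomial_pmf n p)"
  define x where "x l \<omega> = (\<lambda>j\<in>{..<l}. Drs \<omega> ! j)" for l :: nat and \<omega>

  have law: "{\<omega> \<in> space M. length (Drs \<omega>) = l \<and> x l \<omega> \<in> E} \<in> events"
    "prob {\<omega> \<in> space M. length (Drs \<omega>) = l \<and> x l \<omega> \<in> E} = b l * measure (\<Pi>\<^sub>M j\<in>{..<l}. Q) E"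
    if E: "E \<in> sets (\<Pi>\<^sub>M j\<in>{..<l}. K)" for l E
    using rejection_sample_law[OF PS PR pol ratio assms(9,20-24) Q_prob[unfolded Q_def] E[unfolded K_def]]
    unfolding b_def p_def x_def Q_def Drs by simp_all
  have x_space: "x (length (Drs \<omega>)) \<omega> \<in> space (\<Pi>\<^sub>M j\<in>{..<length (Drs \<omega>)}. K)"
    if \<omega>: "\<omega> \<in> space M" for \<omega>
  proof -
    have "(S i \<omega>, R i \<omega>) \<in> space K" if "i < n" for i
    proof -
      have "(\<lambda>\<omega>. (S i \<omega>, A i \<omega>, R i \<omega>)) \<in> M \<rightarrow>\<^sub>M PS \<Otimes>\<^sub>M da \<Otimes>\<^sub>M borel"
        using assms(20) that by (auto simp: indep_vars_def)
      from measurable_space[OF this \<omega>] show ?thesis by (simp add: K_def space_pair_measure)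
    qed
    then have "set (Drs \<omega>) \<subseteq> space K" by (auto simp: Drs rejection_sample_def)
    then show ?thesis by (auto simp: x_def space_PiM dest: nth_mem)
  qed
  have map_x: "Drs \<omega> = map (x (length (Drs \<omega>)) \<omega>) [0..<length (Drs \<omega>)]" for \<omega>
    by (rule nth_equalityI) (auto simp: x_def)
  have length: "{\<omega> \<in> space M. length (Drs \<omega>) = l} \<in> events"
    "prob {\<omega> \<in> space M. length (Drs \<omega>) = l} = b l" for l
  proof -
    have "{\<omega> \<in> space M. length (Drs \<omega>) = l}
        = {\<omega> \<in> space M. length (Drs \<omega>) = l \<and> x l \<omega> \<in> space (\<Pi>\<^sub>M j\<in>{..<l}. K)}"
      using x_space by auto
    moreover have "measure (\<Pi>\<^sub>M j\<in>{..<l}. Q) (space (\<Pi>\<^sub>M j\<in>{..<l}. K)) = 1"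
      using prob_space.prob_space[OF Pi_prob[of l]] by (simp add: spPi)
    ultimately show "{\<omega> \<in> space M. length (Drs \<omega>) = l} \<in> events"
      "prob {\<omega> \<in> space M. length (Drs \<omega>) = l} = b l"
      using law[of "space (\<Pi>\<^sub>M j\<in>{..<l}. K)" l] by simp_all
  qed

  \<comment> \<open>Joint masses instead of conditional probabilities of the split: they may vanish
    for some \<open>l\<close> and \<open>J\<close> without spoiling the identities below.\<close>
  define q where "q l J = prob {\<omega> \<in> space M. T \<omega> = J \<and> length (Drs \<omega>) = l}" for l J
  have mTJ: "{\<omega> \<in> space M. T \<omega> = J} \<in> events" for J
  proof (cases "J \<subseteq> {..<n}")
    case True
    then have "T -` {J} \<inter> space M \<in> events" by (intro measurable_sets[OF mT]) auto
    moreover have "T -` {J} \<inter> space M = {\<omega> \<in> space M. T \<omega> = J}" by auto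
    ultimately show ?thesis by simp
  next
    case False
    then have "{\<omega> \<in> space M. T \<omega> = J} = {}" using measurable_space[OF mT] by auto
    then show ?thesis by (simp only: sets.empty_sets)
  qed
  have mTl: "{\<omega> \<in> space M. T \<omega> = J \<and> length (Drs \<omega>) = l} \<in> events" for J l
    using sets.Int[OF mTJ[of J] length(1)[of l]] by (simp add: Collect_conj_eq Int_ac)
  have TlE: "{\<omega> \<in> space M. (T \<omega> = J \<and> x l \<omega> \<in> E) \<and> length (Drs \<omega>) = l} \<in> events" (is "?ev \<in> _")
    "prob {\<omega> \<in> space M. (T \<omega> = J \<and> x l \<omega> \<in> E) \<and> length (Drs \<omega>) = l} = q l J * measure (\<Pi>\<^sub>M j\<in>{..<l}. Q) E"
    if E: "E \<in> sets (\<Pi>\<^sub>M j\<in>{..<l}. K)" for l J E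
  proof -
    have "?ev = {\<omega> \<in> space M. T \<omega> = J} \<inter> {\<omega> \<in> space M. length (Drs \<omega>) = l \<and> x l \<omega> \<in> E}" by auto
    then show "?ev \<in> events" using mTJ law(1)[OF E] by auto
    show "prob ?ev = q l J * measure (\<Pi>\<^sub>M j\<in>{..<l}. Q) E"
    \<comment> \<open>Conditional probabilities given a null event are zero by convention, so for
      \<open>b l = 0\<close> the split condition is empty, but both sides vanish. Otherwise
      \<open>b l\<close> is multiplied out.\<close>
    proof (cases "b l = 0")
      case True
      have "prob ?ev \<le> b l" unfolding length(2)[symmetric]
        by (intro finite_measure_mono length(1)) auto
      moreover have "q l J \<le> b l" unfolding q_def length(2)[symmetric]
        by (intro finite_measure_mono length(1)) auto
      moreover have "0 \<le> q l J" by (simp add: q_def)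
      ultimately have "q l J = 0" "prob ?ev = 0"
        using True measure_nonneg[of M ?ev] by linarith+
      then show ?thesis by simp
    next
      case False
      have "prob ?ev / b l = (q l J / b l) * (b l * measure (\<Pi>\<^sub>M j\<in>{..<l}. Q) E / b l)"
        using vis[unfolded value_independent_split_def, rule_format, OF E[unfolded K_def], of J]
        unfolding cond_prob_def length(2) q_def law(2)[OF E, symmetric] x_def[symmetric]
        by (simp add: conj_commute)
      then show ?thesis using False by simp
    qed
  qed
  have q_sum: "(\<Sum>J\<in>Pow {..<l}. q l J) = b l" for l
  proof -
    have "prob {\<omega> \<in> space M. length (Drs \<omega>) = l}
        = prob (\<Union>J\<in>Pow {..<l}. {\<omega> \<in> space M. T \<omega> = J \<and> length (Drs \<omega>) = l})"
      using T_sub by (intro arg_cong[where f=prob]) auto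
    also have "\<dots> = (\<Sum>J\<in>Pow {..<l}. q l J)"
      unfolding q_def
      by (rule finite_measure_finite_Union) (use mTl in \<open>auto simp: disjoint_family_on_def\<close>)
    finally show ?thesis by (simp add: length(2))
  qed

  define \<sigma> where "\<sigma> l J = trained_score (qhat \<epsilon>lo) (qhat \<epsilon>up) l J" for l J
  define g where "g l J y = Q.prob {z \<in> space Q. Suc (card J) - nat (k_index (card J) \<epsilon> \<delta> + 1)
    \<le> card {i \<in> J. \<sigma> l J y (y i) < \<sigma> l J y z}}" for l J y
  define G where "G l J = {y \<in> space (\<Pi>\<^sub>M j\<in>{..<l}. Q). \<epsilon> - \<Delta> < g l J y \<and> g l J y \<le> \<epsilon>}" for l J
  have m\<sigma>: "(\<lambda>(y, z). \<sigma> l J y z) \<in> borel_measurable ((\<Pi>\<^sub>M i\<in>{..<l}. Q) \<Otimes>\<^sub>M Q)" for l J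
    using measurable_trained_score[OF alg, of l J]
    unfolding \<sigma>_def by (simp add: measurable_cong_sets[OF sets_pair_measure_cong[OF sPi sQ] refl] K_def)
  have G: "G l J \<in> sets (\<Pi>\<^sub>M j\<in>{..<l}. K)" if "J \<subseteq> {..<l}" for l J
  proof -
    have "g l J \<in> borel_measurable (\<Pi>\<^sub>M i\<in>{..<l}. Q)"
      unfolding g_def by (rule Q.measurable_prob_card_less[OF _ that m\<sigma>]) simp
    then have "G l J \<in> sets (\<Pi>\<^sub>M j\<in>{..<l}. Q)" unfolding G_def by measurable
    then show ?thesis by (simp add: sPi)
  qed

  define c where "c = (sqrt (- 2 * ln \<delta>) + 1) / (2 * \<Delta>) + 1"
  have c0: "0 \<le> c" unfolding c_def using \<epsilon>\<delta> by (intro add_nonneg_nonneg divide_nonneg_nonneg) auto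
  \<comment> \<open>The hypothesis concerns the experiment. There, ties together with size
    \<open>l\<close> and split \<open>J\<close> have probability \<open>q l J\<close> times the
    product measure of \<open>Z\<close>, so \<open>Z\<close> is null once \<open>q l J\<close> is
    nonzero.\<close>
  have inj: "AE y in (\<Pi>\<^sub>M j\<in>{..<l}. Q). inj_on (\<lambda>i. \<sigma> l J y (y i)) J"
    if J: "J \<subseteq> {..<l}" and q0: "q l J \<noteq> 0" for l J
  proof -
    interpret Pl: prob_space "\<Pi>\<^sub>M j\<in>{..<l}. Q" by (rule Pi_prob)
    have fJ: "finite J" using J finite_subset by auto
    define Z where "Z = {y \<in> space (\<Pi>\<^sub>M j\<in>{..<l}. Q). \<not> inj_on (\<lambda>i. \<sigma> l J y (y i)) J}"
    have comp: "(\<lambda>y. \<sigma> l J y (y i)) \<in> borel_measurable (\<Pi>\<^sub>M j\<in>{..<l}. Q)" if "i \<in> J" for i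
    proof -
      have "(\<lambda>y. y i) \<in> (\<Pi>\<^sub>M j\<in>{..<l}. Q) \<rightarrow>\<^sub>M Q"
        using that J by (intro measurable_component_singleton) auto
      from measurable_compose[OF measurable_Pair[OF measurable_ident this] m\<sigma>] show ?thesis by simp
    qed
    have "Z = {y \<in> space (\<Pi>\<^sub>M j\<in>{..<l}. Q).
        \<exists>i\<in>J. \<exists>j\<in>J. i \<noteq> j \<and> \<sigma> l J y (y i) = \<sigma> l J y (y j)}"
      by (auto simp: Z_def inj_on_def)
    also have "\<dots> \<in> sets (\<Pi>\<^sub>M j\<in>{..<l}. Q)"
    proof (intro predE pred_intros_finite fJ pred_intros_logic)
      fix i j assume "i \<in> J" "j \<in> J"
      from borel_measurable_eq[OF comp[OF this(1)] comp[OF this(2)]]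
      show "Measurable.pred (\<Pi>\<^sub>M j\<in>{..<l}. Q) (\<lambda>y. \<sigma> l J y (y i) = \<sigma> l J y (y j))"
        by (simp only: pred_def)
    qed auto
    finally have Z: "Z \<in> sets (\<Pi>\<^sub>M j\<in>{..<l}. Q)" .
    then have ZK: "Z \<in> sets (\<Pi>\<^sub>M j\<in>{..<l}. K)" by (simp add: sPi)
    have "prob {\<omega> \<in> space M. (T \<omega> = J \<and> x l \<omega> \<in> Z) \<and> length (Drs \<omega>) = l} = 0"
    proof (subst prob_eq_0[OF TlE(1)[OF ZK]])
      show "AE \<omega> in M. \<omega> \<notin> {\<omega> \<in> space M. (T \<omega> = J \<and> x l \<omega> \<in> Z) \<and> length (Drs \<omega>) = l}"
        using no_ties
      proof eventually_elim
        case (elim \<omega>)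
        show ?case
        proof
          assume *: "\<omega> \<in> {\<omega> \<in> space M. (T \<omega> = J \<and> x l \<omega> \<in> Z) \<and> length (Drs \<omega>) = l}"
          then have "distinct (calibration_scores qhat \<epsilon>lo \<epsilon>up J (map (x l \<omega>) [0..<l]))"
            using elim map_x[of \<omega>] by auto
          then show False
            unfolding distinct_calibration_scores_iff[OF J] using * by (auto simp: Z_def \<sigma>_def)
        qed
      qed
    qed
    then have "Pl.prob Z = 0" using TlE(2)[OF ZK, of J] q0 by simp
    then have "AE y in (\<Pi>\<^sub>M j\<in>{..<l}. Q). y \<notin> Z" using Pl.prob_eq_0[OF Z] by simp
    then show ?thesis using AE_space by eventually_elim (auto simp: Z_def)
  qed
  \<comment> \<open>The factor \<open>q l J\<close> makes null cases trivial. In the others some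
    outcome realises \<open>l\<close> and \<open>J\<close>, which reveals the size of
    \<open>J\<close>; by the ceiling it is at least \<open>\<gamma> * l\<close>.\<close>
  have good: "q l J * (1 - \<delta> - c / sqrt (\<gamma> * real l)) \<le> q l J * measure (\<Pi>\<^sub>M j\<in>{..<l}. Q) (G l J)"
    if J: "J \<subseteq> {..<l}" and l: "1 \<le> l" for l J
  proof (cases "q l J = 0")
    case False
    have "{\<omega> \<in> space M. T \<omega> = J \<and> length (Drs \<omega>) = l} \<noteq> {}"
      using False unfolding q_def by (metis measure_empty)
    then obtain \<omega> where "\<omega> \<in> space M" "T \<omega> = J" "length (Drs \<omega>) = l" by auto
    from T_card[OF this(1)] this have cJ: "int (card J) = \<lceil>\<gamma> * real l\<rceil>" by simp
    have pos: "0 < \<gamma> * real l" using \<epsilon>\<delta> l by simp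
    have "real_of_int (int (card J)) \<ge> \<gamma> * real l" unfolding cJ by (rule le_of_int_ceiling)
    then have ge: "\<gamma> * real l \<le> real (card J)" by simp
    then have J1: "1 \<le> card J" using pos by linarith
    have "1 - \<delta> - c / sqrt (\<gamma> * real l) \<le> 1 - \<delta> - c / sqrt (real (card J))"
      using divide_left_mono[of "sqrt (\<gamma> * real l)" "sqrt (real (card J))" c] c0 ge pos by simp
    also have "\<dots> \<le> measure (\<Pi>\<^sub>M j\<in>{..<l}. Q) (G l J)"
      unfolding G_def g_def c_def
      by (rule Q.prob_miscoverage_between[OF _ _ _ _ _ _ J m\<sigma> _ inj[OF J False] J1])
        (use \<epsilon>\<delta> in \<open>auto simp: \<sigma>_def intro: trained_score_cong\<close>)
    finally show ?thesis by (intro mult_left_mono) (auto simp: q_def)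
  qed simp

  define W where "W = {\<omega> \<in> space M. \<epsilon> - \<Delta> < L \<omega> \<and> L \<omega> \<le> \<epsilon>}"
  \<comment> \<open>Conditioning is on \<open>everything\<close>, so the procedure is re-expressed
    as a function of that variable alone. Indices from \<open>n\<close> on are never read, hence
    restriction to \<open>{..<n}\<close> changes nothing.\<close>
  define RS where "RS = (\<lambda>d v. rejection_sample (weight \<pi>e \<pi>b) B n
      (\<lambda>i. fst (d i)) (\<lambda>i. fst (snd (d i))) (\<lambda>i. snd (snd (d i))) v)"
  define miss where "miss = (\<lambda>(d, v, J) (s, r). J \<subseteq> {..<length (RS d v)} \<and>
      r \<notin> conformal_interval qhat \<epsilon>lo \<epsilon>up \<epsilon> \<delta> J (RS d v) s)"
  have RS: "RS (\<lambda>i\<in>{..<n}. (S i \<omega>, A i \<omega>, R i \<omega>)) (\<lambda>i\<in>{..<n}. V i \<omega>) = Drs \<omega>" for \<omega>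
  proof -
    have "filter (\<lambda>i. V i \<omega> \<le> weight \<pi>e \<pi>b (S i \<omega>) (A i \<omega>) / B) [0..<n]
      = filter (\<lambda>i. (\<lambda>i\<in>{..<n}. V i \<omega>) i \<le> weight \<pi>e \<pi>b (fst ((\<lambda>i\<in>{..<n}. (S i \<omega>, A i \<omega>, R i \<omega>)) i))
          (fst (snd ((\<lambda>i\<in>{..<n}. (S i \<omega>, A i \<omega>, R i \<omega>)) i))) / B) [0..<n]"
      by (rule filter_cong) auto
    then show ?thesis unfolding RS_def Drs rejection_sample_def by (auto intro!: map_cong)
  qed
  have pm: "Measurable.pred (Dataspace \<Otimes>\<^sub>M K) (\<lambda>(y, z). miss y z)"
  proof -
    have "(\<lambda>(y, z). miss y z) = (\<lambda>((d, v, J), s, r). J \<subseteq> {..<length (RS d v)} \<and>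
      r \<notin> conformal_interval qhat \<epsilon>lo \<epsilon>up \<epsilon> \<delta> J (RS d v) s)"
      by (auto simp: miss_def fun_eq_iff)
    then show ?thesis
      unfolding assms(34) K_def RS_def
      using pred_notin_conformal_interval[OF pol alg \<open>0 < \<delta>\<close>, where n=n and B=B and \<epsilon>=\<epsilon>] by simp
  qed
  have Chat_miss: "Rnew \<omega> \<notin> Chat \<omega> (Snew \<omega>) \<longleftrightarrow> miss (everything \<omega>) (Snew \<omega>, Rnew \<omega>)"
    if "\<omega> \<in> space M" for \<omega>
    using T_sub[OF that] by (simp add: Chat assms(35) miss_def RS)
  note cond = AE_cond_miscoverage[where r=Rnew and C=Chat and s=Snew, OF assms(37)[folded K_def] pm Chat_miss,
      folded assms(38), unfolded K_def assms(36), folded Q_def K_def]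
  have L_eq: "AE \<omega> in M. L \<omega> = Q.prob {z \<in> space K. miss (everything \<omega>) z}"
    by (rule cond(1))
  have mL: "L \<in> borel_measurable M" by (rule cond(2))
  have W: "W \<in> events" unfolding W_def using mL by measurable
  \<comment> \<open>Given all data the test pair is a fresh draw from \<open>Q\<close>, so the
    miscoverage is the mass \<open>g\<close> at the realised size, split and sample.\<close>
  have AE_L: "AE \<omega> in M. L \<omega> = g (length (Drs \<omega>)) (T \<omega>) (x (length (Drs \<omega>)) \<omega>)"
    using L_eq AE_space
  proof eventually_elim
    case (elim \<omega>)
    have "miss (everything \<omega>) z \<longleftrightarrow> Suc (card (T \<omega>)) - nat (k_index (card (T \<omega>)) \<epsilon> \<delta> + 1)
      \<le> card {i \<in> T \<omega>. \<sigma> (length (Drs \<omega>)) (T \<omega>) (x (length (Drs \<omega>)) \<omega>) (x (length (Drs \<omega>)) \<omega> i)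
          < \<sigma> (length (Drs \<omega>)) (T \<omega>) (x (length (Drs \<omega>)) \<omega>) z}" for z
    proof -
      obtain s r where z: "z = (s, r)" by (cases z)
      have "miss (everything \<omega>) z \<longleftrightarrow> r \<notin> conformal_interval qhat \<epsilon>lo \<epsilon>up \<epsilon> \<delta> (T \<omega>) (Drs \<omega>) s"
        using T_sub[OF elim(2)] by (simp add: z assms(35) miss_def RS)
      then show ?thesis
        using notin_conformal_interval_iff[OF T_sub[OF elim(2)] \<open>0 < \<delta>\<close>, of r qhat \<epsilon>lo \<epsilon>up \<epsilon>
            "x (length (Drs \<omega>)) \<omega>" s]
        by (simp add: map_x[symmetric] \<sigma>_def z)
    qed
    then show ?case using elim(1) by (simp add: g_def spQ)
  qed

  \<comment> \<open>Size zero is left out: without calibration points the interval is the whole line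
    and its miscoverage is zero, below \<open>\<epsilon> - \<Delta>\<close>. The lost mass shows up
    as the factor \<open>1 - b 0\<close>.\<close>
  let ?I = "SIGMA l:{1..n}. Pow {..<l}"
  define F where "F = (\<lambda>(l, J). {\<omega> \<in> space M. (T \<omega> = J \<and> x l \<omega> \<in> G l J) \<and> length (Drs \<omega>) = l})"
  have F: "F i \<in> events" if "i \<in> ?I" for i
    using that TlE(1)[OF G] by (auto simp: F_def)
  have "(1 - \<delta>) * (1 - b 0) - c / sqrt \<gamma> * (B / sqrt (real n))
      \<le> (\<Sum>l=1..n. b l * (1 - \<delta> - c / sqrt (\<gamma> * real l)))"
  proof -
    have "(\<Sum>l\<le>n. b l) = b 0 + (\<Sum>l=1..n. b l)"
      by (simp add: sum.atMost_shift sum.atLeast1_atMost_eq)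
    moreover have "(\<Sum>l\<le>n. b l) = 1" unfolding b_def using p by (intro sum_pmf_binomial) auto
    ultimately have sb: "(\<Sum>l=1..n. b l) = 1 - b 0" by simp
    have "(\<Sum>l=1..n. b l / sqrt (real l)) \<le> 1 / (p * sqrt (real n))"
      unfolding b_def by (rule sum_pmf_binomial_inverse_sqrt_le) (use p \<epsilon>\<delta> in auto)
    then have "c / sqrt \<gamma> * (\<Sum>l=1..n. b l / sqrt (real l)) \<le> c / sqrt \<gamma> * (B / sqrt (real n))"
      using c0 \<epsilon>\<delta> by (intro mult_left_mono) (auto simp: p_def)
    moreover have "(\<Sum>l=1..n. b l * (1 - \<delta> - c / sqrt (\<gamma> * real l)))
      = (1 - \<delta>) * (\<Sum>l=1..n. b l) - c / sqrt \<gamma> * (\<Sum>l=1..n. b l / sqrt (real l))"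
      unfolding sum_distrib_left sum_subtractf[symmetric]
      by (intro sum.cong) (auto simp: real_sqrt_mult algebra_simps)
    ultimately show ?thesis unfolding sb by simp
  qed
  also have "\<dots> = (\<Sum>l=1..n. \<Sum>J\<in>Pow {..<l}. q l J * (1 - \<delta> - c / sqrt (\<gamma> * real l)))"
    by (simp only: q_sum sum_distrib_right[symmetric])
  also have "\<dots> \<le> (\<Sum>l=1..n. \<Sum>J\<in>Pow {..<l}. q l J * measure (\<Pi>\<^sub>M j\<in>{..<l}. Q) (G l J))"
    by (intro sum_mono good) auto
  also have "\<dots> = (\<Sum>l=1..n. \<Sum>J\<in>Pow {..<l}. prob (F (l, J)))"
    using TlE(2)[OF G] by (intro sum.cong refl) (auto simp: F_def)
  also have "\<dots> = (\<Sum>i\<in>?I. prob (F i))" by (subst sum.Sigma) auto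
  also have "\<dots> = prob (\<Union>i\<in>?I. F i)"
    by (rule finite_measure_finite_Union[symmetric])
      (use F in \<open>auto simp: F_def disjoint_family_on_def\<close>)
  also have "\<dots> \<le> prob W"
  proof (rule finite_measure_mono_AE[OF _ W])
    show "AE \<omega> in M. \<omega> \<in> (\<Union>i\<in>?I. F i) \<longrightarrow> \<omega> \<in> W"
      using AE_L by eventually_elim (auto simp: F_def W_def G_def)
  qed
  finally have main: "(1 - \<delta>) * (1 - b 0) - c / sqrt \<gamma> * (B / sqrt (real n)) \<le> prob W" .
  have "b 0 \<le> B / (2 * sqrt (real n))"
    using pmf_binomial_0_le[OF p, of n] \<epsilon>\<delta> by (simp add: b_def p_def)
  from coverage_bound_arith[OF \<epsilon>\<delta> B1 this assms(40,41)] main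
  show ?thesis unfolding c_def W_def by linarith
qed

end
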